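(* Let $k>0$ and let $y$ be the solution of $$-y''+qy=-k^2y,\quad x>0;\qquad y(x)=e^{-kx}\ \text{ for } x>a.$$ Then the control $f=W^{-1}y$ (i.e. the control $f\in\mathcal{F}$ for which $u^f(\cdot,0)=y$ in the scattering system) is the solution of the equation $Cf=e^{-k(\cdot)}$ in $\mathcal{F}$, i.e. it satisfies $$f(\tau)+\int_0^\infty r(\tau+s)f(s)\,ds=e^{-k\tau},\qquad\tau\geqslant0.$$
   Context: All functions are real. Let $q\in C^\infty[0,\infty)$ with $\operatorname{supp}q\subset[0,a]$, $a<\infty$. Consider the scattering problem $$u_{tt}-u_{xx}+qu=0,\ \ x>0,\ -\infty<t<x;\qquad u|_{t<-x}=0;\qquad \lim_{s\to\infty}u(s,\tau-s)=f(\tau),\ \tau\geqslant0$$ (no boundary condition at $x=0$ is imposed). For $f\in C^\infty[0,\infty)$ vanishing near $\tau=0$ it has a unique classical smooth solution $u=u^f(x,t)$. For $f=\delta$ (the Dirac delta-function) the fundamental solution has the form $u^\delta(x,t)=\delta(x+t)+w(x,t)$, and for $x>a$ one has $u^\delta(x,t)=\delta(x+t)+r(x-t)$ with $r\in C^\infty[0,\infty)$, $\operatorname{supp}r\subset[0,2a]$; this defines the function $r$. The classical solutions satisfy the Duhamel formula $u^f=u^\delta*f$ (convolution in time, functions extended by zero to negative arguments), i.e. $u^f(x,t)=f(x+t)+\int_0^{x+t}w(x,t-s)f(s)\,ds$, and for $f\in L_2(0,\infty)$ the solution $u^f$ is defined by this formula. Spaces: $\mathcal{F}=L_2(0,\infty)$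 (controls) and $\mathcal{H}=L_2(0,\infty)$ (functions of $x$). Control operator: $W:\mathcal{F}\to\mathcal{H}$, $(Wf)(x)=u^f(x,0)=f(x)+\int_0^xw(x,-s)f(s)\,ds$, $x\geqslant0$; it is an isomorphism of $\mathcal{F}$ onto $\mathcal{H}$. Connecting operator: $C=W^*W:\mathcal{F}\to\mathcal{F}$; it is a positive definite isomorphism of $\mathcal{F}$, and $C=\mathbb{I}+R$, where $\mathbb{I}$ is the identity and $(Rf)(\tau)=\int_0^\infty r(\tau+s)f(s)\,ds$. *)

theory Defs
  imports "HOL-Analysis.Analysis"
begin

(* C^infinity up to the boundary of S: f is differentiable relative to S, and so is every iterated
   directional derivative. On the sets used below (the half-line, a closed sector, the plane) the
   derivative relative to S is unique, also at boundary points. *)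
coinductive smooth_on :: "'a::real_normed_vector set \<Rightarrow> ('a \<Rightarrow> real) \<Rightarrow> bool"
  for S :: "'a set"
where
  "(\<And>p. p \<in> S \<Longrightarrow> (f has_derivative f' p) (at p within S)) \<Longrightarrow>
   (\<And>v. smooth_on S (\<lambda>p. f' p v)) \<Longrightarrow> smooth_on S f"

text \<open>Points of the space-time plane are pairs \<open>(x, t)\<close>.\<close>

definition scattering_domain :: "(real \<times> real) set" where
  "scattering_domain = {(x, t). 0 < x \<and> t < x}"

definition wave_operator :: "(real \<Rightarrow> real) \<Rightarrow> (real \<times> real \<Rightarrow> real) \<Rightarrow> real \<times> real \<Rightarrow> real" where
  "wave_operator q u = (\<lambda>(x, t).
     (deriv ^^ 2) (\<lambda>s. u (x, s)) t - (deriv ^^ 2) (\<lambda>z. u (z, t)) x + q x * u (x, t))"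

definition test_functions :: "(real \<times> real) set \<Rightarrow> (real \<times> real \<Rightarrow> real) set" where
  "test_functions D = {\<phi>. smooth_on UNIV \<phi> \<and>
     compact (closure {p. \<phi> p \<noteq> 0}) \<and> closure {p. \<phi> p \<noteq> 0} \<subseteq> D}"

text \<open>Action of the distribution \<open>\<delta>(x + t) + w(x, t)\<close> on a test function on the scattering domain.\<close>

definition delta_plus :: "(real \<times> real \<Rightarrow> real) \<Rightarrow> (real \<times> real \<Rightarrow> real) \<Rightarrow> real" where
  "delta_plus w \<phi> = (LINT x|lebesgue_on {0<..}. \<phi> (x, - x))
     + (LINT p|lebesgue_on scattering_domain. w p * \<phi> p)"

(* The distribution delta(x + t) + w solves the scattering problem for the control f = delta.
   The wave equation holds in the sense of distributions (the wave operator is formally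
   self-adjoint). Along the line x + t = tau the distribution is delta(tau) + w(s, tau - s), so
   attaining the datum delta as s tends to infinity means that the regular part tends to 0.
   The values of w on the front t = -x are limits from the side t > -x. *)
definition fundamental_solution :: "(real \<Rightarrow> real) \<Rightarrow> (real \<times> real \<Rightarrow> real) \<Rightarrow> bool" where
  "fundamental_solution q w \<longleftrightarrow>
     smooth_on {(x, t). \<bar>t\<bar> \<le> x} w \<and>
     (\<forall>\<phi>\<in>test_functions scattering_domain. delta_plus w (wave_operator q \<phi>) = 0) \<and>
     (\<forall>x>0. \<forall>t. t < - x \<longrightarrow> w (x, t) = 0) \<and>
     (\<forall>\<tau>\<ge>0. ((\<lambda>s. w (s, \<tau> - s)) \<longlongrightarrow> 0) at_top)"

definition response_function :: "real \<Rightarrow> (real \<times> real \<Rightarrow> real) \<Rightarrow> (real \<Rightarrow> real) \<Rightarrow> bool" where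
  "response_function a w r \<longleftrightarrow>
     smooth_on {0..} r \<and> closure {s. 0 \<le> s \<and> r s \<noteq> 0} \<subseteq> {0..2 * a} \<and>
     (\<forall>x>a. \<forall>t<x. w (x, t) = r (x - t))"

(* Elements of L2(0,infinity) are represented by functions; equality in the space is equality
   almost everywhere on the half-line. *)
abbreviation half_line :: "real measure" where
  "half_line \<equiv> lebesgue_on {0..}"

definition L2 :: "(real \<Rightarrow> real) set" where
  "L2 = {f \<in> borel_measurable half_line. integrable half_line (\<lambda>x. (f x)\<^sup>2)}"

definition L2_inner :: "(real \<Rightarrow> real) \<Rightarrow> (real \<Rightarrow> real) \<Rightarrow> real" where
  "L2_inner f g = (LINT x|half_line. f x * g x)"

text \<open>The solution \<open>u\<^sup>f\<close> given by the Duhamel formula, with \<open>f\<close> extended by zero to negative arguments.\<close>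

definition wave :: "(real \<times> real \<Rightarrow> real) \<Rightarrow> (real \<Rightarrow> real) \<Rightarrow> real \<Rightarrow> real \<Rightarrow> real" where
  "wave w f x t = (if 0 \<le> x + t then f (x + t) else 0)
     + (LINT s|lebesgue_on {0..x + t}. w (x, t - s) * f s)"

definition control_operator :: "(real \<times> real \<Rightarrow> real) \<Rightarrow> (real \<Rightarrow> real) \<Rightarrow> real \<Rightarrow> real" where
  "control_operator w f = (\<lambda>x. wave w f x 0)"

text \<open>\<open>adjoint_maps A g h\<close> says that \<open>h = A\<^sup>* g\<close> in \<open>L\<^sub>2(0,\<infinity>)\<close>.\<close>

definition adjoint_maps ::
    "((real \<Rightarrow> real) \<Rightarrow> real \<Rightarrow> real) \<Rightarrow> (real \<Rightarrow> real) \<Rightarrow> (real \<Rightarrow> real) \<Rightarrow> bool" where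
  "adjoint_maps A g h \<longleftrightarrow> h \<in> L2 \<and> (\<forall>\<phi>\<in>L2. L2_inner (A \<phi>) g = L2_inner \<phi> h)"

text \<open>\<open>connecting_maps w f h\<close> says that \<open>C f = h\<close> for \<open>C = W\<^sup>* W\<close>.\<close>

definition connecting_maps ::
    "(real \<times> real \<Rightarrow> real) \<Rightarrow> (real \<Rightarrow> real) \<Rightarrow> (real \<Rightarrow> real) \<Rightarrow> bool" where
  "connecting_maps w f h \<longleftrightarrow> adjoint_maps (control_operator w) (control_operator w f) h"

definition decaying_solution ::
    "(real \<Rightarrow> real) \<Rightarrow> real \<Rightarrow> real \<Rightarrow> (real \<Rightarrow> real) \<Rightarrow> bool" where
  "decaying_solution q a k y \<longleftrightarrow>
     (\<exists>y' y''. \<forall>x>0. (y has_real_derivative y' x) (at x) \<and> (y' has_real_derivative y'' x) (at x) \<and>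
        - y'' x + q x * y x = - k\<^sup>2 * y x) \<and>
     (\<forall>x>a. y x = exp (- k * x))"

end

theory Submission
  imports Defs
begin

text \<open>The adjoint \<open>W\<^sup>*\<close> pairs a function \<open>Y\<close> with the fundamental solution at earlier times:
\<open>(W\<^sup>* Y)(\<tau>) = Y \<tau> + \<integral> w (x, -\<tau>) Y x dx\<close> over \<open>x > \<tau>\<close>. Testing the wave equation for
\<open>\<delta>(x + t) + w\<close> against products \<open>Y x \<cdot> \<alpha> (-t)\<close> shows that \<open>Y'' = q Y + Z\<close> implies
\<open>(W\<^sup>* Y)'' = W\<^sup>* Z\<close> in the weak sense (\<open>wave_adjoint_weak\<close>). Both assertions about \<open>C = W\<^sup>* W\<close>
come from this one fact.

For the decaying solution, \<open>Y = y\<close> and \<open>Z = k\<^sup>2 y\<close>, so \<open>v = W\<^sup>* y\<close> solves \<open>v'' = k\<^sup>2 v\<close> weakly. Beyond \<open>a\<close>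
the response function cuts off the integral and \<open>v \<tau> = y \<tau> = exp (- k \<tau>)\<close>; hence this holds for
all \<open>\<tau> > 0\<close> (\<open>wave_adjoint_decaying_solution\<close>), and \<open>C f = W\<^sup>* (W f) = W\<^sup>* y\<close> is the exponential.

That \<open>C = I + R\<close> is the statement that \<open>\<Gamma> (s, \<tau>) = (W\<^sup>* w (\<sqdot>, -s)) \<tau>\<close> equals \<open>r (s + \<tau>)\<close> for
\<open>|s| < \<tau>\<close> (\<open>gram_kernel_eq_response\<close>). In the variable \<open>s\<close>, smeared by a test function, \<open>w (\<sqdot>, -s)\<close>
solves \<open>Y'' = q Y + Z\<close> with \<open>Z\<close> the smeared second time derivative, so \<open>\<Gamma>\<close> solves the
one-dimensional wave equation in \<open>(s, \<tau>)\<close>; so does \<open>r (s + \<tau>)\<close>, and the two agree for \<open>\<tau> > a\<close>. Both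
characteristics issuing from a point of the cone \<open>|s| < \<tau>\<close> towards larger \<open>\<tau>\<close> remain in the cone, so
they agree everywhere. Times \<open>t = -s > 0\<close> occur here, although \<open>C\<close> itself involves only \<open>s \<ge> 0\<close>:
the upward characteristics leave the quadrant.

The equations for \<open>W\<^sup>* Y\<close> and for \<open>\<Gamma>\<close> are only known in weak form. They are solved by
moving the test function instead of the solution (\<open>transport_integral_zero\<close>): the integral against
a translated test function is constant along the flow, and vanishes once the support has
reached the region where the solution is known.

Uniqueness follows because \<open>(C h, h)\<close> is the squared norm of \<open>W h\<close> and \<open>W\<close> is the identity plus a Volterra
operator with bounded kernel, hence injective (\<open>Volterra_injective\<close>). Boundedness holds because \<open>w (x, -s)\<close> with
\<open>s \<ge> 0\<close> vanishes for \<open>x > 2 a\<close> and \<open>w\<close> is continuous on the closed sector.\<close>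

section \<open>Smooth functions\<close>

lemma smooth_on_derivativeE:
  assumes "smooth_on S f"
  obtains f' where "\<And>p. p \<in> S \<Longrightarrow> (f has_derivative f' p) (at p within S)"
    "\<And>v. smooth_on S (\<lambda>p. f' p v)"
  using assms by (cases rule: smooth_on.cases) auto

lemma smooth_on_cong:
  assumes "smooth_on S f" "\<And>p. p \<in> S \<Longrightarrow> g p = f p"
  shows "smooth_on S g"
proof -
  obtain f' where f': "\<And>p. p \<in> S \<Longrightarrow> (f has_derivative f' p) (at p within S)"
    "\<And>v. smooth_on S (\<lambda>p. f' p v)"
    using smooth_on_derivativeE[OF assms(1)] by blast
  show ?thesis
  proof (rule smooth_on.intros[of S g f'])
    show "(g has_derivative f' p) (at p within S)" if "p \<in> S" for p
      using f'(1)[OF that] that assms(2) by (rule has_derivative_transform[rotated 2]) auto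
  qed (rule f'(2))
qed

lemma smooth_on_subset:
  assumes "smooth_on S f" "T \<subseteq> S"
  shows "smooth_on T f"
  using assms(1)
proof (coinduction arbitrary: f)
  case smooth_on
  then obtain f' where "\<And>p. p \<in> S \<Longrightarrow> (f has_derivative f' p) (at p within S)"
    "\<And>v. smooth_on S (\<lambda>p. f' p v)"
    using smooth_on_derivativeE by blast
  then show ?case
    using assms(2) by (auto intro!: exI[of _ f'] intro: has_derivative_subset)
qed

lemma continuous_on_smooth:
  assumes "smooth_on S f"
  shows "continuous_on S f"
  using smooth_on_derivativeE[OF assms] has_derivative_continuous_on by metis

text \<open>The coinductive definition of smoothness is used through a principle up to algebraic
closure: a family of functions is smooth as soon as its first derivatives are polynomial
expressions in the family and in functions already known to be smooth.\<close>

inductive algebra_over :: "'a::real_normed_vector set \<Rightarrow> ('a \<Rightarrow> real) set \<Rightarrow> ('a \<Rightarrow> real) \<Rightarrow> bool"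
  for S G where
  gen: "g \<in> G \<Longrightarrow> algebra_over S G g"
| smooth: "smooth_on S g \<Longrightarrow> algebra_over S G g"
| const: "algebra_over S G (\<lambda>p. c)"
| add: "algebra_over S G f \<Longrightarrow> algebra_over S G g \<Longrightarrow> algebra_over S G (\<lambda>p. f p + g p)"
| mult: "algebra_over S G f \<Longrightarrow> algebra_over S G g \<Longrightarrow> algebra_over S G (\<lambda>p. f p * g p)"

text \<open>The closure under sums and products is itself a coinduction invariant, by the sum and product
rules; what remains is to differentiate each generator once.\<close>

lemma smooth_on_algebra:
  assumes gens: "\<And>g. g \<in> G \<Longrightarrow> \<exists>g'. (\<forall>p\<in>S. (g has_derivative g' p) (at p within S)) \<and>
      (\<forall>v. algebra_over S G (\<lambda>p. g' p v))"
    and "algebra_over S G f"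
  shows "smooth_on S f"
  using assms(2)
proof (coinduction arbitrary: f)
  case smooth_on
  then have "\<exists>f'. (\<forall>p\<in>S. (f has_derivative f' p) (at p within S)) \<and>
      (\<forall>v. algebra_over S G (\<lambda>p. f' p v))"
  proof induction
    case (gen g)
    then show ?case by (rule gens)
  next
    case (smooth g)
    obtain g' where "\<And>p. p \<in> S \<Longrightarrow> (g has_derivative g' p) (at p within S)"
      "\<And>v. smooth_on S (\<lambda>p. g' p v)"
      using smooth_on_derivativeE[OF smooth] by blast
    then show ?case
      by (auto intro!: exI[of _ g'] algebra_over.smooth)
  next
    case (const c)
    show ?case
      by (rule exI[of _ "\<lambda>p v. 0"]) (auto intro: algebra_over.const)
  next
    case (add f g)
    then obtain f' g' where "\<forall>p\<in>S. (f has_derivative f' p) (at p within S)"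
      "\<forall>p\<in>S. (g has_derivative g' p) (at p within S)"
      "\<forall>v. algebra_over S G (\<lambda>p. f' p v)" "\<forall>v. algebra_over S G (\<lambda>p. g' p v)"
      by blast
    then show ?case
      by (intro exI[of _ "\<lambda>p v. f' p v + g' p v"])
        (auto intro!: derivative_intros algebra_over.add)
  next
    case (mult f g)
    then obtain f' g' where "\<forall>p\<in>S. (f has_derivative f' p) (at p within S)"
      "\<forall>p\<in>S. (g has_derivative g' p) (at p within S)"
      "\<forall>v. algebra_over S G (\<lambda>p. f' p v)" "\<forall>v. algebra_over S G (\<lambda>p. g' p v)"
      by blast
    then show ?case
      using mult.hyps
      by (intro exI[of _ "\<lambda>p v. f p * g' p v + f' p v * g p"])
        (auto intro!: derivative_intros algebra_over.add algebra_over.mult)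
  qed
  then show ?case by auto
qed

lemma smooth_on_const: "smooth_on S (\<lambda>p. c)"
  by (rule smooth_on_algebra[where G = "{}"]) (simp, rule algebra_over.const)

lemma smooth_on_add: "smooth_on S f \<Longrightarrow> smooth_on S g \<Longrightarrow> smooth_on S (\<lambda>p. f p + g p)"
  by (rule smooth_on_algebra[where G = "{}"]) (simp, intro algebra_over.add algebra_over.smooth)

lemma smooth_on_mult: "smooth_on S f \<Longrightarrow> smooth_on S g \<Longrightarrow> smooth_on S (\<lambda>p. f p * g p)"
  by (rule smooth_on_algebra[where G = "{}"]) (simp, intro algebra_over.mult algebra_over.smooth)

lemma smooth_on_inverse:
  assumes f: "smooth_on S f" and nz: "\<And>p. p \<in> S \<Longrightarrow> f p \<noteq> 0"
  shows "smooth_on S (\<lambda>p. inverse (f p))"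
proof (rule smooth_on_algebra[where G = "{\<lambda>p. inverse (f p)}"])
  fix g assume g: "g \<in> {\<lambda>p. inverse (f p)}"
  obtain f' where f': "\<And>p. p \<in> S \<Longrightarrow> (f has_derivative f' p) (at p within S)"
    "\<And>v. smooth_on S (\<lambda>p. f' p v)"
    using smooth_on_derivativeE[OF f] by blast
  show "\<exists>g'. (\<forall>p\<in>S. (g has_derivative g' p) (at p within S)) \<and>
      (\<forall>v. algebra_over S {\<lambda>p. inverse (f p)} (\<lambda>p. g' p v))"
    using g f' nz
    by (intro exI[of _ "\<lambda>p v. (- 1) * ((inverse (f p) * f' p v) * inverse (f p))"] conjI ballI allI
        algebra_over.mult[OF algebra_over.const algebra_over.mult[OF algebra_over.mult[OF
            algebra_over.gen algebra_over.smooth] algebra_over.gen]])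
      (auto intro!: has_derivative_inverse[THEN has_derivative_eq_rhs])
qed (auto intro: algebra_over.gen)

lemma smooth_on_compose_affine:
  assumes "smooth_on T f" and A: "bounded_linear A" and sub: "\<And>p. p \<in> S \<Longrightarrow> A p + c \<in> T"
  shows "smooth_on S (\<lambda>p. f (A p + c))"
  using assms(1)
proof (coinduction arbitrary: f)
  case smooth_on
  then obtain f' where f': "\<And>p. p \<in> T \<Longrightarrow> (f has_derivative f' p) (at p within T)"
    "\<And>v. smooth_on T (\<lambda>p. f' p v)"
    by (rule smooth_on_derivativeE) auto
  have "((\<lambda>p. f (A p + c)) has_derivative (\<lambda>v. f' (A p + c) (A v))) (at p within S)" if "p \<in> S" for p
    by (rule has_derivative_in_compose[OF has_derivative_add_const[OF
            bounded_linear_imp_has_derivative[OF A]] has_derivative_subset[OF f'(1)[OF sub[OF that]]]])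
      (use sub in auto)
  moreover have "\<exists>f. (\<lambda>p. f' (A p + c) (A v)) = (\<lambda>p. f (A p + c)) \<and> smooth_on T f" for v
    using f'(2) by (intro exI[of _ "\<lambda>p. f' p (A v)"]) simp
  ultimately show ?case
    by (intro exI[of _ "\<lambda>p. f (A p + c)"] exI[of _ "\<lambda>p v. f' (A p + c) (A v)"]) blast
qed

lemma smooth_on_deriv:
  fixes S :: "real set"
  assumes "smooth_on S f" "open S"
  shows "\<And>x. x \<in> S \<Longrightarrow> (f has_real_derivative deriv f x) (at x)"
    and "smooth_on S (deriv f)"
proof -
  obtain f' where f': "\<And>p. p \<in> S \<Longrightarrow> (f has_derivative f' p) (at p within S)"
    "\<And>v. smooth_on S (\<lambda>p. f' p v)"
    using smooth_on_derivativeE[OF assms(1)] by blast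
  have *: "(f has_real_derivative f' x 1) (at x)" if "x \<in> S" for x
  proof -
    have d: "(f has_derivative f' x) (at x)"
      using f'(1)[OF that] by (simp only: at_within_open[OF that assms(2)])
    have "f' x = (*) (f' x 1)"
    proof
      fix h show "f' x h = f' x 1 * h"
        using linear_scale[OF has_derivative_linear[OF d], of h 1] by (simp only: real_scaleR_def mult_1_right mult.commute[of h])
    qed
    show ?thesis
      unfolding has_field_derivative_def by (fold \<open>f' x = (*) (f' x 1)\<close>) (rule d)
  qed
  show "(f has_real_derivative deriv f x) (at x)" if "x \<in> S" for x
    unfolding DERIV_imp_deriv[OF *[OF that]] by (rule *[OF that])
  show "smooth_on S (deriv f)"
    by (rule smooth_on_cong[OF f'(2)[of 1]]) (rule DERIV_imp_deriv[OF *])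
qed

text \<open>The pair \<open>y\<close>, \<open>y'\<close> generates an algebra that is closed under differentiation.\<close>

lemma smooth_on_linear_ode:
  fixes S :: "real set"
  assumes "smooth_on S c"
    and y: "\<And>x. x \<in> S \<Longrightarrow> (y has_real_derivative y1 x) (at x)"
    and y1: "\<And>x. x \<in> S \<Longrightarrow> (y1 has_real_derivative c x * y x) (at x)"
  shows "smooth_on S y"
proof (rule smooth_on_algebra[where G = "{y, y1}"])
  fix g assume "g \<in> {y, y1}"
  then consider "g = y" | "g = y1" by blast
  then show "\<exists>g'. (\<forall>p\<in>S. (g has_derivative g' p) (at p within S)) \<and>
      (\<forall>v. algebra_over S {y, y1} (\<lambda>p. g' p v))"
  proof cases
    case 1
    then show ?thesis
      using y by (intro exI[of _ "\<lambda>p v. y1 p * v"] conjI ballI allI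
          algebra_over.mult[OF algebra_over.gen algebra_over.const])
        (auto simp: has_field_derivative_def intro: has_derivative_at_withinI)
  next
    case 2
    then show ?thesis
      using y1 assms(1) by (intro exI[of _ "\<lambda>p v. (c p * y p) * v"] conjI ballI allI
          algebra_over.mult[OF algebra_over.mult[OF algebra_over.smooth algebra_over.gen] algebra_over.const])
        (auto simp: has_field_derivative_def intro: has_derivative_at_withinI)
  qed
qed (auto intro: algebra_over.gen)

text \<open>Makes a function that is smooth only on an open half-line usable as a factor of a test function.
Outside of the half-line \<open>g\<close> is arbitrary, but multiplied by a locally vanishing cutoff.\<close>

lemma smooth_on_extend_by_zero:
  fixes g h :: "real \<Rightarrow> real"
  assumes "smooth_on {b<..} g" "smooth_on UNIV h" "b < b'" "\<And>x. x \<le> b' \<Longrightarrow> h x = 0"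
  shows "smooth_on UNIV (\<lambda>x. g x * h x)"
proof -
  define G where "G = {\<lambda>x. g x * h x | g h. smooth_on {b<..} g \<and> smooth_on UNIV h \<and> (\<exists>b'>b. \<forall>x\<le>b'. h x = 0)}"
  show ?thesis
  proof (rule smooth_on_algebra[where G = G])
    show "algebra_over UNIV G (\<lambda>x. g x * h x)"
      using assms by (auto simp: G_def intro!: algebra_over.gen)
    fix f assume "f \<in> G"
    then obtain g h b' where f: "f = (\<lambda>x. g x * h x)" and g: "smooth_on {b<..} g"
      and h: "smooth_on UNIV h" "\<And>x. x \<le> b' \<Longrightarrow> h x = 0" and b': "b < b'"
      by (auto simp: G_def)
    have h': "deriv h x = 0" if "x < b'" for x
      by (rule DERIV_imp_deriv, rule has_field_derivative_transform_within_open[of "\<lambda>_. 0" _ _ "{..<b'}"])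
        (use that h(2) in auto)
    have "(f has_real_derivative deriv g x * h x + g x * deriv h x) (at x)" for x
    proof (cases "b < x")
      case True
      then show ?thesis
        unfolding f using smooth_on_deriv(1)[OF g, of x] smooth_on_deriv(1)[OF h(1), of x]
        by (auto intro!: derivative_eq_intros)
    next
      case False
      then have *: "x < b'" using b' by auto
      have "(f has_real_derivative 0) (at x)"
        by (rule has_field_derivative_transform_within_open[of "\<lambda>_. 0" _ _ "{..<b'}"])
          (use * h(2) in \<open>auto simp: f\<close>)
      then show ?thesis using * h h' by simp
    qed
    moreover have "algebra_over UNIV G (\<lambda>x. deriv g x * h x)"
      using g h b' smooth_on_deriv(2)[OF g] by (auto simp: G_def intro!: algebra_over.gen)
    moreover have "algebra_over UNIV G (\<lambda>x. g x * deriv h x)"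
      unfolding G_def using g h' dense[OF b'] smooth_on_deriv(2)[OF h(1)]
      by (intro algebra_over.gen) (fastforce)
    ultimately show "\<exists>f'. (\<forall>p\<in>UNIV. (f has_derivative f' p) (at p)) \<and>
        (\<forall>v. algebra_over UNIV G (\<lambda>p. f' p v))"
      by (intro exI[of _ "\<lambda>x v. (deriv g x * h x + g x * deriv h x) * v"])
        (auto simp: has_field_derivative_def
          intro!: algebra_over.mult[OF algebra_over.add algebra_over.const])
  qed
qed

section \<open>Cutoffs and test functions\<close>

text \<open>The index \<open>n\<close> keeps the family closed under differentiation.\<close>

definition flat_exp :: "nat \<Rightarrow> real \<Rightarrow> real" where
  "flat_exp n x = (if 0 < x then exp (- (1 / x)) / x ^ n else 0)"

lemma flat_exp_tendsto: "((\<lambda>x. flat_exp n x) \<longlongrightarrow> 0) (at 0)"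
proof -
  have "((\<lambda>x::real. x ^ n / exp x) \<longlongrightarrow> 0) at_top"
    by (rule tendsto_power_div_exp_0)
  then have "((\<lambda>x::real. inverse x ^ n / exp (inverse x)) \<longlongrightarrow> 0) (at_right 0)"
    by (rule filterlim_compose[OF _ filterlim_inverse_at_top_right])
  then have "(flat_exp n \<longlongrightarrow> 0) (at_right 0)"
    by (rule Lim_transform_eventually)
      (auto simp: flat_exp_def eventually_at_right_field exp_minus field_simps intro!: exI[of _ 1])
  moreover have "(flat_exp n \<longlongrightarrow> 0) (at_left 0)"
    by (rule Lim_transform_eventually[of "\<lambda>_. 0"])
      (auto simp: flat_exp_def eventually_at_left_field intro!: exI[of _ "-1"])
  ultimately show ?thesis
    by (simp add: filterlim_at_split)
qed

lemma flat_exp_derivative: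
  "(flat_exp n has_real_derivative flat_exp (n + 2) x - real n * flat_exp (n + 1) x) (at x)"
proof -
  consider "0 < x" | "x < 0" | "x = 0" by linarith
  then show ?thesis
  proof cases
    case 1
    have "((\<lambda>x. exp (- (1 / x)) / x ^ n) has_real_derivative flat_exp (n + 2) x - real n * flat_exp (n + 1) x) (at x)"
      using 1 by (auto intro!: derivative_eq_intros simp: flat_exp_def field_simps power2_eq_square)
        (cases n; simp add: field_simps)
    then show ?thesis
      by (rule has_field_derivative_transform_within_open[of _ _ _ "{0<..}"])
        (use 1 in \<open>auto simp: flat_exp_def\<close>)
  next
    case 2
    have "((\<lambda>x. 0) has_real_derivative flat_exp (n + 2) x - real n * flat_exp (n + 1) x) (at x)"
      using 2 by (simp add: flat_exp_def)
    then show ?thesis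
      by (rule has_field_derivative_transform_within_open[of _ _ _ "{..<0}"])
        (use 2 in \<open>auto simp: flat_exp_def\<close>)
  next
    case 3
    have "((\<lambda>h. (flat_exp n h - flat_exp n 0) / (h - 0)) \<longlongrightarrow> 0) (at 0)"
      by (rule Lim_transform_eventually[OF flat_exp_tendsto[of "n + 1"]])
        (auto simp: flat_exp_def eventually_at_filter)
    then show ?thesis
      using 3 by (simp add: has_field_derivative_iff flat_exp_def)
  qed
qed

lemma smooth_flat_exp: "smooth_on UNIV (flat_exp n)"
proof (rule smooth_on_algebra[where G = "range flat_exp"])
  fix g assume "g \<in> range flat_exp"
  then obtain n where g: "g = flat_exp n" by blast
  have "algebra_over UNIV (range flat_exp) (\<lambda>x. (flat_exp (n + 2) x + (- real n) * flat_exp (n + 1) x) * v)" for v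
    by (rule algebra_over.mult[OF algebra_over.add[OF algebra_over.gen
          algebra_over.mult[OF algebra_over.const algebra_over.gen]] algebra_over.const]) auto
  then show "\<exists>g'. (\<forall>p\<in>UNIV. (g has_derivative g' p) (at p)) \<and>
      (\<forall>v. algebra_over UNIV (range flat_exp) (\<lambda>p. g' p v))"
    using flat_exp_derivative[of n] g
    by (intro exI[of _ "\<lambda>x v. (flat_exp (n + 2) x + (- real n) * flat_exp (n + 1) x) * v"])
      (auto simp: has_field_derivative_def)
qed (auto intro: algebra_over.gen)

lemma smooth_step:
  fixes c d :: real
  assumes "c < d"
  obtains \<eta> where "smooth_on UNIV \<eta>" "\<And>x. x \<le> c \<Longrightarrow> \<eta> x = 0" "\<And>x. d \<le> x \<Longrightarrow> \<eta> x = (1::real)"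
proof
  let ?l = "\<lambda>x. flat_exp 0 (x - c)" and ?r = "\<lambda>x. flat_exp 0 (d - x)"
  have l: "smooth_on UNIV ?l"
    using smooth_on_compose_affine[OF smooth_flat_exp bounded_linear_ident, of UNIV "-c" 0] by simp
  have r: "smooth_on UNIV ?r"
    using smooth_on_compose_affine[OF smooth_flat_exp bounded_linear_minus[OF bounded_linear_ident], of UNIV d 0]
    by (simp add: algebra_simps)
  have "0 < ?l x + ?r x" for x
  proof (cases "c < x")
    case True
    then show ?thesis
      by (intro add_pos_nonneg) (auto simp: flat_exp_def)
  next
    case False
    then show ?thesis
      using assms by (intro add_nonneg_pos) (auto simp: flat_exp_def)
  qed
  then have "?l x + ?r x \<noteq> 0" for x
    by (metis less_irrefl)
  then show "smooth_on UNIV (\<lambda>x. ?l x * inverse (?l x + ?r x))"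
    by (intro smooth_on_mult smooth_on_inverse smooth_on_add l r)
qed (use assms in \<open>auto simp: flat_exp_def\<close>)

lemma smooth_bump:
  fixes c d :: real
  assumes "c < d"
  obtains \<psi> where "smooth_on UNIV \<psi>" "\<And>x. (\<psi> x :: real) \<ge> 0" "\<And>x. \<psi> x > 0 \<longleftrightarrow> c < x \<and> x < d"
proof
  let ?l = "\<lambda>x. flat_exp 0 (x - c)" and ?r = "\<lambda>x. flat_exp 0 (d - x)"
  have l: "smooth_on UNIV ?l"
    using smooth_on_compose_affine[OF smooth_flat_exp bounded_linear_ident, of UNIV "-c" 0] by simp
  have r: "smooth_on UNIV ?r"
    using smooth_on_compose_affine[OF smooth_flat_exp bounded_linear_minus[OF bounded_linear_ident], of UNIV d 0]
    by (simp add: algebra_simps)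
  show "smooth_on UNIV (\<lambda>x. ?l x * ?r x)"
    by (intro smooth_on_mult l r)
qed (auto simp: flat_exp_def)

text \<open>Vanishing at the end points is included, so that boundary terms disappear when integrating by parts
over the interval itself.\<close>

definition test_on :: "real \<Rightarrow> real \<Rightarrow> (real \<Rightarrow> real) \<Rightarrow> bool" where
  "test_on c d \<phi> \<longleftrightarrow> smooth_on UNIV \<phi> \<and> (\<forall>x. x \<le> c \<or> d \<le> x \<longrightarrow> \<phi> x = 0)"

lemma test_on_smooth: "test_on c d \<phi> \<Longrightarrow> smooth_on UNIV \<phi>"
  and test_on_zero: "test_on c d \<phi> \<Longrightarrow> x \<le> c \<or> d \<le> x \<Longrightarrow> \<phi> x = 0"
  by (auto simp: test_on_def)

lemma test_on_DERIV: "test_on c d \<phi> \<Longrightarrow> (\<phi> has_real_derivative deriv \<phi> x) (at x)"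
  using smooth_on_deriv(1)[OF test_on_smooth, of c d \<phi> x] by simp

lemma test_on_continuous: "test_on c d \<phi> \<Longrightarrow> continuous_on S \<phi>"
  using continuous_on_smooth[OF test_on_smooth] continuous_on_subset by blast

lemma test_on_mono: "test_on c d \<phi> \<Longrightarrow> c' \<le> c \<Longrightarrow> d \<le> d' \<Longrightarrow> test_on c' d' \<phi>"
  by (auto simp: test_on_def)

lemma test_on_deriv:
  assumes "test_on c d \<phi>"
  shows "test_on c d (deriv \<phi>)"
proof -
  have sm: "smooth_on UNIV (deriv \<phi>)"
    using smooth_on_deriv(2)[OF test_on_smooth[OF assms]] by simp
  then have cont: "continuous_on S (deriv \<phi>)" for S
    using continuous_on_smooth continuous_on_subset by blast
  have "deriv \<phi> x = 0" if "x < c" for x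
    by (rule DERIV_imp_deriv, rule has_field_derivative_transform_within_open[of "\<lambda>_. 0" _ _ "{..<c}"])
      (use that test_on_zero[OF assms] in auto)
  then have "deriv \<phi> x = 0" if "x \<le> c" for x
    using continuous_constant_on_closure[OF cont[of "closure {..<c}"], of 0 x] that by auto
  moreover have "deriv \<phi> x = 0" if "d < x" for x
    by (rule DERIV_imp_deriv, rule has_field_derivative_transform_within_open[of "\<lambda>_. 0" _ _ "{d<..}"])
      (use that test_on_zero[OF assms] in auto)
  then have "deriv \<phi> x = 0" if "d \<le> x" for x
    using continuous_constant_on_closure[OF cont[of "closure {d<..}"], of 0 x] that by auto
  ultimately show ?thesis
    using sm by (auto simp: test_on_def)
qed

lemma test_on_shift:
  assumes "test_on c d \<phi>"
  shows "test_on (c + h) (d + h) (\<lambda>x. \<phi> (x - h))" "deriv (\<lambda>x. \<phi> (x - h)) = (\<lambda>x. deriv \<phi> (x - h))"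
proof -
  show "test_on (c + h) (d + h) (\<lambda>x. \<phi> (x - h))"
    using smooth_on_compose_affine[OF test_on_smooth[OF assms] bounded_linear_ident, of UNIV "- h"]
      test_on_zero[OF assms] by (auto simp: test_on_def)
  show "deriv (\<lambda>x. \<phi> (x - h)) = (\<lambda>x. deriv \<phi> (x - h))"
  proof
    fix x
    show "deriv (\<lambda>x. \<phi> (x - h)) x = deriv \<phi> (x - h)"
      by (rule DERIV_imp_deriv, rule DERIV_chain2[OF test_on_DERIV[OF assms], THEN DERIV_cong])
        (auto intro!: derivative_eq_intros)
  qed
qed

lemma test_on_reflect:
  assumes "test_on c d \<phi>"
  shows "test_on (- d) (- c) (\<lambda>x. \<phi> (- x))" "deriv (deriv (\<lambda>x. \<phi> (- x))) = (\<lambda>x. deriv (deriv \<phi>) (- x))"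
proof -
  show "test_on (- d) (- c) (\<lambda>x. \<phi> (- x))"
    using smooth_on_compose_affine[OF test_on_smooth[OF assms] bounded_linear_minus[OF bounded_linear_ident], of UNIV 0]
      test_on_zero[OF assms] by (auto simp: test_on_def)
  have *: "deriv (\<lambda>x. \<phi> (- x)) = (\<lambda>x. - deriv \<phi> (- x))" if "test_on c d \<phi>" for \<phi>
  proof
    fix x
    show "deriv (\<lambda>x. \<phi> (- x)) x = - deriv \<phi> (- x)"
      by (rule DERIV_imp_deriv, rule DERIV_chain2[OF test_on_DERIV[OF that], THEN DERIV_cong])
        (auto intro!: derivative_eq_intros)
  qed
  show "deriv (deriv (\<lambda>x. \<phi> (- x))) = (\<lambda>x. deriv (deriv \<phi>) (- x))"
  proof
    fix x
    show "deriv (deriv (\<lambda>x. \<phi> (- x))) x = deriv (deriv \<phi>) (- x)"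
      unfolding *[OF assms]
      by (rule DERIV_imp_deriv, rule DERIV_minus[OF DERIV_chain2[OF test_on_DERIV[OF test_on_deriv[OF assms]]], THEN DERIV_cong])
        (auto intro!: derivative_eq_intros)
  qed
qed

lemma deriv_cong_open:
  assumes "open S" "x \<in> S" "\<And>y. y \<in> S \<Longrightarrow> f y = (g y :: real)"
  shows "deriv f x = deriv g x"
  by (rule deriv_cong_ev) (use assms eventually_nhds in blast)+

lemma integral_by_parts_test:
  assumes \<gamma>: "test_on c d \<gamma>" and "b < c" "c \<le> d"
    and Y: "smooth_on {b<..} Y"
  shows "integral {c..d} (\<lambda>x. deriv (deriv \<gamma>) x * Y x) = integral {c..d} (\<lambda>x. \<gamma> x * deriv (deriv Y) x)"
proof -
  note Y' = smooth_on_deriv[OF Y]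
  note Y'' = smooth_on_deriv[OF Y'(2)]
  have "((\<lambda>x. deriv (deriv \<gamma>) x * Y x - \<gamma> x * deriv (deriv Y) x) has_integral
      (deriv \<gamma> d * Y d - \<gamma> d * deriv Y d) - (deriv \<gamma> c * Y c - \<gamma> c * deriv Y c)) {c..d}"
  proof (rule fundamental_theorem_of_calculus[OF \<open>c \<le> d\<close>])
    fix x assume "x \<in> {c..d}"
    then have x: "x \<in> {b<..}" using assms by auto
    have "((\<lambda>x. deriv \<gamma> x * Y x - \<gamma> x * deriv Y x) has_real_derivative
      deriv (deriv \<gamma>) x * Y x - \<gamma> x * deriv (deriv Y) x) (at x)"
      using x by (auto intro!: derivative_eq_intros test_on_DERIV[OF \<gamma>] test_on_DERIV[OF test_on_deriv[OF \<gamma>]] Y'(1) Y''(1))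
    then show "((\<lambda>x. deriv \<gamma> x * Y x - \<gamma> x * deriv Y x) has_vector_derivative
      deriv (deriv \<gamma>) x * Y x - \<gamma> x * deriv (deriv Y) x) (at x within {c..d})"
      by (simp add: has_real_derivative_iff_has_vector_derivative has_vector_derivative_at_within)
  qed
  then have "integral {c..d} (\<lambda>x. deriv (deriv \<gamma>) x * Y x - \<gamma> x * deriv (deriv Y) x) = 0"
    using test_on_zero[OF \<gamma>] test_on_zero[OF test_on_deriv[OF \<gamma>]] by (simp add: integral_unique)
  moreover have sub: "{c..d} \<subseteq> {b<..}" using assms by auto
  have "continuous_on {c..d} Y" "continuous_on {c..d} (deriv (deriv Y))"
    using continuous_on_smooth[OF Y] continuous_on_smooth[OF Y''(2)] sub continuous_on_subset by auto
  then have "(\<lambda>x. deriv (deriv \<gamma>) x * Y x) integrable_on {c..d}" 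
    "(\<lambda>x. \<gamma> x * deriv (deriv Y) x) integrable_on {c..d}"
    by (auto intro!: integrable_continuous_real continuous_intros test_on_continuous[OF \<gamma>]
        test_on_continuous[OF test_on_deriv[OF test_on_deriv[OF \<gamma>]]])
  ultimately show ?thesis
    by (simp add: integral_diff)
qed

lemma test_bump:
  fixes x0 \<epsilon> :: real
  assumes "0 < \<epsilon>"
  obtains \<psi> where "test_on (x0 - \<epsilon>) (x0 + \<epsilon>) \<psi>" "\<And>x. 0 \<le> \<psi> x" "0 < \<psi> x0" "\<And>x. \<epsilon> \<le> dist x x0 \<Longrightarrow> \<psi> x = 0"
proof -
  have lt: "x0 - \<epsilon> < x0 + \<epsilon>" using assms by simp
  obtain \<psi> where \<psi>: "smooth_on UNIV \<psi>" "\<And>x. 0 \<le> (\<psi> x :: real)" "\<And>x. \<psi> x > 0 \<longleftrightarrow> x0 - \<epsilon> < x \<and> x < x0 + \<epsilon>"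
    using smooth_bump[OF lt] by blast
  have z: "\<psi> x = 0" if "\<not> (x0 - \<epsilon> < x \<and> x < x0 + \<epsilon>)" for x
    using \<psi>(2)[of x] \<psi>(3)[of x] that by auto
  show ?thesis
    using \<psi> assms by (intro that[of \<psi>]) (auto simp: test_on_def dist_real_def intro!: z)
qed

section \<open>Integration in the plane\<close>

lemma lborel_integral_indicator_Icc:
  fixes f :: "real \<Rightarrow> real"
  assumes "continuous_on {a..b} f"
  shows "(LINT x|lborel. indicator {a..b} x * f x) = integral {a..b} f"
  using set_borel_integral_eq_integral(2)[OF borel_integrable_atLeastAtMost'[OF assms]]
  by (simp add: set_lebesgue_integral_def)

lemma lebesgue_on_integral_indicator:
  fixes f :: "'a::euclidean_space \<Rightarrow> real"
  assumes S: "compact S" "continuous_on S f" and D: "D \<in> sets lebesgue" "S \<subseteq> D"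
    and g: "\<And>p. p \<in> D \<Longrightarrow> g p = indicator S p * f p"
  shows "(LINT p|lebesgue_on D. g p) = (LINT p|lborel. indicator S p * f p)"
proof -
  have "integrable lborel (\<lambda>p. indicator S p * f p)"
    using borel_integrable_compact[OF S] by simp
  then have m: "(\<lambda>p. indicator S p * f p) \<in> borel_measurable lborel"
    by (rule borel_measurable_integrable)
  have "(LINT p|lebesgue_on D. g p) = (LINT p|lebesgue_on D. indicator S p * f p)"
    by (rule Bochner_Integration.integral_cong) (auto simp: g)
  also have "\<dots> = (LINT p|lebesgue. indicator D p *\<^sub>R (indicator S p * f p))"
    using D(1) by (intro integral_restrict_space) auto
  also have "\<dots> = (LINT p|lebesgue. indicator S p * f p)"
    using D(2) by (intro Bochner_Integration.integral_cong) (auto split: split_indicator)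
  also have "\<dots> = (LINT p|lborel. indicator S p * f p)"
    by (rule integral_completion[OF m])
  finally show ?thesis .
qed

lemma planar_Fubini:
  fixes f :: "real \<times> real \<Rightarrow> real"
  assumes S: "compact S" "continuous_on S f"
  shows "(LINT p|lborel. indicator S p * f p) = (LINT t|lborel. (LINT x|lborel. indicator S (x, t) * f (x, t)))"
    "(LINT p|lborel. indicator S p * f p) = (LINT x|lborel. (LINT t|lborel. indicator S (x, t) * f (x, t)))"
proof -
  have int: "integrable (lborel \<Otimes>\<^sub>M lborel) (\<lambda>(x, t). indicator S (x, t) * f (x, t))"
    using borel_integrable_compact[OF S] by (simp add: lborel_prod case_prod_unfold)
  show "(LINT p|lborel. indicator S p * f p) = (LINT t|lborel. (LINT x|lborel. indicator S (x, t) * f (x, t)))"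
    using lborel_pair.integral_snd[OF int] by (simp add: lborel_prod case_prod_unfold)
  show "(LINT p|lborel. indicator S p * f p) = (LINT x|lborel. (LINT t|lborel. indicator S (x, t) * f (x, t)))"
    using lborel_pair.integral_fst[OF int] by (simp add: lborel_prod case_prod_unfold)
qed

text \<open>Replacing \<open>x\<close> by \<open>max x (g p)\<close> turns the moving limit into a fixed one, at the cost of an
explicit rectangle.\<close>

lemma continuous_on_integral_lower_limit:
  fixes H :: "real \<Rightarrow> 'a::t2_space \<Rightarrow> real"
  assumes "0 \<le> M" and g: "continuous_on U g" "\<And>p. p \<in> U \<Longrightarrow> 0 \<le> g p"
    and H: "continuous_on {(p, x). p \<in> U \<and> g p \<le> x} (\<lambda>(p, x). H x p)"
  shows "continuous_on U (\<lambda>p. integral {g p..M} (\<lambda>x. H x p))"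
proof -
  have "continuous_on (U \<times> cbox 0 M) ((\<lambda>(p, x). H x p) \<circ> (\<lambda>(p, x). (p, max x (g p))))"
    using g(1) by (intro continuous_on_compose continuous_on_subset[OF H])
     (auto intro!: continuous_intros continuous_on_compose2[OF g(1)] simp: case_prod_unfold)
  then have 1: "continuous_on U (\<lambda>p. integral (cbox 0 M) (\<lambda>x. H (max x (g p)) p))"
    by (intro integral_continuous_on_param) (simp add: o_def case_prod_unfold)
  have "continuous_on U ((\<lambda>(p, x). H x p) \<circ> (\<lambda>p. (p, g p)))"
    using g(1) by (intro continuous_on_compose continuous_on_subset[OF H]) (auto intro!: continuous_intros)
  then have 2: "continuous_on U (\<lambda>p. min (g p) M * H (g p) p)"
    by (intro continuous_intros g) (simp add: o_def)
  show ?thesis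
  proof (rule continuous_on_eq[OF continuous_on_diff[OF 1 2]])
    fix p assume p: "p \<in> U"
    define m where "m = min (g p) M"
    have m: "0 \<le> m" "m \<le> M" using g(2)[OF p] assms(1) by (auto simp: m_def)
    have "continuous_on {g p..} ((\<lambda>(p, x). H x p) \<circ> (\<lambda>x. (p, x)))"
      using p by (intro continuous_on_compose continuous_on_subset[OF H]) (auto intro!: continuous_intros)
    then have Hp: "continuous_on {g p..} (\<lambda>x. H x p)" by (simp add: o_def)
    have "continuous_on {0..M} (\<lambda>x. H (max x (g p)) p)"
      by (rule continuous_on_compose2[OF Hp]) (auto intro!: continuous_intros)
    then have "integral {0..M} (\<lambda>x. H (max x (g p)) p) =
        integral {0..m} (\<lambda>x. H (max x (g p)) p) + integral {m..M} (\<lambda>x. H (max x (g p)) p)"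
      using m by (intro Henstock_Kurzweil_Integration.integral_combine[symmetric] integrable_continuous_real) auto
    moreover have "integral {0..m} (\<lambda>x. H (max x (g p)) p) = integral {0..m} (\<lambda>x. H (g p) p)"
      by (rule integral_cong) (auto simp: m_def max_def)
    moreover have "integral {m..M} (\<lambda>x. H (max x (g p)) p) = integral {g p..M} (\<lambda>x. H x p)"
    proof (cases "g p \<le> M")
      case True
      then have "m = g p" by (simp add: m_def)
      then show ?thesis by (auto intro!: integral_cong simp: max_def)
    next
      case False
      then show ?thesis by (simp add: m_def)
    qed
    ultimately show "integral (cbox 0 M) (\<lambda>x. H (max x (g p)) p) - min (g p) M * H (g p) p
        = integral {g p..M} (\<lambda>x. H x p)"
      using m by (simp add: m_def)
  qed
qed

section \<open>Vanishing of weakly transported functions\<close>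

text \<open>A pointwise form of the fundamental lemma of the calculus of variations.\<close>

lemma zero_if_bump_integrals_zero:
  fixes D :: "'a::euclidean_space \<Rightarrow> real"
  assumes D: "continuous_on (cbox A B) D" and ne: "box A B \<noteq> {}" and p0: "p0 \<in> cbox A B"
    and \<zeta>: "\<And>\<epsilon>. 0 < \<epsilon> \<Longrightarrow> \<exists>\<zeta>. continuous_on (cbox A B) \<zeta> \<and> (\<forall>p. 0 \<le> \<zeta> p) \<and> 0 < \<zeta> p0 \<and>
      (\<forall>p. \<epsilon> \<le> dist p p0 \<longrightarrow> \<zeta> p = 0) \<and> integral (cbox A B) (\<lambda>p. D p * \<zeta> p) = 0"
  shows "D p0 = 0"
proof (rule ccontr)
  assume nz: "D p0 \<noteq> 0"
  then obtain \<epsilon> where \<epsilon>: "0 < \<epsilon>" "\<And>p. p \<in> cbox A B \<Longrightarrow> dist p p0 < \<epsilon> \<Longrightarrow> dist (D p) (D p0) < \<bar>D p0\<bar>"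
    using D p0 unfolding continuous_on_iff by (metis zero_less_abs_iff)
  obtain \<zeta> where \<zeta>: "continuous_on (cbox A B) \<zeta>" "\<And>p. 0 \<le> \<zeta> p" "0 < \<zeta> p0"
      "\<And>p. \<epsilon> \<le> dist p p0 \<Longrightarrow> \<zeta> p = 0" "integral (cbox A B) (\<lambda>p. D p * \<zeta> p) = 0"
    using assms(4)[OF \<epsilon>(1)] by blast
  let ?f = "\<lambda>p. sgn (D p0) * (D p * \<zeta> p)"
  have cont: "continuous_on (cbox A B) (\<lambda>p. D p * \<zeta> p)"
    by (intro continuous_intros D \<zeta>)
  then have "(?f has_integral 0) (cbox A B)"
    using has_integral_mult_right[OF integrable_integral[OF integrable_continuous[OF cont]], of "sgn (D p0)"] \<zeta>(5)
    by simp
  moreover have "0 \<le> ?f p" if "p \<in> box A B" for p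
  proof (cases "dist p p0 < \<epsilon>")
    case True
    then have "dist (D p) (D p0) < \<bar>D p0\<bar>"
      using \<epsilon>(2) that box_subset_cbox by blast
    then have "0 \<le> sgn (D p0) * D p"
      by (auto simp: dist_real_def sgn_if split: if_splits)
    then show ?thesis
      using \<zeta>(2)[of p] by (metis mult.assoc mult_nonneg_nonneg)
  next
    case False
    then show ?thesis using \<zeta>(4) by simp
  qed
  moreover have "continuous_on (cbox A B) ?f"
    by (intro continuous_intros cont)
  ultimately have "?f p0 = 0"
    using has_integral_0_cbox_imp_0[OF _ _ _ ne p0] by blast
  then show False
    using nz \<zeta>(3) by (simp add: sgn_if split: if_splits)
qed

text \<open>If \<open>D\<close> annihilates the derivative of \<open>\<zeta>\<close> in direction \<open>v\<close>, at every translate of \<open>\<zeta>\<close> along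
\<open>v\<close> up to time \<open>T\<close>, then the integral against the translates does not depend on time. This is the
integration along characteristics for a function \<open>D\<close> that is merely continuous.\<close>

lemma transport_integral_zero:
  fixes D :: "'a::euclidean_space \<Rightarrow> real"
  assumes D: "continuous_on (cbox A B) D"
    and \<zeta>: "\<And>p. (\<zeta> has_derivative \<zeta>' p) (at p)" and \<delta>: "\<And>p. \<zeta>' p v = \<delta> p" "continuous_on UNIV \<delta>"
    and T: "0 \<le> T"
    and flow: "\<And>\<sigma>. 0 \<le> \<sigma> \<Longrightarrow> \<sigma> \<le> T \<Longrightarrow> integral (cbox A B) (\<lambda>p. D p * \<delta> (p - \<sigma> *\<^sub>R v)) = 0"
    and final: "integral (cbox A B) (\<lambda>p. D p * \<zeta> (p - T *\<^sub>R v)) = 0"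
  shows "integral (cbox A B) (\<lambda>p. D p * \<zeta> p) = 0"
proof -
  let ?G = "\<lambda>\<sigma>. integral (cbox A B) (\<lambda>p. D p * \<zeta> (p - \<sigma> *\<^sub>R v))"
  have \<zeta>c: "continuous_on UNIV \<zeta>"
    using \<zeta> has_derivative_continuous_on by blast
  have "(?G has_real_derivative 0) (at \<sigma> within {0..T})" if "\<sigma> \<in> {0..T}" for \<sigma>
  proof -
    have "(?G has_real_derivative integral (cbox A B) (\<lambda>p. - (D p * \<delta> (p - \<sigma> *\<^sub>R v)))) (at \<sigma> within {0..T})"
    proof (rule leibniz_rule_field_derivative[OF _ _ _ that])
      fix \<sigma> p
      have "((\<lambda>\<sigma>. \<zeta> (p - \<sigma> *\<^sub>R v)) has_derivative (\<lambda>h. \<zeta>' (p - \<sigma> *\<^sub>R v) (- (h *\<^sub>R v)))) (at \<sigma> within {0..T})"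
        by (rule has_derivative_compose[OF _ \<zeta>]) (auto intro!: derivative_eq_intros)
      moreover have "\<zeta>' (p - \<sigma> *\<^sub>R v) (- (h *\<^sub>R v)) = - \<delta> (p - \<sigma> *\<^sub>R v) * h" for h
        using linear_cmul[OF has_derivative_linear[OF \<zeta>], of "p - \<sigma> *\<^sub>R v" "- h" v] \<delta>(1) by simp
      moreover have "(*) (- \<delta> (p - \<sigma> *\<^sub>R v)) = (\<lambda>h. - \<delta> (p - \<sigma> *\<^sub>R v) * h)"
        by (rule ext) simp
      ultimately have "((\<lambda>\<sigma>. \<zeta> (p - \<sigma> *\<^sub>R v)) has_real_derivative - \<delta> (p - \<sigma> *\<^sub>R v)) (at \<sigma> within {0..T})"
        unfolding has_field_derivative_def by (simp only:)
      from DERIV_cmult[OF this, of "D p"]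
      show "((\<lambda>\<sigma>. D p * \<zeta> (p - \<sigma> *\<^sub>R v)) has_real_derivative - (D p * \<delta> (p - \<sigma> *\<^sub>R v))) (at \<sigma> within {0..T})"
        by simp
    next
      fix \<sigma>
      show "(\<lambda>p. D p * \<zeta> (p - \<sigma> *\<^sub>R v)) integrable_on cbox A B"
        by (intro integrable_continuous continuous_intros D continuous_on_compose2[OF \<zeta>c]) auto
    next
      show "continuous_on ({0..T} \<times> cbox A B) (\<lambda>(\<sigma>, p). - (D p * \<delta> (p - \<sigma> *\<^sub>R v)))"
        unfolding case_prod_unfold
        by (intro continuous_intros continuous_on_compose2[OF D] continuous_on_compose2[OF \<delta>(2)]) auto
    qed simp
    then show ?thesis
      using flow that by simp
  qed
  then obtain c where c: "\<And>\<sigma>. \<sigma> \<in> {0..T} \<Longrightarrow> ?G \<sigma> = c"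
    using has_field_derivative_zero_constant[of "{0..T}" ?G] by auto
  show ?thesis
    using c[of 0] c[of T] T final by simp
qed

lemma integral_eq_if_zero_outside:
  fixes f :: "real \<Rightarrow> real"
  assumes "{c..d} \<subseteq> {A..B}" "continuous_on {A..B} f" "\<And>x. x \<in> {A..B} \<Longrightarrow> x \<notin> {c..d} \<Longrightarrow> f x = 0"
  shows "integral {A..B} f = integral {c..d} f"
proof -
  have "integral {A..B} f = integral {A..B} (\<lambda>x. if x \<in> {c..d} then f x else 0)"
    by (rule integral_cong) (use assms(3) in auto)
  also have "\<dots> = integral ({c..d} \<inter> {A..B}) f"
    by (rule Henstock_Kurzweil_Integration.integral_restrict_Int)
  finally show ?thesis
    by (simp only: Int_absorb2[OF assms(1)])
qed

section \<open>Integral operators with bounded kernels\<close>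

definition square_integrable :: "(real \<Rightarrow> real) \<Rightarrow> bool" where
  "square_integrable f \<longleftrightarrow> f \<in> borel_measurable borel \<and> integrable lborel (\<lambda>x. (f x)\<^sup>2)"

lemma square_integrable_measurable: "square_integrable f \<Longrightarrow> f \<in> borel_measurable borel"
  by (simp add: square_integrable_def)

lemma square_integrable_product:
  assumes "square_integrable f" "square_integrable g"
  shows "integrable lborel (\<lambda>x. f x * g x)"
proof (rule Bochner_Integration.integrable_bound)
  show "integrable lborel (\<lambda>x. (f x)\<^sup>2 + (g x)\<^sup>2)"
    using assms by (auto simp: square_integrable_def)
  show "(\<lambda>x. f x * g x) \<in> borel_measurable lborel"
    using assms by (auto simp: square_integrable_def)
  have "\<bar>u * v\<bar> \<le> u\<^sup>2 + v\<^sup>2" for u v :: real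
  proof -
    have "0 \<le> (\<bar>u\<bar> - \<bar>v\<bar>)\<^sup>2" "0 \<le> \<bar>u\<bar> * \<bar>v\<bar>" by auto
    then show ?thesis unfolding power2_diff abs_mult power2_abs by linarith
  qed
  then show "AE x in lborel. norm (f x * g x) \<le> norm ((f x)\<^sup>2 + (g x)\<^sup>2)"
    by simp
qed

lemma square_integrable_add:
  assumes "square_integrable f" "square_integrable g"
  shows "square_integrable (\<lambda>x. f x + g x)"
proof -
  have "integrable lborel (\<lambda>x. (f x)\<^sup>2 + (g x)\<^sup>2 + 2 * (f x * g x))"
    using square_integrable_product[OF assms] assms by (auto simp: square_integrable_def)
  then show ?thesis
    using assms by (auto simp: square_integrable_def power2_sum mult.assoc)
qed

lemma square_integrable_minus: "square_integrable f \<Longrightarrow> square_integrable (\<lambda>x. - f x)"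
  and square_integrable_abs: "square_integrable f \<Longrightarrow> square_integrable (\<lambda>x. \<bar>f x\<bar>)"
  by (auto simp: square_integrable_def)

lemma square_integrable_bounded:
  assumes f: "f \<in> borel_measurable borel" and bd: "\<And>x. \<bar>f x\<bar> \<le> c * indicator {0..m} x"
  shows "square_integrable f"
  unfolding square_integrable_def
proof (intro conjI f)
  show "integrable lborel (\<lambda>x. (f x)\<^sup>2)"
  proof (rule Bochner_Integration.integrable_bound)
    show "integrable lborel (\<lambda>x. c\<^sup>2 * indicator {0..m} x :: real)"
      by (intro integrable_mult_right integrable_real_indicator) (auto simp: emeasure_lborel_Icc_eq)
    show "(\<lambda>x. (f x)\<^sup>2) \<in> borel_measurable lborel" using f by auto
    have "(f x)\<^sup>2 \<le> c\<^sup>2 * indicator {0..m} x" for x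
      using bd[of x] by (auto simp: indicator_def abs_le_square_iff[symmetric] split: if_splits)
    then show "AE x in lborel. norm ((f x)\<^sup>2) \<le> norm (c\<^sup>2 * indicator {0..m} x :: real)"
      by (auto simp: indicator_def)
  qed
qed

text \<open>A bounded kernel supported in a square maps square-integrable functions to bounded functions of
compact support, and Fubini's theorem applies to all double integrals formed with it.\<close>

locale bounded_kernel =
  fixes k :: "real \<times> real \<Rightarrow> real" and m c :: real
  assumes k_measurable [measurable]: "k \<in> borel_measurable borel"
    and k_bound: "\<bar>k (x, s)\<bar> \<le> c * (indicator {0..m} x * indicator {0..m} s)"
begin

definition operator :: "(real \<Rightarrow> real) \<Rightarrow> real \<Rightarrow> real" where
  "operator g x = (LINT s|lborel. k (x, s) * g s)"

definition transposed :: "(real \<Rightarrow> real) \<Rightarrow> real \<Rightarrow> real" where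
  "transposed h s = (LINT x|lborel. k (x, s) * h x)"

lemma k_product_measurable [measurable]: "k \<in> borel_measurable (lborel \<Otimes>\<^sub>M lborel)"
  by (simp add: lborel_prod)

lemma k_bounds:
  "\<bar>k (x, s)\<bar> \<le> \<bar>c\<bar> * (indicator {0..m} x * indicator {0..m} s)"
  "\<bar>k (x, s)\<bar> \<le> \<bar>c\<bar> * indicator {0..m} s" "\<bar>k (x, s)\<bar> \<le> \<bar>c\<bar> * indicator {0..m} x"
  using k_bound[of x s] by (cases "x \<in> {0..m}"; cases "s \<in> {0..m}"; simp)+

lemma section_square_integrable:
  "square_integrable (\<lambda>s. k (x, s))" "square_integrable (\<lambda>x. k (x, s))"
proof -
  note k_bounds(2,3)
  then show "square_integrable (\<lambda>s. k (x, s))" "square_integrable (\<lambda>x. k (x, s))"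
    by (auto intro!: square_integrable_bounded[of _ "\<bar>c\<bar>" m])
qed

lemma indicator_square_integrable: "square_integrable (\<lambda>x. indicator {0..m} x)"
  by (rule square_integrable_bounded[of _ 1 m]) auto

lemma product_integrable:
  assumes g: "square_integrable g" and h: "square_integrable h"
  shows "integrable (lborel \<Otimes>\<^sub>M lborel) (\<lambda>(x, s). k (x, s) * g s * h x)"
proof (rule Bochner_Integration.integrable_bound)
  let ?i = "indicator {0..m} :: real \<Rightarrow> real"
  let ?b = "\<lambda>p::real \<times> real. (c * (?i (fst p) * h (fst p))) * (?i (snd p) * g (snd p))"
  have [measurable]: "g \<in> borel_measurable borel" "h \<in> borel_measurable borel"
    using assms by (simp_all add: square_integrable_def)
  have gs: "(\<lambda>p. g (snd p)) \<in> borel_measurable (lborel \<Otimes>\<^sub>M lborel)"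
    by (rule measurable_compose[OF measurable_snd]) simp
  have hf: "(\<lambda>p. h (fst p)) \<in> borel_measurable (lborel \<Otimes>\<^sub>M lborel)"
    by (rule measurable_compose[OF measurable_fst]) simp
  have ig: "integrable lborel (\<lambda>x. ?i x * g x)" and ih: "integrable lborel (\<lambda>x. ?i x * h x)"
    by (intro square_integrable_product indicator_square_integrable g h)+
  show "integrable (lborel \<Otimes>\<^sub>M lborel) ?b"
  proof (rule lborel_pair.Fubini_integrable)
    have "integrable lborel (\<lambda>x. norm (c * (?i x * h x)) * (LINT s|lborel. norm (?i s * g s)))"
      by (intro integrable_mult_left integrable_norm integrable_mult_right ih)
    moreover have "(LINT s|lborel. norm (?b (x, s))) = norm (c * (?i x * h x)) * (LINT s|lborel. norm (?i s * g s))" for x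
      by (simp only: fst_conv snd_conv norm_mult[of "c * (?i x * h x)"] integral_mult_right_zero)
    ultimately show "integrable lborel (\<lambda>x. LINT s|lborel. norm (?b (x, s)))"
      by (simp only:)
    show "AE x in lborel. integrable lborel (\<lambda>s. ?b (x, s))"
      using ig by (intro AE_I2) (simp only: fst_conv snd_conv, rule integrable_mult_right)
    show "?b \<in> borel_measurable (lborel \<Otimes>\<^sub>M lborel)"
      by (intro borel_measurable_times borel_measurable_const gs hf) measurable
  qed
  show "(\<lambda>(x, s). k (x, s) * g s * h x) \<in> borel_measurable (lborel \<Otimes>\<^sub>M lborel)"
    using k_product_measurable gs hf by (simp add: case_prod_unfold)
  show "AE p in lborel \<Otimes>\<^sub>M lborel. norm (case p of (x, s) \<Rightarrow> k (x, s) * g s * h x) \<le> norm (?b p)"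
  proof (intro AE_I2, clarsimp simp: abs_mult)
    fix x s
    have "\<bar>k (x, s)\<bar> * (\<bar>g s\<bar> * \<bar>h x\<bar>) \<le> \<bar>c\<bar> * (?i x * ?i s) * (\<bar>g s\<bar> * \<bar>h x\<bar>)"
      by (rule mult_right_mono[OF k_bounds(1)]) simp
    then show "\<bar>k (x, s)\<bar> * \<bar>g s\<bar> * \<bar>h x\<bar> \<le> \<bar>c\<bar> * (?i x * \<bar>h x\<bar>) * (?i s * \<bar>g s\<bar>)"
      by (simp add: mult_ac)
  qed
qed

lemma duality:
  assumes g: "square_integrable g" and h: "square_integrable h"
  shows "(LINT x|lborel. operator g x * h x) = (LINT s|lborel. g s * transposed h s)"
proof -
  have "(LINT x|lborel. operator g x * h x) = (LINT x|lborel. (LINT s|lborel. k (x, s) * g s * h x))"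
    by (simp add: operator_def)
  also have "\<dots> = (LINT s|lborel. (LINT x|lborel. k (x, s) * g s * h x))"
    using lborel_pair.Fubini_integral[OF product_integrable[OF g h]] by simp
  also have "\<dots> = (LINT s|lborel. g s * transposed h s)"
  proof (rule Bochner_Integration.integral_cong[OF refl])
    fix s
    have "(LINT x|lborel. k (x, s) * g s * h x) = (LINT x|lborel. g s * (k (x, s) * h x))"
      by (simp add: mult_ac)
    then show "(LINT x|lborel. k (x, s) * g s * h x) = g s * transposed h s"
      by (simp add: transposed_def)
  qed
  finally show ?thesis .
qed

lemma operator_square_integrable:
  assumes g: "square_integrable g"
  shows "square_integrable (operator g)"
proof (rule square_integrable_bounded)
  have [measurable]: "g \<in> borel_measurable borel"
    using assms by (simp add: square_integrable_def)
  show "operator g \<in> borel_measurable borel"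
    unfolding operator_def[abs_def] by measurable
  fix x
  show "\<bar>operator g x\<bar> \<le> (\<bar>c\<bar> * (LINT s|lborel. indicator {0..m} s * \<bar>g s\<bar>)) * indicator {0..m} x"
  proof (cases "x \<in> {0..m}")
    case True
    have int: "integrable lborel (\<lambda>s. indicator {0..m} s * \<bar>g s\<bar>)"
      by (intro square_integrable_product indicator_square_integrable square_integrable_abs g)
    have "\<bar>operator g x\<bar> \<le> (LINT s|lborel. \<bar>k (x, s) * g s\<bar>)"
      unfolding operator_def by (rule integral_abs_bound)
    also have "\<dots> \<le> (LINT s|lborel. \<bar>c\<bar> * (indicator {0..m} s * \<bar>g s\<bar>))"
    proof (rule integral_mono)
      show "integrable lborel (\<lambda>s. \<bar>k (x, s) * g s\<bar>)"
        by (intro integrable_abs square_integrable_product section_square_integrable g)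
      fix s
      show "\<bar>k (x, s) * g s\<bar> \<le> \<bar>c\<bar> * (indicator {0..m} s * \<bar>g s\<bar>)"
        using mult_right_mono[OF k_bounds(2)[of x s], of "\<bar>g s\<bar>"] by (simp add: abs_mult mult.assoc)
    qed (intro integrable_mult_right int)
    finally show ?thesis using True by simp
  next
    case False
    then have "k (x, s) = 0" for s
      using k_bound[of x s] by simp
    then show ?thesis using False by (simp add: operator_def)
  qed
qed

lemma swapped_kernel: "bounded_kernel (\<lambda>p. k (snd p, fst p)) m c"
proof
  have "(\<lambda>p::real \<times> real. (snd p, fst p)) \<in> borel_measurable borel"
    by (intro borel_measurable_continuous_onI continuous_intros)
  from measurable_compose[OF this k_measurable]
  show "(\<lambda>p. k (snd p, fst p)) \<in> borel_measurable borel" .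
  show "\<bar>k (snd (x, s), fst (x, s))\<bar> \<le> c * (indicator {0..m} x * indicator {0..m} s)" for x s
    using k_bound[of s x] by (simp add: mult_ac)
qed

lemma transposed_square_integrable:
  assumes "square_integrable h"
  shows "square_integrable (transposed h)"
  using bounded_kernel.operator_square_integrable[OF swapped_kernel assms]
  by (simp add: transposed_def[abs_def] bounded_kernel.operator_def[OF swapped_kernel, abs_def])

lemma operator_add:
  assumes "square_integrable f" "square_integrable g"
  shows "operator (\<lambda>s. f s + g s) x = operator f x + operator g x"
  unfolding operator_def using assms
  by (subst Bochner_Integration.integral_add[symmetric])
    (auto intro!: square_integrable_product section_square_integrable simp: distrib_left)

lemma transposed_add:
  assumes "square_integrable f" "square_integrable g"
  shows "transposed (\<lambda>s. f s + g s) x = transposed f x + transposed g x"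
  unfolding transposed_def using assms
  by (subst Bochner_Integration.integral_add[symmetric])
    (auto intro!: square_integrable_product section_square_integrable simp: distrib_left)

end

lemma bounded_kernel_abs: "bounded_kernel k m c \<Longrightarrow> bounded_kernel (\<lambda>p. \<bar>k p\<bar>) m c"
  by (auto simp: bounded_kernel_def)

text \<open>Integrating \<open>|h| \<le> \<integral> |k| |h|\<close> against the weight \<open>exp (- 2 b x)\<close>, with \<open>b\<close> above the bound of the
kernel, and exchanging the integrals bounds the weighted norm of \<open>h\<close> by one half of itself.\<close>

lemma Volterra_injective:
  assumes k: "bounded_kernel k m c" and volterra: "\<And>x s. x < s \<Longrightarrow> k (x, s) = 0"
    and h: "square_integrable h" and eq: "AE x in lborel. h x + bounded_kernel.operator k h x = 0"
  shows "AE x in lborel. h x = 0"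
proof -
  interpret k: bounded_kernel k m c by (rule k)
  interpret a: bounded_kernel "\<lambda>p. \<bar>k p\<bar>" m c by (rule bounded_kernel_abs[OF k])
  \<comment> \<open>The increment makes the exponent nonzero for the zero kernel.\<close>
  define b where "b = \<bar>c\<bar> + 1"
  have b: "0 < b" "\<bar>c\<bar> \<le> b" by (auto simp: b_def)
  define e where "e x = indicator {0..m} x * exp (- 2 * b * x)" for x :: real
  have e0: "0 \<le> e x" for x by (simp add: e_def)
  have e: "square_integrable e"
    unfolding e_def[abs_def] using b
    by (intro square_integrable_bounded[of _ 1 m]) (auto simp: indicator_def)
  have ha: "square_integrable (\<lambda>x. \<bar>h x\<bar>)" by (rule square_integrable_abs[OF h])
  have he: "integrable lborel (\<lambda>x. \<bar>h x\<bar> * e x)" by (rule square_integrable_product[OF ha e])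
  have "a.transposed e s \<le> e s / 2" for s
  proof (cases "s \<in> {0..m}")
    case True
    have cont: "continuous_on {s..m} (\<lambda>x. b * exp (- 2 * b * x))"
      by (intro continuous_intros)
    have int: "integrable lborel (\<lambda>x. indicator {s..m} x * (b * exp (- 2 * b * x)))"
      using borel_integrable_atLeastAtMost'[OF cont] by (simp add: set_integrable_def)
    have "a.transposed e s \<le> (LINT x|lborel. indicator {s..m} x * (b * exp (- 2 * b * x)))"
      unfolding a.transposed_def
    proof (rule integral_mono[OF square_integrable_product[OF a.section_square_integrable(2) e] int])
      fix x
      show "\<bar>k (x, s)\<bar> * e x \<le> indicator {s..m} x * (b * exp (- 2 * b * x))"
        using k.k_bound[of x s] volterra[of x s] b True
        by (cases "x < s") (auto simp: e_def indicator_def intro!: mult_right_mono)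
    qed
    also have "\<dots> = integral {s..m} (\<lambda>x. b * exp (- 2 * b * x))"
      by (rule lborel_integral_indicator_Icc[OF cont])
    also have "\<dots> = - exp (- 2 * b * m) / 2 - - exp (- 2 * b * s) / 2"
      by (intro integral_unique fundamental_theorem_of_calculus)
        (use True b in \<open>auto intro!: derivative_eq_intros simp flip: has_real_derivative_iff_has_vector_derivative\<close>)
    also have "\<dots> \<le> e s / 2"
      using True by (simp add: e_def)
    finally show ?thesis .
  next
    case False
    then have "k (x, s) = 0" for x
      using k.k_bound[of x s] by simp
    then show ?thesis using e0[of s] by (simp add: a.transposed_def)
  qed
  then have "(LINT s|lborel. \<bar>h s\<bar> * a.transposed e s) \<le> (LINT s|lborel. \<bar>h s\<bar> * e s / 2)"
  proof (intro integral_mono')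
    show "integrable lborel (\<lambda>s. \<bar>h s\<bar> * e s / 2)" using he by simp
    show "\<bar>h s\<bar> * a.transposed e s \<le> \<bar>h s\<bar> * e s / 2" if "\<And>s. a.transposed e s \<le> e s / 2" for s
      using mult_left_mono[OF that[of s], of "\<bar>h s\<bar>"] by simp
    show "0 \<le> \<bar>h s\<bar> * e s / 2" for s using e0 by simp
  qed
  then have up: "(LINT s|lborel. \<bar>h s\<bar> * a.transposed e s) \<le> (LINT s|lborel. \<bar>h s\<bar> * e s) / 2"
    by simp
  have "AE x in lborel. \<bar>h x\<bar> * e x \<le> a.operator (\<lambda>x. \<bar>h x\<bar>) x * e x"
    using eq
  proof eventually_elim
    case (elim x)
    have "\<bar>h x\<bar> = \<bar>k.operator h x\<bar>" using elim by simp
    also have "\<dots> \<le> a.operator (\<lambda>x. \<bar>h x\<bar>) x"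
      unfolding a.operator_def k.operator_def using integral_abs_bound[of lborel "\<lambda>s. k (x, s) * h s"]
      by (simp add: abs_mult)
    finally show ?case by (rule mult_right_mono[OF _ e0])
  qed
  then have "(LINT x|lborel. \<bar>h x\<bar> * e x) \<le> (LINT x|lborel. a.operator (\<lambda>x. \<bar>h x\<bar>) x * e x)"
    by (intro integral_mono_AE he square_integrable_product a.operator_square_integrable ha e)
  also have "\<dots> = (LINT s|lborel. \<bar>h s\<bar> * a.transposed e s)"
    by (rule a.duality[OF ha e])
  finally have "(LINT x|lborel. \<bar>h x\<bar> * e x) \<le> 0"
    using up by simp
  moreover have "0 \<le> (LINT x|lborel. \<bar>h x\<bar> * e x)"
    using e0 by (intro Bochner_Integration.integral_nonneg) simp
  ultimately have "AE x in lborel. \<bar>h x\<bar> * e x = 0"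
    using integral_nonneg_eq_0_iff_AE[OF he] e0 by simp
  with eq show ?thesis
  proof eventually_elim
    case (elim x)
    show "h x = 0"
    proof (cases "x \<in> {0..m}")
      case True
      then show ?thesis using elim by (simp add: e_def)
    next
      case False
      then have "k (x, s) = 0" for s
        using k.k_bound[of x s] by simp
      then show ?thesis using elim by (simp add: k.operator_def)
    qed
  qed
qed

section \<open>Representatives of square-integrable functions on the half-line\<close>

lemma AE_half_line: "(AE x in half_line. P x) \<longleftrightarrow> (AE x in lborel. 0 \<le> x \<longrightarrow> P x)"
  by (simp add: AE_restrict_space_iff AE_completion_iff)

text \<open>Elements of \<open>L2\<close> are only Lebesgue measurable, and Fubini's theorem is applied to the Borel
product measure; \<open>f0\<close> is a Borel representative of \<open>f\<close>, extended by zero to the whole line.\<close>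

definition half_line_version :: "(real \<Rightarrow> real) \<Rightarrow> (real \<Rightarrow> real) \<Rightarrow> bool" where
  "half_line_version f f0 \<longleftrightarrow> square_integrable f0 \<and> (\<forall>x<0. f0 x = 0) \<and>
    f \<in> borel_measurable half_line \<and> (AE x in half_line. f x = f0 x)"

lemma L2_version:
  assumes "f \<in> L2"
  obtains f0 where "half_line_version f f0"
proof -
  have f: "f \<in> borel_measurable half_line" "integrable half_line (\<lambda>x. (f x)\<^sup>2)"
    using assms by (auto simp: L2_def)
  have "(\<lambda>x. indicator {0..} x *\<^sub>R f x) \<in> borel_measurable lebesgue"
    using f(1) by (subst (asm) borel_measurable_restrict_space_iff) simp_all
  then obtain g where g: "g \<in> borel_measurable lborel" "AE x in lborel. indicator {0..} x *\<^sub>R f x = g x"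
    using completion_ex_borel_measurable_real[of "\<lambda>x. indicator {0..} x *\<^sub>R f x" lborel] by blast
  define f0 where "f0 x = indicator {0..} x * g x" for x
  have m: "f0 \<in> borel_measurable borel"
    unfolding f0_def[abs_def] using g(1) by simp
  have ae: "AE x in lborel. indicator {0..} x * f x = f0 x"
    using g(2) by eventually_elim (auto simp: f0_def indicator_def)
  have "integrable lebesgue (\<lambda>x. indicator {0..} x *\<^sub>R (f x)\<^sup>2)"
    using f(2) by (subst (asm) integrable_restrict_space) simp_all
  moreover have "(\<lambda>x. (f0 x)\<^sup>2) \<in> borel_measurable lebesgue"
    using m by (intro measurable_completion) simp
  moreover have "AE x in lebesgue. indicator {0..} x *\<^sub>R (f x)\<^sup>2 = (f0 x)\<^sup>2"
    using AE_completion[OF ae] by eventually_elim (auto simp: indicator_def)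
  ultimately have "integrable lebesgue (\<lambda>x. (f0 x)\<^sup>2)"
    by (rule integrable_cong_AE_imp)
  then have "integrable lborel (\<lambda>x. (f0 x)\<^sup>2)"
    using m by (subst (asm) integrable_completion) simp_all
  then have "square_integrable f0"
    using m by (simp add: square_integrable_def)
  moreover have "AE x in half_line. f x = f0 x"
    unfolding AE_half_line using ae by eventually_elim auto
  ultimately show ?thesis
    using f(1) by (intro that[of f0]) (simp add: half_line_version_def f0_def)
qed

lemma L2_inner_version:
  assumes f: "half_line_version f f0" and g: "half_line_version g g0"
  shows "L2_inner f g = (LINT x|lborel. f0 x * g0 x)"
proof -
  have m: "f0 \<in> borel_measurable borel" "g0 \<in> borel_measurable borel"
    using f g by (auto simp: half_line_version_def square_integrable_def)
  have "L2_inner f g = (LINT x|half_line. f0 x * g0 x)"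
    unfolding L2_inner_def
  proof (rule integral_cong_AE)
    have "AE x in half_line. f x = f0 x" "AE x in half_line. g x = g0 x"
      using f g by (auto simp: half_line_version_def)
    then show "AE x in half_line. f x * g x = f0 x * g0 x" by eventually_elim simp
    show "(\<lambda>x. f x * g x) \<in> borel_measurable half_line"
      using f g by (auto simp: half_line_version_def)
    show "(\<lambda>x. f0 x * g0 x) \<in> borel_measurable half_line"
      using m by (intro measurable_restrict_space1 measurable_completion) auto
  qed
  also have "\<dots> = (LINT x|lebesgue. indicator {0..} x *\<^sub>R (f0 x * g0 x))"
    by (rule integral_restrict_space) simp
  also have "\<dots> = (LINT x|lebesgue. f0 x * g0 x)"
    using f by (intro Bochner_Integration.integral_cong) (auto simp: half_line_version_def indicator_def not_le)
  also have "\<dots> = (LINT x|lborel. f0 x * g0 x)"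
    using m by (intro integral_completion) auto
  finally show ?thesis .
qed

lemma half_line_version_L2:
  assumes "half_line_version f f0"
  shows "f \<in> L2"
proof -
  have f: "square_integrable f0" "f \<in> borel_measurable half_line" "AE x in half_line. f x = f0 x"
    using assms by (auto simp: half_line_version_def)
  have m: "f0 \<in> borel_measurable half_line"
    using f(1) by (intro measurable_restrict_space1 measurable_completion) (simp add: square_integrable_def)
  have "integrable lebesgue (\<lambda>x. (f0 x)\<^sup>2)"
    using f(1) by (subst integrable_completion) (auto simp: square_integrable_def)
  then have "integrable half_line (\<lambda>x. (f0 x)\<^sup>2)"
    by (subst integrable_restrict_space) (simp, intro integrable_mult_indicator, simp_all)
  moreover have "AE x in half_line. (f0 x)\<^sup>2 = (f x)\<^sup>2"
    using f(3) by eventually_elim simp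
  ultimately have "integrable half_line (\<lambda>x. (f x)\<^sup>2)"
    using f(2) by (intro integrable_cong_AE_imp[of half_line "\<lambda>x. (f0 x)\<^sup>2" "\<lambda>x. (f x)\<^sup>2"]) auto
  then show ?thesis using f(2) by (simp add: L2_def)
qed

section \<open>Pairing the fundamental solution with separated variables\<close>

lemma scattering_domain_measurable: "scattering_domain \<in> sets lebesgue"
proof -
  have "open scattering_domain"
    unfolding scattering_domain_def case_prod_unfold
    by (intro open_Collect_conj open_Collect_less continuous_intros)
  then show ?thesis by (simp add: borel_open)
qed

text \<open>The wave equation in the sense of distributions, written out for a product test function.\<close>

lemma fundamental_solution_separable:
  assumes fund: "fundamental_solution q w"
    and P: "test_on x1 x2 P" and A: "test_on t1 t2 A" and "0 < x1" "t2 < x1"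
  shows "(LINT x|lebesgue_on {0<..}. P x * deriv (deriv A) (- x) - deriv (deriv P) x * A (- x) + q x * (P x * A (- x)))
    + (LINT p|lebesgue_on scattering_domain. w p * (P (fst p) * deriv (deriv A) (snd p)
        - deriv (deriv P) (fst p) * A (snd p) + q (fst p) * (P (fst p) * A (snd p)))) = 0"
proof -
  define \<phi> where "\<phi> = (\<lambda>p. P (fst p) * A (snd p))"
  have "smooth_on UNIV \<phi>"
    unfolding \<phi>_def
    using smooth_on_compose_affine[OF test_on_smooth[OF P] bounded_linear_fst, of UNIV 0]
      smooth_on_compose_affine[OF test_on_smooth[OF A] bounded_linear_snd, of UNIV 0]
    by (intro smooth_on_mult) auto
  moreover
  have "closure {p. \<phi> p \<noteq> 0} \<subseteq> cbox (x1, t1) (x2, t2)"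
  proof (rule closure_minimal)
    show "{p. \<phi> p \<noteq> 0} \<subseteq> cbox (x1, t1) (x2, t2)"
    proof
      fix p assume "p \<in> {p. \<phi> p \<noteq> 0}"
      then have "P (fst p) \<noteq> 0" "A (snd p) \<noteq> 0" by (auto simp: \<phi>_def)
      then have "\<not> (fst p \<le> x1 \<or> x2 \<le> fst p)" "\<not> (snd p \<le> t1 \<or> t2 \<le> snd p)"
        using test_on_zero[OF P] test_on_zero[OF A] by blast+
      then show "p \<in> cbox (x1, t1) (x2, t2)"
        by (cases p) (auto simp: cbox_Pair_iff)
    qed
  qed (rule closed_cbox)
  then have "compact (closure {p. \<phi> p \<noteq> 0})" "closure {p. \<phi> p \<noteq> 0} \<subseteq> scattering_domain"
    using assms(4,5) bounded_subset[OF bounded_cbox, of "closure {p. \<phi> p \<noteq> 0}" "(x1, t1)" "(x2, t2)"]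
    by (auto simp: compact_eq_bounded_closed scattering_domain_def)
  ultimately have "delta_plus w (wave_operator q \<phi>) = 0"
    using fund unfolding fundamental_solution_def test_functions_def by blast
  moreover
  have "wave_operator q \<phi> = (\<lambda>p. P (fst p) * deriv (deriv A) (snd p)
        - deriv (deriv P) (fst p) * A (snd p) + q (fst p) * (P (fst p) * A (snd p)))"
  proof -
    have "(deriv ^^ 2) (\<lambda>s. c * f s) = (\<lambda>s. c * deriv (deriv f) s)" if "test_on s1 s2 f" for c f s1 s2
    proof -
      have *: "deriv (\<lambda>s. c * f s) = (\<lambda>s. c * deriv f s)" if "test_on s1 s2 f" for f
        using DERIV_imp_deriv[OF DERIV_cmult[OF test_on_DERIV[OF that]]] by blast
      show ?thesis
        using *[OF that] *[OF test_on_deriv[OF that]] by (simp add: numeral_2_eq_2)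
    qed
    from this[OF P] this[OF A] have
      "(deriv ^^ 2) (\<lambda>z. P z * A t) x = deriv (deriv P) x * A t"
      "(deriv ^^ 2) (\<lambda>s. P x * A s) t = P x * deriv (deriv A) t" for x t
      by (simp_all add: mult.commute[of "P _" "A t"] fun_eq_iff)
    then show ?thesis
      by (auto simp: wave_operator_def \<phi>_def fun_eq_iff)
  qed
  ultimately show ?thesis
    unfolding delta_plus_def by simp
qed

section \<open>The adjoint of the control operator\<close>

locale scattering =
  fixes q r :: "real \<Rightarrow> real" and w :: "real \<times> real \<Rightarrow> real" and a :: real
  assumes a_nonneg: "0 \<le> a"
    and q_smooth: "smooth_on {0..} q"
    and fund: "fundamental_solution q w"
    and resp: "response_function a w r"
begin

abbreviation sector :: "(real \<times> real) set" where
  "sector \<equiv> {(x, t). \<bar>t\<bar> \<le> x}"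

text \<open>Any bound above \<open>2 a\<close> would do: it lies beyond the support of \<open>w (\<sqdot>, -s)\<close> for every \<open>s \<ge> 0\<close>, so
integrals over unbounded intervals can stop there.\<close>

definition M :: real where "M = 2 * a + 1"

lemma M_pos: "0 < M" and M_gt: "a < M" "2 * a < M"
  using a_nonneg by (auto simp: M_def)

lemma w_smooth: "smooth_on sector w"
  using fund by (simp add: fundamental_solution_def)

lemma w_continuous: "continuous_on sector w"
  by (rule continuous_on_smooth[OF w_smooth])

lemma w_before_front: "0 < x \<Longrightarrow> t < - x \<Longrightarrow> w (x, t) = 0"
  using fund by (simp add: fundamental_solution_def)

lemma w_outgoing: "a < x \<Longrightarrow> t < x \<Longrightarrow> w (x, t) = r (x - t)"
  using resp by (auto simp: response_function_def)

lemma r_zero: "2 * a < s \<Longrightarrow> r s = 0"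
proof (rule ccontr)
  assume s: "2 * a < s" "r s \<noteq> 0"
  then have "s \<in> closure {s. 0 \<le> s \<and> r s \<noteq> 0}"
    using a_nonneg by (intro closure_subset[THEN subsetD]) auto
  then show False
    using resp s(1) by (auto simp: response_function_def)
qed

lemma w_far: "M \<le> x \<Longrightarrow> 0 \<le> s \<Longrightarrow> w (x, - s) = 0"
  using w_outgoing[of x "- s"] r_zero[of "x + s"] M_gt a_nonneg by simp

lemma w_continuous_compose [continuous_intros]:
  assumes "continuous_on S f" "continuous_on S g" "\<And>p. p \<in> S \<Longrightarrow> \<bar>g p\<bar> \<le> f p"
  shows "continuous_on S (\<lambda>p. w (f p, g p))"
  by (rule continuous_on_compose2[OF w_continuous]) (use assms in \<open>auto intro!: continuous_intros\<close>)

lemma q_smooth_pos: "0 \<le> b \<Longrightarrow> smooth_on {b<..} q"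
  by (rule smooth_on_subset[OF q_smooth]) auto

text \<open>The formula for \<open>W\<^sup>*\<close>, meant for continuous functions on the open half-line.
It pairs \<open>Y\<close> with \<open>\<delta>(x + t) + w\<close> at time \<open>t = -\<tau>\<close>.\<close>

definition wave_adjoint :: "(real \<Rightarrow> real) \<Rightarrow> real \<Rightarrow> real" where
  "wave_adjoint Y \<tau> = Y \<tau> + integral {\<tau>..M} (\<lambda>x. w (x, - \<tau>) * Y x)"

lemma wave_adjoint_continuous:
  assumes "0 \<le> b" and Y: "continuous_on {b<..} Y"
  shows "continuous_on {b<..} (wave_adjoint Y)"
  unfolding wave_adjoint_def
  by (intro continuous_on_add Y continuous_on_integral_lower_limit[where g = "\<lambda>\<tau>. \<tau>"])
   (use assms M_pos in \<open>auto simp: case_prod_unfold intro!: continuous_intros continuous_on_compose2[OF Y]\<close>)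

text \<open>For \<open>x \<ge> \<tau> > a\<close> one has \<open>w (x, -\<tau>) = r (x + \<tau>)\<close> and \<open>x + \<tau> > 2 a\<close>.\<close>

lemma wave_adjoint_far:
  assumes "a < \<tau>"
  shows "wave_adjoint Y \<tau> = Y \<tau>"
proof -
  have "integral {\<tau>..M} (\<lambda>x. w (x, - \<tau>) * Y x) = integral {\<tau>..M} (\<lambda>x. 0)"
  proof (rule integral_cong)
    fix x assume "x \<in> {\<tau>..M}"
    then have "w (x, - \<tau>) = r (x + \<tau>)" "r (x + \<tau>) = 0"
      using assms a_nonneg by (auto simp: w_outgoing intro!: r_zero)
    then show "w (x, - \<tau>) * Y x = 0" by simp
  qed
  then show ?thesis by (simp add: wave_adjoint_def)
qed

text \<open>The test function is \<open>Y x \<cdot> \<alpha> (-t)\<close>, with \<open>Y\<close> cut off near \<open>b\<close> and near infinity. The cutoff is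
invisible: at times \<open>-d \<le> t \<le> -c\<close> the distribution lives on \<open>-t \<le> x \<le> M\<close>. The operator
applied to the product leaves \<open>Y \<alpha>'' - Z \<alpha>\<close>, and the potential disappears.\<close>

lemma wave_adjoint_weak:
  assumes "0 \<le> b" "b < c" "c \<le> d" and \<alpha>: "test_on c d \<alpha>"
    and Y: "smooth_on {b<..} Y" and Z: "continuous_on {b<..} Z"
    and ode: "\<And>x. b < x \<Longrightarrow> deriv (deriv Y) x = q x * Y x + Z x"
  shows "integral {c..d} (\<lambda>\<tau>. wave_adjoint Y \<tau> * deriv (deriv \<alpha>) \<tau> - wave_adjoint Z \<tau> * \<alpha> \<tau>) = 0"
proof -
  note \<alpha>' = test_on_deriv[OF \<alpha>]
  note \<alpha>'' = test_on_deriv[OF \<alpha>']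
  define A where "A t = \<alpha> (- t)" for t
  have A: "test_on (- d) (- c) A" and A'': "deriv (deriv A) = (\<lambda>x. deriv (deriv \<alpha>) (- x))"
    unfolding A_def[abs_def] using test_on_reflect[OF \<alpha>] by auto
  have Yc: "continuous_on {b<..} Y" by (rule continuous_on_smooth[OF Y])
  \<comment> \<open>The cutoff is \<open>1\<close> on a neighbourhood of \<open>[c, max M d]\<close>, hence the additional unit.\<close>
  define M' where "M' = max M d + 1"
  obtain b' b'' where b': "b < b'" "b' < b''" "b'' < c"
    using dense[OF \<open>b < c\<close>] dense by metis
  obtain \<eta>1 where \<eta>1: "smooth_on UNIV \<eta>1" "\<And>x. x \<le> b' \<Longrightarrow> \<eta>1 x = 0" "\<And>x. b'' \<le> x \<Longrightarrow> \<eta>1 x = (1::real)"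
    using smooth_step[OF \<open>b' < b''\<close>] by blast
  obtain \<eta>2 where \<eta>2: "smooth_on UNIV \<eta>2" "\<And>x. x \<le> - M' - 1 \<Longrightarrow> \<eta>2 x = 0" "\<And>x. - M' \<le> x \<Longrightarrow> \<eta>2 x = (1::real)"
    using smooth_step[of "- M' - 1" "- M'"] by auto
  define P where "P x = Y x * (\<eta>1 x * \<eta>2 (- x))" for x
  have "smooth_on UNIV P"
    unfolding P_def[abs_def]
    using smooth_on_compose_affine[OF \<eta>2(1) bounded_linear_minus[OF bounded_linear_ident], of UNIV 0]
    by (intro smooth_on_extend_by_zero[OF Y _ \<open>b < b'\<close>] smooth_on_mult \<eta>1) (auto simp: \<eta>1(2))
  then have P: "test_on b' (M' + 1) P"
    using \<eta>1(2) \<eta>2(2) by (auto simp: test_on_def P_def)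
  have PY: "P x = Y x" "deriv (deriv P) x = q x * Y x + Z x" if "c \<le> x" "x \<le> max M d" for x
  proof -
    have eq: "P y = Y y" if "y \<in> {b''<..<M'}" for y
      using that by (simp add: P_def \<eta>1 \<eta>2)
    have x: "x \<in> {b''<..<M'}" using that b' by (auto simp: M'_def)
    then show "P x = Y x" by (rule eq)
    have "deriv P y = deriv Y y" if "y \<in> {b''<..<M'}" for y
      by (rule deriv_cong_open[OF _ that eq]) auto
    then have "deriv (deriv P) x = deriv (deriv Y) x"
      by (intro deriv_cong_open[OF _ x]) auto
    then show "deriv (deriv P) x = q x * Y x + Z x"
      using that b' ode by simp
  qed
  define h where "h \<tau> x = Y x * deriv (deriv \<alpha>) \<tau> - Z x * \<alpha> \<tau>" for \<tau> x
  have PA: "P x * deriv (deriv A) t - deriv (deriv P) x * A t + q x * (P x * A t) = h (- t) x"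
    if "c \<le> x" "x \<le> max M d" for x t
    using PY[OF that] by (simp add: h_def A'' A_def algebra_simps)
  have PA0: "P x * deriv (deriv A) t - deriv (deriv P) x * A t + q x * (P x * A t) = 0"
    if "- t \<le> c \<or> d \<le> - t" for x t
    using test_on_zero[OF \<alpha> that] test_on_zero[OF \<alpha>'' that] by (simp add: A'' A_def)
  have hc: "continuous_on {c..d} (\<lambda>x. h x x)"
    unfolding h_def using \<open>b < c\<close>
    by (intro continuous_intros test_on_continuous[OF \<alpha>] test_on_continuous[OF \<alpha>'']
        continuous_on_subset[OF Yc] continuous_on_subset[OF Z]) auto
  define S where "S = {(x, t). - d \<le> t \<and> t \<le> - c \<and> - t \<le> x \<and> x \<le> M}"
  have "closed S"
    unfolding S_def case_prod_unfold
    by (intro closed_Collect_conj closed_Collect_le continuous_intros)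
  moreover have "S \<subseteq> cbox (c, - d) (M, - c)"
    by (auto simp: S_def cbox_Pair_iff)
  ultimately have S: "compact S"
    using bounded_subset[OF bounded_cbox] compact_eq_bounded_closed by blast
  have Sd: "S \<subseteq> scattering_domain"
    using assms(1,2) by (auto simp: S_def scattering_domain_def)
  define f where "f p = w p * h (- snd p) (fst p)" for p
  have f: "continuous_on S f"
    unfolding f_def h_def using assms(1,2)
    by (intro continuous_intros continuous_on_subset[OF w_continuous]
        continuous_on_compose2[OF Yc] continuous_on_compose2[OF Z]
        continuous_on_compose2[OF test_on_continuous[OF \<alpha>, of UNIV]]
        continuous_on_compose2[OF test_on_continuous[OF \<alpha>'', of UNIV]]) (auto simp: S_def)
  have "(LINT x|lebesgue_on {0<..}. P x * deriv (deriv A) (- x) - deriv (deriv P) x * A (- x) + q x * (P x * A (- x)))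
      = (LINT x|lborel. indicator {c..d} x * h x x)"
  proof (rule lebesgue_on_integral_indicator[OF compact_Icc hc])
    show "{c..d} \<subseteq> {0<..}" using assms by auto
    fix x :: real
    show "P x * deriv (deriv A) (- x) - deriv (deriv P) x * A (- x) + q x * (P x * A (- x)) = indicator {c..d} x * h x x"
      using PA[of x "- x"] PA0[of "- x" x] by (cases "x \<in> {c..d}") auto
  qed simp
  also have "\<dots> = integral {c..d} (\<lambda>x. h x x)"
    by (rule lborel_integral_indicator_Icc[OF hc])
  finally have I1: "(LINT x|lebesgue_on {0<..}. P x * deriv (deriv A) (- x) - deriv (deriv P) x * A (- x) + q x * (P x * A (- x)))
      = integral {c..d} (\<lambda>x. h x x)" .
  have "(LINT p|lebesgue_on scattering_domain. w p * (P (fst p) * deriv (deriv A) (snd p)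
        - deriv (deriv P) (fst p) * A (snd p) + q (fst p) * (P (fst p) * A (snd p))))
     = (LINT p|lborel. indicator S p * f p)"
  proof (rule lebesgue_on_integral_indicator[OF S f scattering_domain_measurable Sd])
    fix p assume "p \<in> scattering_domain"
    then obtain x t where p: "p = (x, t)" "0 < x" "t < x"
      by (cases p) (auto simp: scattering_domain_def)
    consider "- t < c \<or> d < - t" | "x < - t" | "c \<le> - t" "- t \<le> d" "- t \<le> x" "M < x"
      | "c \<le> - t" "- t \<le> d" "- t \<le> x" "x \<le> M"
      by linarith
    then show "w p * (P (fst p) * deriv (deriv A) (snd p) - deriv (deriv P) (fst p) * A (snd p)
        + q (fst p) * (P (fst p) * A (snd p))) = indicator S p * f p"
    proof cases
      case 1
      then show ?thesis using PA0[of t x] p by (auto simp: S_def)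
    next
      case 2
      then show ?thesis using w_before_front[of x t] p by (simp add: f_def S_def)
    next
      case 3
      then show ?thesis using w_far[of x "- t"] p assms(1,2) by (simp add: f_def S_def)
    next
      case 4
      then show ?thesis using PA[of x t] p by (auto simp: f_def S_def)
    qed
  qed
  also have "\<dots> = (LINT t|lborel. (LINT x|lborel. indicator S (x, t) * f (x, t)))"
    by (rule planar_Fubini(1)[OF S f])
  also have "\<dots> = (LINT t|lborel. indicator {- d..- c} t * integral {- t..M} (\<lambda>x. f (x, t)))"
  proof (rule Bochner_Integration.integral_cong[OF refl])
    fix t
    show "(LINT x|lborel. indicator S (x, t) * f (x, t)) = indicator {- d..- c} t * integral {- t..M} (\<lambda>x. f (x, t))"
    proof (cases "t \<in> {- d..- c}")
      case True
      then have "(LINT x|lborel. indicator S (x, t) * f (x, t)) = (LINT x|lborel. indicator {- t..M} x * f (x, t))"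
        by (intro Bochner_Integration.integral_cong) (auto simp: S_def split: split_indicator)
      also have "\<dots> = integral {- t..M} (\<lambda>x. f (x, t))"
        by (intro lborel_integral_indicator_Icc continuous_on_compose2[OF f])
          (use True in \<open>auto simp: S_def intro!: continuous_intros\<close>)
      finally show ?thesis using True by simp
    qed (auto simp: S_def indicator_def)
  qed
  also have "\<dots> = integral {- d..- c} (\<lambda>t. integral {- t..M} (\<lambda>x. f (x, t)))"
  proof (intro lborel_integral_indicator_Icc continuous_on_integral_lower_limit)
    have "continuous_on {(p, x). p \<in> {- d..- c} \<and> - p \<le> x} (\<lambda>p. w (snd p, fst p) * h (- fst p) (snd p))"
      unfolding h_def using assms(1,2)
      by (intro continuous_intros
          continuous_on_compose2[OF Yc] continuous_on_compose2[OF Z]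
          continuous_on_compose2[OF test_on_continuous[OF \<alpha>, of UNIV]]
          continuous_on_compose2[OF test_on_continuous[OF \<alpha>'', of UNIV]]) auto
    then show "continuous_on {(p, x). p \<in> {- d..- c} \<and> - p \<le> x} (\<lambda>(p, x). f (x, p))"
      by (simp add: f_def case_prod_unfold)
  qed (use assms(1,2) M_pos in \<open>auto intro!: continuous_intros\<close>)
  also have "\<dots> = integral {c..d} (\<lambda>\<tau>. integral {\<tau>..M} (\<lambda>x. w (x, - \<tau>) * h \<tau> x))"
    using Henstock_Kurzweil_Integration.integral_reflect_real[of d c "\<lambda>\<tau>. integral {\<tau>..M} (\<lambda>x. w (x, - \<tau>) * h \<tau> x)"]
    by (simp add: f_def)
  finally have I2: "(LINT p|lebesgue_on scattering_domain. w p * (P (fst p) * deriv (deriv A) (snd p)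
        - deriv (deriv P) (fst p) * A (snd p) + q (fst p) * (P (fst p) * A (snd p))))
     = integral {c..d} (\<lambda>\<tau>. integral {\<tau>..M} (\<lambda>x. w (x, - \<tau>) * h \<tau> x))" .
  have inner: "integral {\<tau>..M} (\<lambda>x. w (x, - \<tau>) * h \<tau> x) = wave_adjoint Y \<tau> * deriv (deriv \<alpha>) \<tau> - wave_adjoint Z \<tau> * \<alpha> \<tau> - h \<tau> \<tau>"
    if "\<tau> \<in> {c..d}" for \<tau>
  proof -
    have int: "(\<lambda>x. w (x, - \<tau>) * U x) integrable_on {\<tau>..M}" if "continuous_on {b<..} U" for U
      using \<open>\<tau> \<in> {c..d}\<close> assms(1,2)
      by (intro integrable_continuous_real continuous_intros continuous_on_subset[OF that]) auto
    have "integral {\<tau>..M} (\<lambda>x. w (x, - \<tau>) * h \<tau> x)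
       = integral {\<tau>..M} (\<lambda>x. w (x, - \<tau>) * Y x * deriv (deriv \<alpha>) \<tau> - w (x, - \<tau>) * Z x * \<alpha> \<tau>)"
      by (simp add: h_def algebra_simps)
    also have "\<dots> = integral {\<tau>..M} (\<lambda>x. w (x, - \<tau>) * Y x) * deriv (deriv \<alpha>) \<tau> - integral {\<tau>..M} (\<lambda>x. w (x, - \<tau>) * Z x) * \<alpha> \<tau>"
      using int[OF Yc] int[OF Z] by (simp add: integral_diff integrable_on_mult_left)
    finally show ?thesis
      by (simp add: wave_adjoint_def h_def algebra_simps)
  qed
  have sub: "{c..d} \<subseteq> {b<..}" using assms(2) by auto
  have adjc: "continuous_on {c..d} (\<lambda>\<tau>. wave_adjoint Y \<tau> * deriv (deriv \<alpha>) \<tau> - wave_adjoint Z \<tau> * \<alpha> \<tau>)"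
    by (intro continuous_intros test_on_continuous[OF \<alpha>] test_on_continuous[OF \<alpha>'']
      continuous_on_subset[OF wave_adjoint_continuous[OF assms(1) Yc] sub]
      continuous_on_subset[OF wave_adjoint_continuous[OF assms(1) Z] sub])
  have "integral {c..d} (\<lambda>\<tau>. integral {\<tau>..M} (\<lambda>x. w (x, - \<tau>) * h \<tau> x))
    = integral {c..d} (\<lambda>\<tau>. wave_adjoint Y \<tau> * deriv (deriv \<alpha>) \<tau> - wave_adjoint Z \<tau> * \<alpha> \<tau> - h \<tau> \<tau>)"
    by (rule integral_cong) (rule inner)
  also have "\<dots> = integral {c..d} (\<lambda>\<tau>. wave_adjoint Y \<tau> * deriv (deriv \<alpha>) \<tau> - wave_adjoint Z \<tau> * \<alpha> \<tau>) - integral {c..d} (\<lambda>\<tau>. h \<tau> \<tau>)"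
    by (intro integral_diff integrable_continuous_real adjc hc)
  finally show ?thesis
    using fundamental_solution_separable[OF fund P A] I1 I2 b' assms(1) by simp
qed

section \<open>Averages of the fundamental solution over time\<close>

definition time_average :: "real \<Rightarrow> (real \<Rightarrow> real) \<Rightarrow> real \<Rightarrow> real" where
  "time_average b \<beta> x = integral {- b..b} (\<lambda>s. w (x, - s) * \<beta> s)"

text \<open>On \<open>x > b\<close> the points \<open>(x, -s)\<close> with \<open>|s| \<le> b\<close> stay inside the sector, so one may differentiate
under the integral; the derivative has the same form with \<open>w\<close> replaced by a derivative of \<open>w\<close>, which
is the coinduction invariant.\<close>

lemma time_average_smooth:
  assumes "0 \<le> b" and \<beta>: "continuous_on {- b..b} \<beta>"
  shows "smooth_on {b<..} (time_average b \<beta>)"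
  unfolding time_average_def[abs_def] using w_smooth
proof (coinduction arbitrary: w)
  case (smooth_on g)
  obtain g' where g': "\<And>p. p \<in> sector \<Longrightarrow> (g has_derivative g' p) (at p within sector)"
    "\<And>v. smooth_on sector (\<lambda>p. g' p v)"
    using smooth_on_derivativeE[OF smooth_on] by blast
  have cont: "continuous_on S (\<lambda>p. h (f1 p, f2 p))" if "smooth_on sector h" "continuous_on S f1" "continuous_on S f2"
    "\<And>p. p \<in> S \<Longrightarrow> \<bar>f2 p\<bar> \<le> f1 p" for h S and f1 f2 :: "'z::topological_space \<Rightarrow> real"
    by (rule continuous_on_compose2[OF continuous_on_smooth[OF that(1)]]) (use that in \<open>auto intro!: continuous_intros\<close>)
  have "((\<lambda>x. integral {- b..b} (\<lambda>s. g (x, - s) * \<beta> s)) has_derivative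
      (\<lambda>v. integral {- b..b} (\<lambda>s. g' (x, - s) (v, 0) * \<beta> s))) (at x within {b<..})" if x: "x \<in> {b<..}" for x
  proof -
    have lin: "g' (x, - s) (v, 0) = g' (x, - s) (1, 0) * v" if "x \<in> {b<..}" "s \<in> {- b..b}" for x s v
    proof -
      have "linear (g' (x, - s))"
        by (rule has_derivative_linear[OF g'(1)]) (use that in auto)
      from linear_cmul[OF this, of v "(1, 0)"] show ?thesis by simp
    qed
    have "((\<lambda>x. integral (cbox (- b) b) (\<lambda>s. g (x, - s) * \<beta> s)) has_real_derivative
      integral (cbox (- b) b) (\<lambda>s. g' (x, - s) (1, 0) * \<beta> s)) (at x within {b<..})"
    proof (rule leibniz_rule_field_derivative[OF _ _ _ x])
      fix x s assume xs: "x \<in> {b<..}" "s \<in> cbox (- b) b"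
      have "(\<lambda>v. g' (x, - s) (v, 0)) = (*) (g' (x, - s) (1, 0))"
        by (rule ext, rule lin) (use xs in auto)
      moreover have "((\<lambda>x. g (x, - s)) has_derivative (\<lambda>v. g' (x, - s) (v, 0))) (at x within {b<..})"
        using xs by (intro has_derivative_in_compose[where f = "\<lambda>x. (x, - s)" and g = g] has_derivative_subset[OF g'(1)])
          (auto intro!: derivative_eq_intros)
      ultimately have "((\<lambda>x. g (x, - s)) has_real_derivative g' (x, - s) (1, 0)) (at x within {b<..})"
        unfolding has_field_derivative_def by (simp only:)
      from DERIV_cmult_right[OF this, of "\<beta> s"]
      show "((\<lambda>x. g (x, - s) * \<beta> s) has_real_derivative g' (x, - s) (1, 0) * \<beta> s) (at x within {b<..})" .
    next
      fix x assume x: "x \<in> {b<..}"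
      show "(\<lambda>s. g (x, - s) * \<beta> s) integrable_on cbox (- b) b"
        using x \<beta> by (intro integrable_continuous continuous_intros cont[OF smooth_on]) auto
    next
      show "continuous_on ({b<..} \<times> cbox (- b) b) (\<lambda>(x, s). g' (x, - s) (1, 0) * \<beta> s)"
        unfolding case_prod_unfold
        by (intro continuous_intros cont[OF g'(2)] continuous_on_compose2[OF \<beta>]) auto
    qed simp
    then have "((\<lambda>x. integral {- b..b} (\<lambda>s. g (x, - s) * \<beta> s)) has_derivative
        (\<lambda>v. integral {- b..b} (\<lambda>s. g' (x, - s) (1, 0) * \<beta> s) * v)) (at x within {b<..})"
      by (simp add: has_field_derivative_def)
    moreover have "integral {- b..b} (\<lambda>s. g' (x, - s) (1, 0) * \<beta> s) * v
        = integral {- b..b} (\<lambda>s. g' (x, - s) (v, 0) * \<beta> s)" for v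
    proof -
      have "integral {- b..b} (\<lambda>s. g' (x, - s) (1, 0) * \<beta> s) * v
          = integral {- b..b} (\<lambda>s. g' (x, - s) (1, 0) * \<beta> s * v)" by simp
      also have "\<dots> = integral {- b..b} (\<lambda>s. g' (x, - s) (v, 0) * \<beta> s)"
        by (rule integral_cong) (simp only: lin[OF x, of _ v] mult_ac)
      finally show ?thesis .
    qed
    ultimately show ?thesis by simp
  qed
  moreover have "\<exists>h. (\<lambda>x. integral {- b..b} (\<lambda>s. g' (x, - s) (v, 0) * \<beta> s))
      = (\<lambda>x. integral {- b..b} (\<lambda>s. h (x, - s) * \<beta> s)) \<and> smooth_on sector h" for v
    by (rule exI[of _ "\<lambda>p. g' p (v, 0)"]) (simp add: g'(2))
  ultimately show ?case
    by (intro exI[of _ "\<lambda>x. integral {- b..b} (\<lambda>s. g (x, - s) * \<beta> s)"]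
        exI[of _ "\<lambda>x v. integral {- b..b} (\<lambda>s. g' (x, - s) (v, 0) * \<beta> s)"]) blast
qed

text \<open>Here the test function \<open>\<gamma> x \<cdot> \<beta> (-t)\<close> is supported strictly inside the sector, so the front does
not contribute. The averaged equation holds weakly in \<open>x\<close>, and then pointwise because both sides are
continuous.\<close>

lemma time_average_ode:
  assumes "0 \<le> b" and \<beta>: "test_on (- b) b \<beta>" and "b < x0"
  shows "deriv (deriv (time_average b \<beta>)) x0 = q x0 * time_average b \<beta> x0 + time_average b (deriv (deriv \<beta>)) x0"
proof -
  note \<beta>'' = test_on_deriv[OF test_on_deriv[OF \<beta>]]
  define Y Z where "Y = time_average b \<beta>" and "Z = time_average b (deriv (deriv \<beta>))"
  have Y: "smooth_on {b<..} Y" and Z: "smooth_on {b<..} Z"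
    using time_average_smooth[OF \<open>0 \<le> b\<close>] test_on_continuous[OF \<beta>] test_on_continuous[OF \<beta>'']
    by (auto simp: Y_def Z_def)
  have Y2: "smooth_on {b<..} (deriv (deriv Y))"
    by (intro smooth_on_deriv Y) auto
  have qs: "smooth_on {b<..} q" by (rule q_smooth_pos[OF \<open>0 \<le> b\<close>])
  define E where "E x = q x * Y x + Z x - deriv (deriv Y) x" for x
  have Ec: "continuous_on {b<..} E"
    unfolding E_def by (intro continuous_intros continuous_on_smooth Y Z Y2 qs)
  define c0 d0 where "c0 = (b + x0) / 2" and "d0 = x0 + 1"
  have c0: "b < c0" "c0 < x0" "x0 < d0" using \<open>b < x0\<close> by (auto simp: c0_def d0_def)
  have weak: "integral {c0..d0} (\<lambda>x. E x * \<gamma> x) = 0" if \<gamma>: "test_on c0 d0 \<gamma>" for \<gamma>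
  proof -
    note \<gamma>'' = test_on_deriv[OF test_on_deriv[OF \<gamma>]]
    define A where "A t = \<beta> (- t)" for t
    have A: "test_on (- b) b A" and A'': "deriv (deriv A) = (\<lambda>x. deriv (deriv \<beta>) (- x))"
      unfolding A_def[abs_def] using test_on_reflect[OF \<beta>] by auto
    define k where "k x t = \<gamma> x * deriv (deriv A) t - deriv (deriv \<gamma>) x * A t + q x * (\<gamma> x * A t)" for x t
    have k0: "k x t = 0" if "x \<notin> {c0..d0} \<or> t \<notin> {- b..b}" for x t
      using that test_on_zero[OF \<gamma>, of x] test_on_zero[OF \<gamma>'', of x] test_on_zero[OF A, of t]
        test_on_zero[OF test_on_deriv[OF test_on_deriv[OF A]], of t] by (auto simp: k_def)
    define S where "S = cbox (c0, - b) (d0, b)"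
    have S: "compact S" by (simp add: S_def compact_cbox)
    have f: "continuous_on S (\<lambda>p. w p * k (fst p) (snd p))"
      unfolding k_def using c0 \<open>0 \<le> b\<close>
      by (intro continuous_intros continuous_on_subset[OF w_continuous]
        continuous_on_compose2[OF continuous_on_smooth[OF qs]]
        continuous_on_compose2[OF test_on_continuous[OF \<gamma>, of UNIV]]
        continuous_on_compose2[OF test_on_continuous[OF \<gamma>'', of UNIV]]
        continuous_on_compose2[OF test_on_continuous[OF A, of UNIV]]
        continuous_on_compose2[OF test_on_continuous[OF test_on_deriv[OF test_on_deriv[OF A]], of UNIV]])
        (auto simp: S_def cbox_Pair_iff)
    have "(LINT x|lebesgue_on {0<..}. k x (- x)) = (LINT x|lebesgue_on {0::real<..}. 0)"
      by (rule Bochner_Integration.integral_cong) (use c0 in \<open>auto intro!: k0\<close>)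
    moreover have "(LINT x|lebesgue_on {0<..}. k x (- x)) + (LINT p|lebesgue_on scattering_domain. w p * k (fst p) (snd p)) = 0"
      unfolding k_def by (rule fundamental_solution_separable[OF fund \<gamma> A]) (use c0 \<open>0 \<le> b\<close> in auto)
    moreover have "(LINT p|lebesgue_on scattering_domain. w p * k (fst p) (snd p)) =
       (LINT p|lborel. indicator S p * (w p * k (fst p) (snd p)))"
    proof (rule lebesgue_on_integral_indicator[OF S f scattering_domain_measurable])
      show "S \<subseteq> scattering_domain"
        using c0 \<open>0 \<le> b\<close> by (auto simp: S_def scattering_domain_def cbox_Pair_iff)
      show "w p * k (fst p) (snd p) = indicator S p * (w p * k (fst p) (snd p))" for p
        using k0[of "fst p" "snd p"] by (cases "p \<in> S") (auto simp: S_def cbox_Pair_eq mem_Times_iff)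
    qed
    ultimately have "0 = (LINT p|lborel. indicator S p * (w p * k (fst p) (snd p)))"
      by simp
    also have "\<dots> = (LINT x|lborel. (LINT t|lborel. indicator S (x, t) * (w (x, t) * k x t)))"
      using planar_Fubini(2)[OF S f] by simp
    also have "\<dots> = (LINT x|lborel. indicator {c0..d0} x * integral {- b..b} (\<lambda>t. w (x, t) * k x t))"
    proof (rule Bochner_Integration.integral_cong[OF refl])
      fix x
      show "(LINT t|lborel. indicator S (x, t) * (w (x, t) * k x t)) = indicator {c0..d0} x * integral {- b..b} (\<lambda>t. w (x, t) * k x t)"
      proof (cases "x \<in> {c0..d0}")
        case True
        then have "(LINT t|lborel. indicator S (x, t) * (w (x, t) * k x t)) = (LINT t|lborel. indicator {- b..b} t * (w (x, t) * k x t))"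
          by (intro Bochner_Integration.integral_cong) (auto simp: S_def cbox_Pair_iff indicator_def)
        also have "\<dots> = integral {- b..b} (\<lambda>t. w (x, t) * k x t)"
        proof (rule lborel_integral_indicator_Icc)
          have "continuous_on {- b..b} (Pair x)" "Pair x ` {- b..b} \<subseteq> S"
            using True by (auto simp: S_def cbox_Pair_iff intro!: continuous_intros)
          from continuous_on_compose2[OF f this] show "continuous_on {- b..b} (\<lambda>t. w (x, t) * k x t)"
            by simp
        qed
        finally show ?thesis using True by simp
      qed (auto simp: S_def cbox_Pair_iff indicator_def)
    qed
    also have "\<dots> = integral {c0..d0} (\<lambda>x. integral {- b..b} (\<lambda>t. w (x, t) * k x t))"
    proof (rule lborel_integral_indicator_Icc)
      have "continuous_on ({c0..d0} \<times> cbox (- b) b) (\<lambda>(x, t). w (x, t) * k x t)"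
        using f by (simp add: S_def case_prod_unfold cbox_Pair_eq)
      then show "continuous_on {c0..d0} (\<lambda>x. integral {- b..b} (\<lambda>t. w (x, t) * k x t))"
        using integral_continuous_on_param[of "{c0..d0}" "- b" b "\<lambda>x t. w (x, t) * k x t"] by simp
    qed
    also have "\<dots> = integral {c0..d0} (\<lambda>x. \<gamma> x * (q x * Y x + Z x) - deriv (deriv \<gamma>) x * Y x)"
    proof (rule integral_cong)
      fix x assume x: "x \<in> {c0..d0}"
      have int: "(\<lambda>s. w (x, - s) * \<psi> s) integrable_on {- b..b}" if "test_on (- b) b \<psi>" for \<psi>
        using x c0 by (intro integrable_continuous_real continuous_intros test_on_continuous[OF that]) auto
      have "integral {- b..b} (\<lambda>t. w (x, t) * k x t) = integral {- b..b} (\<lambda>s. w (x, - s) * k x (- s))"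
        using Henstock_Kurzweil_Integration.integral_reflect_real[of b "- b" "\<lambda>s. w (x, - s) * k x (- s)"] by simp
      also have "\<dots> = integral {- b..b} (\<lambda>s. \<gamma> x * (w (x, - s) * deriv (deriv \<beta>) s)
           + (q x * \<gamma> x - deriv (deriv \<gamma>) x) * (w (x, - s) * \<beta> s))"
        by (simp add: k_def A'' A_def algebra_simps)
      also have "\<dots> = \<gamma> x * Z x + (q x * \<gamma> x - deriv (deriv \<gamma>) x) * Y x"
        using int[OF \<beta>] int[OF \<beta>''] unfolding Y_def Z_def time_average_def
        by (subst integral_add) (auto intro: integrable_on_mult_right)
      finally show "integral {- b..b} (\<lambda>t. w (x, t) * k x t) = \<gamma> x * (q x * Y x + Z x) - deriv (deriv \<gamma>) x * Y x"
        by (simp add: algebra_simps)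
    qed
    also have "\<dots> = integral {c0..d0} (\<lambda>x. \<gamma> x * (q x * Y x + Z x)) - integral {c0..d0} (\<lambda>x. deriv (deriv \<gamma>) x * Y x)"
      using c0 by (intro integral_diff integrable_continuous_real continuous_intros test_on_continuous[OF \<gamma>] test_on_continuous[OF \<gamma>'']
          continuous_on_subset[OF continuous_on_smooth[OF Y]] continuous_on_subset[OF continuous_on_smooth[OF Z]]
          continuous_on_subset[OF continuous_on_smooth[OF qs]]) auto
    also have "integral {c0..d0} (\<lambda>x. deriv (deriv \<gamma>) x * Y x) = integral {c0..d0} (\<lambda>x. \<gamma> x * deriv (deriv Y) x)"
      using c0 by (intro integral_by_parts_test[OF \<gamma> _ _ Y]) auto
    also have "integral {c0..d0} (\<lambda>x. \<gamma> x * (q x * Y x + Z x)) - \<dots> = integral {c0..d0} (\<lambda>x. \<gamma> x * (q x * Y x + Z x) - \<gamma> x * deriv (deriv Y) x)"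
      using c0 by (intro integral_diff[symmetric] integrable_continuous_real continuous_intros test_on_continuous[OF \<gamma>] 
          continuous_on_subset[OF continuous_on_smooth[OF Y]] continuous_on_subset[OF continuous_on_smooth[OF Z]]
          continuous_on_subset[OF continuous_on_smooth[OF Y2]]
          continuous_on_subset[OF continuous_on_smooth[OF qs]]) auto
    finally show ?thesis
      by (simp add: E_def algebra_simps)
  qed
  have "E x0 = 0"
  proof (rule zero_if_bump_integrals_zero[where A = c0 and B = d0 and D = E and ?p0.0 = x0])
    show "continuous_on (cbox c0 d0) E"
      using c0 by (intro continuous_on_subset[OF Ec]) auto
    fix \<epsilon> :: real assume "0 < \<epsilon>"
    define e where "e = min \<epsilon> (min (x0 - c0) 1)"
    have e: "0 < e" "e \<le> \<epsilon>" "e \<le> x0 - c0" "e \<le> 1"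
      using \<open>0 < \<epsilon>\<close> c0 unfolding e_def min_le_iff_disj by auto
    obtain \<psi> where \<psi>: "test_on (x0 - e) (x0 + e) \<psi>" "\<And>x. 0 \<le> \<psi> x" "0 < \<psi> x0" "\<And>x. e \<le> dist x x0 \<Longrightarrow> \<psi> x = 0"
      using test_bump[OF e(1)] by blast
    have t: "test_on c0 d0 \<psi>"
      by (rule test_on_mono[OF \<psi>(1)]) (use e in \<open>auto simp: d0_def\<close>)
    show "\<exists>\<zeta>. continuous_on (cbox c0 d0) \<zeta> \<and> (\<forall>p. 0 \<le> \<zeta> p) \<and> 0 < \<zeta> x0 \<and>
          (\<forall>p. \<epsilon> \<le> dist p x0 \<longrightarrow> \<zeta> p = 0) \<and> integral (cbox c0 d0) (\<lambda>p. E p * \<zeta> p) = 0"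
      using weak[OF t] test_on_continuous[OF t] \<psi>(2,3,4) e(2) by (intro exI[of _ \<psi>]) auto
  qed (use c0 in auto)
  then show ?thesis
    by (simp add: E_def Y_def Z_def)
qed

section \<open>The kernel of the connecting operator\<close>

text \<open>The regular part of the pairing of the fundamental solution at time \<open>-\<tau>\<close> with the one at time
\<open>-s\<close>. It is considered for \<open>|s| \<le> \<tau>\<close>, where \<open>w (\<sqdot>, -s)\<close> is smooth on the half-line \<open>x > \<tau>\<close> of integration.\<close>

definition gram_kernel :: "real \<times> real \<Rightarrow> real" where
  "gram_kernel p = wave_adjoint (\<lambda>x. w (x, - fst p)) (snd p)"

abbreviation cone :: "(real \<times> real) set" where
  "cone \<equiv> {(s, \<tau>). \<bar>s\<bar> \<le> \<tau>}"

lemma gram_kernel_continuous: "continuous_on cone gram_kernel"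
proof -
  have "continuous_on cone (\<lambda>p. w (snd p, - fst p) + integral {snd p..M} (\<lambda>x. w (x, - snd p) * w (x, - fst p)))"
    using M_pos
    by (intro continuous_on_add continuous_on_integral_lower_limit)
      (auto simp: case_prod_unfold intro!: continuous_intros)
  then show ?thesis by (simp add: gram_kernel_def[abs_def] wave_adjoint_def)
qed

lemma gram_kernel_far:
  assumes "a < \<tau>" "\<bar>s\<bar> < \<tau>"
  shows "gram_kernel (s, \<tau>) = r (s + \<tau>)"
  using assms by (simp add: gram_kernel_def wave_adjoint_far w_outgoing add.commute)

lemma wave_adjoint_time_average:
  assumes "0 \<le> b" "b < \<tau>" and \<beta>: "continuous_on {- b..b} \<beta>"
  shows "wave_adjoint (time_average b \<beta>) \<tau> = integral {- b..b} (\<lambda>s. gram_kernel (s, \<tau>) * \<beta> s)"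
proof -
  have ww: "continuous_on (cbox (\<tau>, - b) (M, b)) (\<lambda>(x, s). w (x, - \<tau>) * (w (x, - s) * \<beta> s))"
    using assms(1,2) unfolding case_prod_unfold
    by (intro continuous_intros continuous_on_compose2[OF \<beta>]) (auto simp: cbox_Pair_iff)
  have "continuous_on {- b..b} (\<lambda>s. integral {\<tau>..M} (\<lambda>x. w (x, - \<tau>) * w (x, - s)))"
    using assms(1,2) M_pos
    by (intro continuous_on_integral_lower_limit) (auto simp: case_prod_unfold intro!: continuous_intros)
  note int = integrable_continuous_real[OF continuous_on_mult[OF this \<beta>]]
  have int': "(\<lambda>s. w (\<tau>, - s) * \<beta> s) integrable_on {- b..b}"
    using assms(1,2) by (intro integrable_continuous_real continuous_intros \<beta>) auto
  have "wave_adjoint (time_average b \<beta>) \<tau> = integral {- b..b} (\<lambda>s. w (\<tau>, - s) * \<beta> s)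
      + integral {\<tau>..M} (\<lambda>x. integral {- b..b} (\<lambda>s. w (x, - \<tau>) * (w (x, - s) * \<beta> s)))"
    by (simp add: wave_adjoint_def time_average_def)
  also have "integral {\<tau>..M} (\<lambda>x. integral {- b..b} (\<lambda>s. w (x, - \<tau>) * (w (x, - s) * \<beta> s)))
    = integral {- b..b} (\<lambda>s. integral {\<tau>..M} (\<lambda>x. w (x, - \<tau>) * (w (x, - s) * \<beta> s)))"
    using integral_swap_continuous[OF ww] by simp
  also have "\<dots> = integral {- b..b} (\<lambda>s. integral {\<tau>..M} (\<lambda>x. w (x, - \<tau>) * w (x, - s)) * \<beta> s)"
    by (simp add: mult.assoc[symmetric])
  finally show ?thesis
    using int int' by (simp add: gram_kernel_def wave_adjoint_def distrib_right integral_add)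
qed

text \<open>The function \<open>\<Gamma> (s, \<tau>) - r (s + \<tau>)\<close>, which is continuous on the closed cone. Clamping the
argument to the cone gives a continuous extension to the plane, so that integrals over boxes make
sense.\<close>

definition defect :: "real \<times> real \<Rightarrow> real" where
  "defect = (\<lambda>(s, \<tau>). let \<tau>' = \<bar>\<tau>\<bar>; s' = max (- \<tau>') (min s \<tau>') in gram_kernel (s', \<tau>') - r (s' + \<tau>'))"

lemma r_smooth: "smooth_on {0..} r"
  using resp by (simp add: response_function_def)

lemma defect_continuous: "continuous_on S defect"
proof -
  let ?c = "\<lambda>p::real \<times> real. (max (- \<bar>snd p\<bar>) (min (fst p) \<bar>snd p\<bar>), \<bar>snd p\<bar>)"
  have 1: "continuous_on UNIV (\<lambda>p. gram_kernel (?c p))"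
    by (rule continuous_on_compose2[OF gram_kernel_continuous]) (auto intro!: continuous_intros)
  have 2: "continuous_on UNIV (\<lambda>p. r (fst (?c p) + snd (?c p)))"
    by (rule continuous_on_compose2[OF continuous_on_smooth[OF r_smooth]]) (auto intro!: continuous_intros)
  show ?thesis
    using continuous_on_subset[OF continuous_on_diff[OF 1 2], of S]
    by (simp add: defect_def Let_def case_prod_unfold)
qed

lemma defect_eq: "\<bar>s\<bar> \<le> \<tau> \<Longrightarrow> defect (s, \<tau>) = gram_kernel (s, \<tau>) - r (s + \<tau>)"
  by (auto simp: defect_def Let_def max_def min_def)

text \<open>Both sides equal the integral of \<open>r'' (s + \<tau>)\<close> against \<open>\<beta> \<alpha>\<close>.\<close>

lemma response_weak_wave:
  assumes "0 \<le> b" "b < t1" "t1 \<le> t2" and \<beta>: "test_on (- b) b \<beta>" and \<alpha>: "test_on t1 t2 \<alpha>"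
  shows "integral {t1..t2} (\<lambda>\<tau>. integral {- b..b} (\<lambda>s. r (s + \<tau>) * \<beta> s) * deriv (deriv \<alpha>) \<tau>)
    = integral {t1..t2} (\<lambda>\<tau>. integral {- b..b} (\<lambda>s. r (s + \<tau>) * deriv (deriv \<beta>) s) * \<alpha> \<tau>)"
proof -
  note \<alpha>'' = test_on_deriv[OF test_on_deriv[OF \<alpha>]]
  note \<beta>'' = test_on_deriv[OF test_on_deriv[OF \<beta>]]
  define r2 where "r2 = deriv (deriv r)"
  have rs: "smooth_on {0<..} r" by (rule smooth_on_subset[OF r_smooth]) auto
  have r2: "smooth_on {0<..} r2"
    unfolding r2_def by (intro smooth_on_deriv rs) auto
  have rsh: "smooth_on {- h<..} (\<lambda>x. r (x + h))" "x \<in> {- h<..} \<Longrightarrow> deriv (deriv (\<lambda>x. r (x + h))) x = r2 (x + h)" for h x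
  proof -
    show "smooth_on {- h<..} (\<lambda>x. r (x + h))"
      using smooth_on_compose_affine[OF rs bounded_linear_ident, of "{- h<..}" h] by auto
    have *: "deriv (\<lambda>x. u (x + h)) x = deriv u (x + h)" if "smooth_on {0<..} u" "x \<in> {- h<..}" for u x
      by (rule DERIV_imp_deriv, rule DERIV_chain2[OF smooth_on_deriv(1)[OF that(1)], THEN DERIV_cong])
        (use that(2) in \<open>auto intro!: derivative_eq_intros\<close>)
    assume x: "x \<in> {- h<..}"
    have "deriv (deriv (\<lambda>x. r (x + h))) x = deriv (\<lambda>x. deriv r (x + h)) x"
      by (rule deriv_cong_open[OF _ x]) (auto intro!: *[OF rs])
    also have "\<dots> = r2 (x + h)"
      unfolding r2_def by (rule *[OF smooth_on_deriv(2)[OF rs] x]) simp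
    finally show "deriv (deriv (\<lambda>x. r (x + h))) x = r2 (x + h)" .
  qed
  have swap: "integral {t1..t2} (\<lambda>\<tau>. integral {- b..b} (\<lambda>s. u (s + \<tau>) * \<phi> s) * \<psi> \<tau>)
      = integral {- b..b} (\<lambda>s. integral {t1..t2} (\<lambda>\<tau>. \<psi> \<tau> * u (s + \<tau>)) * \<phi> s)"
    if u: "smooth_on {0<..} u" and "test_on (- b) b \<phi>" "test_on t1 t2 \<psi>" for u \<phi> \<psi>
  proof -
    have "continuous_on (cbox (t1, - b) (t2, b)) (\<lambda>(\<tau>, s). u (s + \<tau>) * \<phi> s * \<psi> \<tau>)"
      using assms(1,2) unfolding case_prod_unfold
      by (intro continuous_intros continuous_on_compose2[OF continuous_on_smooth[OF u]]
          continuous_on_compose2[OF test_on_continuous[OF that(2), of UNIV]]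
          continuous_on_compose2[OF test_on_continuous[OF that(3), of UNIV]])
        (auto simp: cbox_Pair_iff)
    from integral_swap_continuous[OF this]
    have "integral {t1..t2} (\<lambda>\<tau>. integral {- b..b} (\<lambda>s. u (s + \<tau>) * \<phi> s * \<psi> \<tau>))
      = integral {- b..b} (\<lambda>s. integral {t1..t2} (\<lambda>\<tau>. u (s + \<tau>) * \<phi> s * \<psi> \<tau>))"
      by (simp only: cbox_interval)
    also have "\<dots> = integral {- b..b} (\<lambda>s. integral {t1..t2} (\<lambda>\<tau>. \<psi> \<tau> * u (s + \<tau>)) * \<phi> s)"
      by (intro integral_cong) (simp add: mult_ac)
    finally show ?thesis by simp
  qed
  have "integral {t1..t2} (\<lambda>\<tau>. integral {- b..b} (\<lambda>s. r (s + \<tau>) * \<beta> s) * deriv (deriv \<alpha>) \<tau>)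
     = integral {- b..b} (\<lambda>s. integral {t1..t2} (\<lambda>\<tau>. deriv (deriv \<alpha>) \<tau> * r (s + \<tau>)) * \<beta> s)"
    by (rule swap[OF rs \<beta> \<alpha>''])
  also have "\<dots> = integral {- b..b} (\<lambda>s. integral {t1..t2} (\<lambda>\<tau>. \<alpha> \<tau> * r2 (s + \<tau>)) * \<beta> s)"
  proof (rule integral_cong, rule arg_cong2[where f = "(*)", OF _ refl])
    fix s assume s: "s \<in> {- b..b}"
    have "integral {t1..t2} (\<lambda>\<tau>. deriv (deriv \<alpha>) \<tau> * r (\<tau> + s)) = integral {t1..t2} (\<lambda>\<tau>. \<alpha> \<tau> * deriv (deriv (\<lambda>\<tau>. r (\<tau> + s))) \<tau>)"
      by (rule integral_by_parts_test[OF \<alpha> _ assms(3) rsh(1)]) (use s assms in auto)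
    also have "\<dots> = integral {t1..t2} (\<lambda>\<tau>. \<alpha> \<tau> * r2 (\<tau> + s))"
      by (intro integral_cong arg_cong2[where f = "(*)"] refl rsh(2)) (use s assms in auto)
    finally show "integral {t1..t2} (\<lambda>\<tau>. deriv (deriv \<alpha>) \<tau> * r (s + \<tau>)) = integral {t1..t2} (\<lambda>\<tau>. \<alpha> \<tau> * r2 (s + \<tau>))"
      by (simp add: add.commute)
  qed
  also have "\<dots> = integral {t1..t2} (\<lambda>\<tau>. integral {- b..b} (\<lambda>s. r2 (s + \<tau>) * \<beta> s) * \<alpha> \<tau>)"
    by (rule swap[OF r2 \<beta> \<alpha>, symmetric])
  also have "\<dots> = integral {t1..t2} (\<lambda>\<tau>. integral {- b..b} (\<lambda>s. r (s + \<tau>) * deriv (deriv \<beta>) s) * \<alpha> \<tau>)"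
  proof (rule integral_cong, rule arg_cong2[where f = "(*)", OF _ refl])
    fix \<tau> assume \<tau>: "\<tau> \<in> {t1..t2}"
    have "integral {- b..b} (\<lambda>s. deriv (deriv \<beta>) s * r (s + \<tau>)) = integral {- b..b} (\<lambda>s. \<beta> s * deriv (deriv (\<lambda>s. r (s + \<tau>))) s)"
      by (rule integral_by_parts_test[OF \<beta> _ _ rsh(1)]) (use \<tau> assms in auto)
    also have "\<dots> = integral {- b..b} (\<lambda>s. \<beta> s * r2 (s + \<tau>))"
      by (intro integral_cong arg_cong2[where f = "(*)"] refl rsh(2)) (use \<tau> assms in auto)
    finally show "integral {- b..b} (\<lambda>s. r2 (s + \<tau>) * \<beta> s) = integral {- b..b} (\<lambda>s. r (s + \<tau>) * deriv (deriv \<beta>) s)"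
      by (simp add: mult.commute)
  qed
  finally show ?thesis .
qed

text \<open>The contribution of \<open>\<Gamma>\<close> is the weak equation for the adjoint of a time average; the
contribution of the response function vanishes by itself.\<close>

lemma defect_weak_wave:
  assumes "s1 \<le> s2" "t1 \<le> t2" "\<bar>s1\<bar> < t1" "\<bar>s2\<bar> < t1" "- N \<le> s1" "s2 \<le> N" "t2 \<le> N"
    and \<beta>: "test_on s1 s2 \<beta>" and \<alpha>: "test_on t1 t2 \<alpha>"
  shows "integral (cbox (- N, 0) (N, N)) (\<lambda>p. defect p *
    (\<beta> (fst p) * deriv (deriv \<alpha>) (snd p) - deriv (deriv \<beta>) (fst p) * \<alpha> (snd p))) = 0"
proof -
  define b where "b = max \<bar>s1\<bar> \<bar>s2\<bar>"
  have b: "0 \<le> b" "b < t1" "b \<le> N" "- b \<le> s1" "s2 \<le> b"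
    using assms by (auto simp: b_def)
  note \<alpha>'' = test_on_deriv[OF test_on_deriv[OF \<alpha>]]
  have \<beta>b: "test_on (- b) b \<beta>" by (rule test_on_mono[OF \<beta>]) (use b in auto)
  note \<beta>'' = test_on_deriv[OF test_on_deriv[OF \<beta>b]]
  define h where "h s \<tau> = defect (s, \<tau>) * (\<beta> s * deriv (deriv \<alpha>) \<tau> - deriv (deriv \<beta>) s * \<alpha> \<tau>)" for s \<tau>
  have h: "continuous_on S (\<lambda>p. h (fst p) (snd p))" for S
    unfolding h_def
    by (intro continuous_intros continuous_on_compose2[OF defect_continuous[of UNIV]]
        continuous_on_compose2[OF test_on_continuous[OF \<alpha>, of UNIV]]
        continuous_on_compose2[OF test_on_continuous[OF \<alpha>'', of UNIV]]
        continuous_on_compose2[OF test_on_continuous[OF \<beta>b, of UNIV]]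
        continuous_on_compose2[OF test_on_continuous[OF \<beta>'', of UNIV]]) auto
  have hs: "continuous_on S (\<lambda>s. h s \<tau>)" for S \<tau>
    by (rule continuous_on_compose2[OF h[of UNIV], of S "\<lambda>s. (s, \<tau>)", simplified]) (auto intro!: continuous_intros)
  have "integral (cbox (- N, 0) (N, N)) (\<lambda>p. h (fst p) (snd p)) = integral {- N..N} (\<lambda>s. integral {0..N} (\<lambda>\<tau>. h s \<tau>))"
    using integral_prod_continuous[OF h, of "- N" 0 N N] by simp
  also have "\<dots> = integral {0..N} (\<lambda>\<tau>. integral {- N..N} (\<lambda>s. h s \<tau>))"
    using integral_swap_continuous[of "- N" 0 N N h] h by (simp add: case_prod_unfold)
  also have "\<dots> = integral {t1..t2} (\<lambda>\<tau>. integral {- N..N} (\<lambda>s. h s \<tau>))"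
  proof (rule integral_eq_if_zero_outside)
    show "continuous_on {0..N} (\<lambda>\<tau>. integral {- N..N} (\<lambda>s. h s \<tau>))"
    proof -
      have "continuous_on ({0..N} \<times> cbox (- N) N) (\<lambda>p. (snd p, fst p))"
        by (intro continuous_intros)
      from continuous_on_compose2[OF h[of UNIV] this]
      have "continuous_on ({0..N} \<times> cbox (- N) N) (\<lambda>(\<tau>, s). h s \<tau>)"
        by (simp add: case_prod_unfold)
      from integral_continuous_on_param[OF this] show ?thesis by simp
    qed
    show "integral {- N..N} (\<lambda>s. h s \<tau>) = 0" if "\<tau> \<notin> {t1..t2}" for \<tau>
    proof -
      have "\<tau> \<le> t1 \<or> t2 \<le> \<tau>" using that by auto
      then show ?thesis
        using test_on_zero[OF \<alpha>, of \<tau>] test_on_zero[OF \<alpha>'', of \<tau>] by (simp add: h_def)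
    qed
  qed (use assms in auto)
  also have "\<dots> = integral {t1..t2} (\<lambda>\<tau>.
      (wave_adjoint (time_average b \<beta>) \<tau> * deriv (deriv \<alpha>) \<tau> - wave_adjoint (time_average b (deriv (deriv \<beta>))) \<tau> * \<alpha> \<tau>)
      - (integral {- b..b} (\<lambda>s. r (s + \<tau>) * \<beta> s) * deriv (deriv \<alpha>) \<tau>
       - integral {- b..b} (\<lambda>s. r (s + \<tau>) * deriv (deriv \<beta>) s) * \<alpha> \<tau>))"
  proof (rule integral_cong)
    fix \<tau> assume \<tau>: "\<tau> \<in> {t1..t2}"
    have K: "(\<lambda>s. gram_kernel (s, \<tau>) * \<phi> s) integrable_on {- b..b}" and R: "(\<lambda>s. r (s + \<tau>) * \<phi> s) integrable_on {- b..b}"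
      if "test_on (- b) b \<phi>" for \<phi>
      using \<tau> b by (auto intro!: integrable_continuous_real continuous_intros test_on_continuous[OF that]
          continuous_on_compose2[OF gram_kernel_continuous] continuous_on_compose2[OF continuous_on_smooth[OF r_smooth]])
    have "integral {- N..N} (\<lambda>s. h s \<tau>) = integral {- b..b} (\<lambda>s. h s \<tau>)"
    proof (rule integral_eq_if_zero_outside[OF _ hs])
      show "h s \<tau> = 0" if "s \<notin> {- b..b}" for s
        using test_on_zero[OF \<beta>b, of s] test_on_zero[OF \<beta>'', of s] that by (auto simp: h_def)
    qed (use b in auto)
    also have "\<dots> = integral {- b..b} (\<lambda>s. deriv (deriv \<alpha>) \<tau> * (gram_kernel (s, \<tau>) * \<beta> s)
       - \<alpha> \<tau> * (gram_kernel (s, \<tau>) * deriv (deriv \<beta>) s)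
       - (deriv (deriv \<alpha>) \<tau> * (r (s + \<tau>) * \<beta> s) - \<alpha> \<tau> * (r (s + \<tau>) * deriv (deriv \<beta>) s)))"
      by (rule integral_cong) (use \<tau> b in \<open>auto simp: h_def defect_eq algebra_simps\<close>)
    also have "\<dots> = deriv (deriv \<alpha>) \<tau> * integral {- b..b} (\<lambda>s. gram_kernel (s, \<tau>) * \<beta> s)
       - \<alpha> \<tau> * integral {- b..b} (\<lambda>s. gram_kernel (s, \<tau>) * deriv (deriv \<beta>) s)
       - (deriv (deriv \<alpha>) \<tau> * integral {- b..b} (\<lambda>s. r (s + \<tau>) * \<beta> s)
          - \<alpha> \<tau> * integral {- b..b} (\<lambda>s. r (s + \<tau>) * deriv (deriv \<beta>) s))"
      using K[OF \<beta>b] K[OF \<beta>''] R[OF \<beta>b] R[OF \<beta>'']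
      by (simp add: integral_diff integrable_diff integrable_on_mult_right)
    finally show "integral {- N..N} (\<lambda>s. h s \<tau>) =
      (wave_adjoint (time_average b \<beta>) \<tau> * deriv (deriv \<alpha>) \<tau> - wave_adjoint (time_average b (deriv (deriv \<beta>))) \<tau> * \<alpha> \<tau>)
      - (integral {- b..b} (\<lambda>s. r (s + \<tau>) * \<beta> s) * deriv (deriv \<alpha>) \<tau>
       - integral {- b..b} (\<lambda>s. r (s + \<tau>) * deriv (deriv \<beta>) s) * \<alpha> \<tau>)"
      using wave_adjoint_time_average[OF b(1), of \<tau> \<beta>] wave_adjoint_time_average[OF b(1), of \<tau> "deriv (deriv \<beta>)"]
        test_on_continuous[OF \<beta>b] test_on_continuous[OF \<beta>''] \<tau> b(2)
      by (simp add: mult.commute)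
  qed
  also have "\<dots> = 0"
  proof -
    have sub: "{t1..t2} \<subseteq> {b<..}" using b by auto
    have mom: "continuous_on {b<..} (time_average b \<phi>)" if "test_on (- b) b \<phi>" for \<phi>
      by (rule continuous_on_smooth[OF time_average_smooth[OF b(1) test_on_continuous[OF that]]])
    have ac: "continuous_on {t1..t2} (wave_adjoint (time_average b \<phi>))" if "test_on (- b) b \<phi>" for \<phi>
      by (rule continuous_on_subset[OF wave_adjoint_continuous[OF b(1) mom[OF that]] sub])
    have rc: "continuous_on {t1..t2} (\<lambda>\<tau>. integral {- b..b} (\<lambda>s. r (s + \<tau>) * \<phi> s))" if "test_on (- b) b \<phi>" for \<phi>
    proof -
      have "continuous_on ({t1..t2} \<times> cbox (- b) b) (\<lambda>(\<tau>, s). r (s + \<tau>) * \<phi> s)"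
        unfolding case_prod_unfold using b
        by (intro continuous_intros continuous_on_compose2[OF continuous_on_smooth[OF r_smooth]]
            continuous_on_compose2[OF test_on_continuous[OF that, of UNIV]]) auto
      from integral_continuous_on_param[OF this] show ?thesis by simp
    qed
    have "integral {t1..t2} (\<lambda>\<tau>. wave_adjoint (time_average b \<beta>) \<tau> * deriv (deriv \<alpha>) \<tau> - wave_adjoint (time_average b (deriv (deriv \<beta>))) \<tau> * \<alpha> \<tau>) = 0"
      by (rule wave_adjoint_weak[OF b(1,2) assms(2) \<alpha> time_average_smooth[OF b(1) test_on_continuous[OF \<beta>b]] mom[OF \<beta>'']
          time_average_ode[OF b(1) \<beta>b]])
    moreover have "integral {t1..t2} (\<lambda>\<tau>. integral {- b..b} (\<lambda>s. r (s + \<tau>) * \<beta> s) * deriv (deriv \<alpha>) \<tau>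
        - integral {- b..b} (\<lambda>s. r (s + \<tau>) * deriv (deriv \<beta>) s) * \<alpha> \<tau>) = 0"
      using response_weak_wave[OF b(1,2) assms(2) \<beta>b \<alpha>] rc[OF \<beta>b] rc[OF \<beta>'']
      by (subst integral_diff)
        (auto intro!: integrable_continuous_real continuous_intros test_on_continuous[OF \<alpha>] test_on_continuous[OF \<alpha>''])
    ultimately show ?thesis
      using ac[OF \<beta>b] ac[OF \<beta>''] rc[OF \<beta>b] rc[OF \<beta>'']
      by (subst integral_diff)
        (auto intro!: integrable_continuous_real continuous_intros test_on_continuous[OF \<alpha>] test_on_continuous[OF \<alpha>''])
  qed
  finally show ?thesis by (simp add: h_def)
qed

lemma test_product_derivative:
  assumes \<beta>: "test_on s1 s2 \<beta>" and \<alpha>: "test_on t1 t2 \<alpha>"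
  shows "((\<lambda>p. \<beta> (fst p) * \<alpha> (snd p)) has_derivative
    (\<lambda>v. fst v * (deriv \<beta> (fst p) * \<alpha> (snd p)) + snd v * (\<beta> (fst p) * deriv \<alpha> (snd p)))) (at p)"
  by (rule has_derivative_mult[OF DERIV_compose_FDERIV[OF test_on_DERIV[OF \<beta>] has_derivative_fst[OF has_derivative_ident]]
        DERIV_compose_FDERIV[OF test_on_DERIV[OF \<alpha>] has_derivative_snd[OF has_derivative_ident]],
        THEN has_derivative_eq_rhs])
    (auto simp: algebra_simps)

lemma test_product_continuous:
  assumes \<beta>: "test_on s1 s2 \<beta>" and \<alpha>: "test_on t1 t2 \<alpha>"
  shows "continuous_on S (\<lambda>p. \<beta> (fst p) * \<alpha> (snd p))"
  by (intro continuous_intros continuous_on_compose2[OF test_on_continuous[OF \<alpha>, of UNIV]]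
        continuous_on_compose2[OF test_on_continuous[OF \<beta>, of UNIV]]) auto

text \<open>The wave operator factors, and its right factor, tested with \<open>\<beta>\<close> and \<open>\<alpha>\<close>, is transported along the
characteristic direction \<open>(1, 1)\<close>. After time \<open>T\<close> the support lies in \<open>\<tau> > a\<close>, where the defect is
zero.\<close>

lemma defect_first_order:
  assumes "s1 \<le> s2" "t1 \<le> t2" "\<bar>s1\<bar> < t1" "\<bar>s2\<bar> < t1" "- N \<le> s1" "s2 + T \<le> N" "t2 + T \<le> N"
    and T: "0 \<le> T" "a < t1 + T"
    and \<beta>: "test_on s1 s2 \<beta>" and \<alpha>: "test_on t1 t2 \<alpha>"
  shows "integral (cbox (- N, 0) (N, N)) (\<lambda>p. defect p *
    (\<beta> (fst p) * deriv \<alpha> (snd p) - deriv \<beta> (fst p) * \<alpha> (snd p))) = 0"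
proof -
  note \<alpha>' = test_on_deriv[OF \<alpha>]
  note \<beta>' = test_on_deriv[OF \<beta>]
  note \<alpha>'' = test_on_deriv[OF \<alpha>']
  note \<beta>'' = test_on_deriv[OF \<beta>']
  show ?thesis
  proof (rule transport_integral_zero[where v = "(1, 1)", OF defect_continuous _ _ _ T(1)])
    show "((\<lambda>p. \<beta> (fst p) * deriv \<alpha> (snd p) - deriv \<beta> (fst p) * \<alpha> (snd p)) has_derivative
      (\<lambda>v. (fst v * (deriv \<beta> (fst p) * deriv \<alpha> (snd p)) + snd v * (\<beta> (fst p) * deriv (deriv \<alpha>) (snd p)))
         - (fst v * (deriv (deriv \<beta>) (fst p) * \<alpha> (snd p)) + snd v * (deriv \<beta> (fst p) * deriv \<alpha> (snd p))))) (at p)" for p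
      by (rule has_derivative_diff[OF test_product_derivative[OF \<beta> \<alpha>'] test_product_derivative[OF \<beta>' \<alpha>]])
    show "continuous_on UNIV (\<lambda>p. \<beta> (fst p) * deriv (deriv \<alpha>) (snd p) - deriv (deriv \<beta>) (fst p) * \<alpha> (snd p))"
      by (rule continuous_on_diff[OF test_product_continuous[OF \<beta> \<alpha>''] test_product_continuous[OF \<beta>'' \<alpha>]])
  next
    fix \<sigma> assume \<sigma>: "0 \<le> \<sigma>" "\<sigma> \<le> T"
    have "integral (cbox (- N, 0) (N, N)) (\<lambda>p. defect p * 
        ((\<lambda>s. \<beta> (s - \<sigma>)) (fst p) * deriv (deriv (\<lambda>s. \<alpha> (s - \<sigma>))) (snd p) -
          deriv (deriv (\<lambda>s. \<beta> (s - \<sigma>))) (fst p) * (\<lambda>s. \<alpha> (s - \<sigma>)) (snd p))) = 0"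
      by (rule defect_weak_wave[OF _ _ _ _ _ _ _ test_on_shift(1)[OF \<beta>, of \<sigma>] test_on_shift(1)[OF \<alpha>, of \<sigma>]])
        (use assms \<sigma> in auto)
    then show "integral (cbox (- N, 0) (N, N)) (\<lambda>p. defect p *
      (\<beta> (fst (p - \<sigma> *\<^sub>R (1, 1))) * deriv (deriv \<alpha>) (snd (p - \<sigma> *\<^sub>R (1, 1)))
       - deriv (deriv \<beta>) (fst (p - \<sigma> *\<^sub>R (1, 1))) * \<alpha> (snd (p - \<sigma> *\<^sub>R (1, 1))))) = 0"
      by (simp add: test_on_shift(2)[OF \<alpha>] test_on_shift(2)[OF \<beta>] test_on_shift(2)[OF \<alpha>'] test_on_shift(2)[OF \<beta>'])
  next
    have "defect p * (\<beta> (fst (p - T *\<^sub>R (1, 1))) * deriv \<alpha> (snd (p - T *\<^sub>R (1, 1)))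
       - deriv \<beta> (fst (p - T *\<^sub>R (1, 1))) * \<alpha> (snd (p - T *\<^sub>R (1, 1)))) = 0" for p
    proof (cases "s1 < fst p - T \<and> fst p - T < s2 \<and> t1 < snd p - T \<and> snd p - T < t2")
      case True
      then have "\<bar>fst p\<bar> < snd p" "a < snd p" using assms by auto
      then have "defect p = 0"
        using defect_eq[of "fst p" "snd p"] gram_kernel_far[of "snd p" "fst p"] by simp
      then show ?thesis by simp
    next
      case False
      then consider "fst p - T \<le> s1 \<or> s2 \<le> fst p - T" | "snd p - T \<le> t1 \<or> t2 \<le> snd p - T"
        by linarith
      then show ?thesis
      proof cases
        case 1
        then show ?thesis using test_on_zero[OF \<beta>] test_on_zero[OF \<beta>'] by simp
      next
        case 2
        then show ?thesis using test_on_zero[OF \<alpha>] test_on_zero[OF \<alpha>'] by simp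
      qed
    qed
    then show "integral (cbox (- N, 0) (N, N)) (\<lambda>p. defect p * (\<beta> (fst (p - T *\<^sub>R (1, 1))) * deriv \<alpha> (snd (p - T *\<^sub>R (1, 1)))
       - deriv \<beta> (fst (p - T *\<^sub>R (1, 1))) * \<alpha> (snd (p - T *\<^sub>R (1, 1))))) = 0"
      by (simp only: integral_0)
  qed simp
qed

text \<open>Transport along the other characteristic \<open>(-1, 1)\<close>, whose derivative of \<open>\<beta> \<alpha>\<close> is the
first order expression already known to be annihilated.\<close>

lemma defect_zeroth_order:
  assumes "s1 \<le> s2" "t1 \<le> t2" "\<bar>s1\<bar> < t1" "\<bar>s2\<bar> < t1" "- N \<le> s1 - T" "s2 + T \<le> N" "t2 + 2 * T \<le> N"
    and T: "0 \<le> T" "a < t1 + T"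
    and \<beta>: "test_on s1 s2 \<beta>" and \<alpha>: "test_on t1 t2 \<alpha>"
  shows "integral (cbox (- N, 0) (N, N)) (\<lambda>p. defect p * (\<beta> (fst p) * \<alpha> (snd p))) = 0"
proof -
  note \<alpha>' = test_on_deriv[OF \<alpha>]
  note \<beta>' = test_on_deriv[OF \<beta>]
  show ?thesis
  proof (rule transport_integral_zero[where v = "(- 1, 1)", OF defect_continuous test_product_derivative[OF \<beta> \<alpha>] _ _ T(1)])
    show "continuous_on UNIV (\<lambda>p. \<beta> (fst p) * deriv \<alpha> (snd p) - deriv \<beta> (fst p) * \<alpha> (snd p))"
      by (rule continuous_on_diff[OF test_product_continuous[OF \<beta> \<alpha>'] test_product_continuous[OF \<beta>' \<alpha>]])
  next
    fix \<sigma> assume \<sigma>: "0 \<le> \<sigma>" "\<sigma> \<le> T"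
    have "integral (cbox (- N, 0) (N, N)) (\<lambda>p. defect p * 
        ((\<lambda>s. \<beta> (s - (- \<sigma>))) (fst p) * deriv (\<lambda>s. \<alpha> (s - \<sigma>)) (snd p) -
          deriv (\<lambda>s. \<beta> (s - (- \<sigma>))) (fst p) * (\<lambda>s. \<alpha> (s - \<sigma>)) (snd p))) = 0"
      by (rule defect_first_order[OF _ _ _ _ _ _ _ T(1) _ test_on_shift(1)[OF \<beta>, of "- \<sigma>"] test_on_shift(1)[OF \<alpha>, of \<sigma>]])
        (use assms \<sigma> in auto)
    then show "integral (cbox (- N, 0) (N, N)) (\<lambda>p. defect p *
      (\<beta> (fst (p - \<sigma> *\<^sub>R (- 1, 1))) * deriv \<alpha> (snd (p - \<sigma> *\<^sub>R (- 1, 1)))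
       - deriv \<beta> (fst (p - \<sigma> *\<^sub>R (- 1, 1))) * \<alpha> (snd (p - \<sigma> *\<^sub>R (- 1, 1))))) = 0"
      unfolding test_on_shift(2)[OF \<alpha>] test_on_shift(2)[OF \<beta>] by simp
  next
    have "defect p * (\<beta> (fst (p - T *\<^sub>R (- 1, 1))) * \<alpha> (snd (p - T *\<^sub>R (- 1, 1)))) = 0" for p
    proof (cases "s1 < fst p + T \<and> fst p + T < s2 \<and> t1 < snd p - T \<and> snd p - T < t2")
      case True
      then have "\<bar>fst p\<bar> < snd p" "a < snd p" using assms by auto
      then have "defect p = 0"
        using defect_eq[of "fst p" "snd p"] gram_kernel_far[of "snd p" "fst p"] by simp
      then show ?thesis by simp
    next
      case False
      then consider "fst p + T \<le> s1 \<or> s2 \<le> fst p + T" | "snd p - T \<le> t1 \<or> t2 \<le> snd p - T"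
        by linarith
      then show ?thesis
        using test_on_zero[OF \<beta>] test_on_zero[OF \<alpha>] by cases simp_all
    qed
    then show "integral (cbox (- N, 0) (N, N)) (\<lambda>p. defect p * (\<beta> (fst (p - T *\<^sub>R (- 1, 1))) * \<alpha> (snd (p - T *\<^sub>R (- 1, 1))))) = 0"
      by (simp only: integral_0)
  qed simp
qed

theorem gram_kernel_eq_response:
  assumes "\<bar>s\<bar> < \<tau>"
  shows "gram_kernel (s, \<tau>) = r (s + \<tau>)"
proof -
  \<comment> \<open>Time \<open>T\<close> lifts any point of the cone above \<open>a\<close>; two successive lifts must fit into the box.\<close>
  define T N where "T = a + 1" and "N = \<bar>s\<bar> + \<tau> + 2 * T + 1"
  have N: "0 < T" "a < T" "\<bar>s\<bar> + \<tau> + 2 * T + 1 = N" "0 < N"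
    using a_nonneg assms by (auto simp: T_def N_def)
  have "defect (s, \<tau>) = 0"
  proof (rule zero_if_bump_integrals_zero[where A = "(- N, 0)" and B = "(N, N)" and D = defect and ?p0.0 = "(s, \<tau>)", OF defect_continuous])
    show "box (- N, 0) (N, N) \<noteq> {}"
      using N by (auto simp: box_ne_empty Basis_prod_def)
    show "(s, \<tau>) \<in> cbox (- N, 0) (N, N)"
      using N assms by (auto simp: cbox_Pair_iff)
    fix \<epsilon> :: real assume "0 < \<epsilon>"
    \<comment> \<open>The square of half-width \<open>e\<close> has to stay inside the cone: \<open>\<bar>s\<bar> + e < \<tau> - e\<close>.\<close>
    define e where "e = min (\<epsilon> / 2) (min ((\<tau> - \<bar>s\<bar>) / 4) 1)"
    have e: "0 < e" "e \<le> \<epsilon> / 2" "e \<le> (\<tau> - \<bar>s\<bar>) / 4" "e \<le> 1"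
      using \<open>0 < \<epsilon>\<close> assms unfolding e_def min_le_iff_disj by auto
    obtain \<beta> where \<beta>: "test_on (s - e) (s + e) \<beta>" "\<And>x. 0 \<le> \<beta> x" "0 < \<beta> s" "\<And>x. e \<le> dist x s \<Longrightarrow> \<beta> x = 0"
      using test_bump[OF e(1)] by blast
    obtain \<alpha> where \<alpha>: "test_on (\<tau> - e) (\<tau> + e) \<alpha>" "\<And>x. 0 \<le> \<alpha> x" "0 < \<alpha> \<tau>" "\<And>x. e \<le> dist x \<tau> \<Longrightarrow> \<alpha> x = 0"
      using test_bump[OF e(1)] by blast
    have "\<beta> (fst p) * \<alpha> (snd p) = 0" if "\<epsilon> \<le> dist p (s, \<tau>)" for p
    proof -
      have "dist p (s, \<tau>) \<le> dist (fst p) s + dist (snd p) \<tau>"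
        by (cases p) (simp add: dist_Pair_Pair sqrt_sum_squares_le_sum)
      then have "e \<le> dist (fst p) s \<or> e \<le> dist (snd p) \<tau>"
        using that e(2) by linarith
      then show ?thesis using \<beta>(4) \<alpha>(4) by auto
    qed
    moreover have "integral (cbox (- N, 0) (N, N)) (\<lambda>p. defect p * (\<beta> (fst p) * \<alpha> (snd p))) = 0"
    proof (rule defect_zeroth_order[OF _ _ _ _ _ _ _ _ _ \<beta>(1) \<alpha>(1), where T = T])
      have "4 * e \<le> \<tau> - \<bar>s\<bar>" using e(3) by simp
      then show "\<bar>s - e\<bar> < \<tau> - e" "\<bar>s + e\<bar> < \<tau> - e" "- N \<le> s - e - T" "s + e + T \<le> N"
          "\<tau> + e + 2 * T \<le> N" "a < \<tau> - e + T"
        using e(1,4) N by (auto simp: abs_if split: if_splits)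
    qed (use e N in auto)
    ultimately show "\<exists>\<zeta>. continuous_on (cbox (- N, 0) (N, N)) \<zeta> \<and> (\<forall>p. 0 \<le> \<zeta> p) \<and> 0 < \<zeta> (s, \<tau>) \<and>
        (\<forall>p. \<epsilon> \<le> dist p (s, \<tau>) \<longrightarrow> \<zeta> p = 0) \<and> integral (cbox (- N, 0) (N, N)) (\<lambda>p. defect p * \<zeta> p) = 0"
      using test_product_continuous[OF \<beta>(1) \<alpha>(1)] \<beta>(2,3) \<alpha>(2,3)
      by (intro exI[of _ "\<lambda>p. \<beta> (fst p) * \<alpha> (snd p)"]) simp
  qed
  then show ?thesis
    using assms by (simp add: defect_eq)
qed

section \<open>The decaying solution\<close>

lemma wave_adjoint_mult: "wave_adjoint (\<lambda>x. c * Y x) \<tau> = c * wave_adjoint Y \<tau>"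
proof -
  have "integral {\<tau>..M} (\<lambda>x. w (x, - \<tau>) * (c * Y x)) = integral {\<tau>..M} (\<lambda>x. c * (w (x, - \<tau>) * Y x))"
    by (simp add: mult.left_commute)
  then show ?thesis
    by (simp add: wave_adjoint_def algebra_simps)
qed

lemma decaying_solution_smooth:
  assumes "decaying_solution q a k y"
  shows "smooth_on {0<..} y" "\<And>x. 0 < x \<Longrightarrow> deriv (deriv y) x = q x * y x + k\<^sup>2 * y x"
proof -
  obtain y1 y2 where y: "\<And>x. 0 < x \<Longrightarrow> (y has_real_derivative y1 x) (at x)"
    "\<And>x. 0 < x \<Longrightarrow> (y1 has_real_derivative y2 x) (at x)"
    and ode: "\<And>x. 0 < x \<Longrightarrow> - y2 x + q x * y x = - k\<^sup>2 * y x"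
    using assms unfolding decaying_solution_def by blast
  have y2: "y2 x = (q x + k\<^sup>2) * y x" if "0 < x" for x
    using ode[OF that] by (simp add: algebra_simps)
  show "smooth_on {0<..} y"
    by (rule smooth_on_linear_ode[of _ "\<lambda>x. q x + k\<^sup>2" _ y1])
      (use y y2 in \<open>auto intro!: smooth_on_add smooth_on_const q_smooth_pos\<close>)
  fix x :: real assume x: "0 < x"
  have "deriv (deriv y) x = deriv y1 x"
    by (rule deriv_cong_open[of "{0<..}"]) (use x DERIV_imp_deriv[OF y(1)] in auto)
  then show "deriv (deriv y) x = q x * y x + k\<^sup>2 * y x"
    using DERIV_imp_deriv[OF y(2)[OF x]] y2[OF x] by (simp add: algebra_simps)
qed

text \<open>The equation \<open>V'' = k\<^sup>2 V\<close> for the difference \<open>V\<close> of both sides factors into two equations of first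
order. With exponential weights each of them becomes a pure derivative, to which the transport argument
applies; \<open>V = 0\<close> beyond \<open>a\<close> supplies the final condition.\<close>

theorem wave_adjoint_decaying_solution:
  assumes k: "0 < k" and y: "decaying_solution q a k y" and x0: "0 < x0"
  shows "wave_adjoint y x0 = exp (- k * x0)"
proof -
  note ys = decaying_solution_smooth[OF y]
  have yc: "continuous_on {0<..} y" by (rule continuous_on_smooth[OF ys(1)])
  define V where "V x = wave_adjoint y x - exp (- k * x)" for x
  have Vc: "continuous_on {0<..} V"
    unfolding V_def by (intro continuous_intros wave_adjoint_continuous yc) simp
  have V0: "V x = 0" if "a < x" for x
    using that y wave_adjoint_far[OF that, of y] by (simp add: V_def decaying_solution_def)
  have exp_smooth: "smooth_on {0<..} (\<lambda>x::real. exp (- k * x))" and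
    exp_deriv: "deriv (deriv (\<lambda>x. exp (- k * x))) = (\<lambda>x. k\<^sup>2 * exp (- k * x))"
  proof -
    show "smooth_on {0<..} (\<lambda>x::real. exp (- k * x))"
      by (rule smooth_on_linear_ode[of _ "\<lambda>x. k\<^sup>2" _ "\<lambda>x. - k * exp (- k * x)"])
        (auto intro!: smooth_on_const derivative_eq_intros simp: power2_eq_square)
    have "deriv (\<lambda>x. c * exp (- k * x)) = (\<lambda>x. - k * c * exp (- k * x))" for c
      by (rule ext, rule DERIV_imp_deriv) (auto intro!: derivative_eq_intros)
    from this[of 1] this[of "- k"] show "deriv (deriv (\<lambda>x. exp (- k * x))) = (\<lambda>x. k\<^sup>2 * exp (- k * x))"
      by (simp add: power2_eq_square)
  qed
  define T A B where "T = a + 1" and "A = x0 / 2" and "B = x0 + 1 + 2 * T"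
  have T: "0 < T" "a < T" and A: "0 < A" "A < x0" and B: "x0 + 1 + 2 * T = B"
    using a_nonneg x0 by (auto simp: T_def A_def B_def)
  have VB: "continuous_on {A..B} V"
    by (rule continuous_on_subset[OF Vc]) (use A in auto)
  have weak: "integral {A..B} (\<lambda>x. V x * (deriv (deriv \<alpha>) x - k\<^sup>2 * \<alpha> x)) = 0"
    if "A \<le> c" "c \<le> d" "d \<le> B" and \<alpha>: "test_on c d \<alpha>" for c d \<alpha>
  proof -
    note \<alpha>'' = test_on_deriv[OF test_on_deriv[OF \<alpha>]]
    have c: "0 < c" using that A by simp
    have ac: "continuous_on {c..d} (wave_adjoint y)"
      by (rule continuous_on_subset[OF wave_adjoint_continuous[OF order_refl yc]]) (use c in auto)
    have "integral {A..B} (\<lambda>x. V x * (deriv (deriv \<alpha>) x - k\<^sup>2 * \<alpha> x)) =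
       integral {c..d} (\<lambda>x. V x * (deriv (deriv \<alpha>) x - k\<^sup>2 * \<alpha> x))"
    proof (rule integral_eq_if_zero_outside)
      show "continuous_on {A..B} (\<lambda>x. V x * (deriv (deriv \<alpha>) x - k\<^sup>2 * \<alpha> x))"
        by (intro continuous_intros VB test_on_continuous[OF \<alpha>] test_on_continuous[OF \<alpha>''])
      fix x assume "x \<notin> {c..d}"
      then have "x \<le> c \<or> d \<le> x" by auto
      then show "V x * (deriv (deriv \<alpha>) x - k\<^sup>2 * \<alpha> x) = 0"
        using test_on_zero[OF \<alpha>, of x] test_on_zero[OF \<alpha>'', of x] by simp
    qed (use that in auto)
    also have "\<dots> = integral {c..d} (\<lambda>x. (wave_adjoint y x * deriv (deriv \<alpha>) x - wave_adjoint (\<lambda>x. k\<^sup>2 * y x) x * \<alpha> x)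
        - (deriv (deriv \<alpha>) x * exp (- k * x) - \<alpha> x * (k\<^sup>2 * exp (- k * x))))"
      by (rule integral_cong) (simp only: V_def wave_adjoint_mult, simp add: algebra_simps)
    also have "\<dots> = integral {c..d} (\<lambda>x. wave_adjoint y x * deriv (deriv \<alpha>) x - wave_adjoint (\<lambda>x. k\<^sup>2 * y x) x * \<alpha> x)
        - (integral {c..d} (\<lambda>x. deriv (deriv \<alpha>) x * exp (- k * x)) - integral {c..d} (\<lambda>x. \<alpha> x * (k\<^sup>2 * exp (- k * x))))"
      unfolding wave_adjoint_mult
      by (subst integral_diff, (auto intro!: integrable_continuous_real continuous_intros ac
            test_on_continuous[OF \<alpha>] test_on_continuous[OF \<alpha>''])[2],
          subst integral_diff, (auto intro!: integrable_continuous_real continuous_intros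
            test_on_continuous[OF \<alpha>] test_on_continuous[OF \<alpha>''])[2], rule refl)
    also have "\<dots> = 0"
      using wave_adjoint_weak[OF order_refl c that(2) \<alpha> ys(1) continuous_on_mult[OF continuous_on_const yc] ys(2)]
        integral_by_parts_test[OF \<alpha> c that(2) exp_smooth, unfolded exp_deriv]
      by simp
    finally show ?thesis .
  qed
  have support: "V x * (h (x - T)) = 0" if "test_on c d h" "0 < c" for x c d h
  proof (cases "x - T \<le> c")
    case True
    then show ?thesis using test_on_zero[OF that(1)] by simp
  next
    case False
    then show ?thesis using V0[of x] T that(2) by simp
  qed
  have first: "integral {A..B} (\<lambda>x. V x * (deriv \<alpha> x + k * \<alpha> x)) = 0"
    if cd: "A \<le> c" "c \<le> d" "d + T \<le> B" and \<alpha>: "test_on c d \<alpha>" for c d \<alpha>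
  proof -
    note \<alpha>' = test_on_deriv[OF \<alpha>]
    note \<alpha>'' = test_on_deriv[OF \<alpha>']
    \<comment> \<open>The weighted expression has derivative \<open>exp (- k x) (\<alpha>'' - k\<^sup>2 \<alpha>)\<close>.\<close>
    have "integral (cbox A B) (\<lambda>x. V x * exp (k * x) * (exp (- k * x) * (deriv \<alpha> x + k * \<alpha> x))) = 0"
    proof (rule transport_integral_zero[where v = 1 and T = T])
      show "((\<lambda>x. exp (- k * x) * (deriv \<alpha> x + k * \<alpha> x)) has_derivative
        (\<lambda>h. exp (- k * x) * (deriv (deriv \<alpha>) x - k\<^sup>2 * \<alpha> x) * h)) (at x)" for x
      proof -
        have "((\<lambda>x. exp (- k * x) * (deriv \<alpha> x + k * \<alpha> x)) has_real_derivative
          exp (- k * x) * (deriv (deriv \<alpha>) x - k\<^sup>2 * \<alpha> x)) (at x)"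
          by (auto intro!: derivative_eq_intros test_on_DERIV[OF \<alpha>] test_on_DERIV[OF \<alpha>']
              simp: algebra_simps power2_eq_square)
        then show ?thesis by (simp add: has_field_derivative_def)
      qed
      fix \<sigma> :: real assume \<sigma>: "0 \<le> \<sigma>" "\<sigma> \<le> T"
      have "integral {A..B} (\<lambda>x. V x * (deriv (deriv (\<lambda>x. \<alpha> (x - \<sigma>))) x - k\<^sup>2 * \<alpha> (x - \<sigma>))) = 0"
        by (rule weak[OF _ _ _ test_on_shift(1)[OF \<alpha>]]) (use cd \<sigma> in auto)
      then have "exp (k * \<sigma>) * integral {A..B} (\<lambda>x. V x * (deriv (deriv \<alpha>) (x - \<sigma>) - k\<^sup>2 * \<alpha> (x - \<sigma>))) = 0"
        by (simp add: test_on_shift(2)[OF \<alpha>] test_on_shift(2)[OF \<alpha>'])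
      also have "exp (k * \<sigma>) * integral {A..B} (\<lambda>x. V x * (deriv (deriv \<alpha>) (x - \<sigma>) - k\<^sup>2 * \<alpha> (x - \<sigma>)))
        = integral {A..B} (\<lambda>x. exp (k * \<sigma>) * (V x * (deriv (deriv \<alpha>) (x - \<sigma>) - k\<^sup>2 * \<alpha> (x - \<sigma>))))"
        by (rule integral_mult_right[symmetric])
      also have "\<dots> = integral (cbox A B) (\<lambda>x. V x * exp (k * x) * (exp (- k * (x - \<sigma> *\<^sub>R 1)) *
          (deriv (deriv \<alpha>) (x - \<sigma> *\<^sub>R 1) - k\<^sup>2 * \<alpha> (x - \<sigma> *\<^sub>R 1))))"
      proof (unfold cbox_interval, rule integral_cong)
        fix x
        have "exp (k * \<sigma>) = exp (k * x) * exp (- k * (x - \<sigma>))"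
          by (simp add: algebra_simps flip: exp_add)
        then show "exp (k * \<sigma>) * (V x * (deriv (deriv \<alpha>) (x - \<sigma>) - k\<^sup>2 * \<alpha> (x - \<sigma>))) =
          V x * exp (k * x) * (exp (- k * (x - \<sigma> *\<^sub>R 1)) * (deriv (deriv \<alpha>) (x - \<sigma> *\<^sub>R 1) - k\<^sup>2 * \<alpha> (x - \<sigma> *\<^sub>R 1)))"
          by (simp only: real_scaleR_def mult_1_left mult_1_right mult_ac)
      qed
      finally show "integral (cbox A B) (\<lambda>x. V x * exp (k * x) * (exp (- k * (x - \<sigma> *\<^sub>R 1)) *
          (deriv (deriv \<alpha>) (x - \<sigma> *\<^sub>R 1) - k\<^sup>2 * \<alpha> (x - \<sigma> *\<^sub>R 1)))) = 0" .
    next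
      have "V x * exp (k * x) * (exp (- k * (x - T *\<^sub>R 1)) * (deriv \<alpha> (x - T *\<^sub>R 1) + k * \<alpha> (x - T *\<^sub>R 1))) = 0" for x
        using support[OF \<alpha>, of x] support[OF \<alpha>', of x] cd A by auto
      then show "integral (cbox A B) (\<lambda>x. V x * exp (k * x) * (exp (- k * (x - T *\<^sub>R 1)) *
          (deriv \<alpha> (x - T *\<^sub>R 1) + k * \<alpha> (x - T *\<^sub>R 1)))) = 0"
        by (simp only: integral_0)
    qed (use T VB in \<open>auto intro!: continuous_intros test_on_continuous[OF \<alpha>] test_on_continuous[OF \<alpha>'']\<close>)
    moreover have "V x * exp (k * x) * (exp (- k * x) * (deriv \<alpha> x + k * \<alpha> x)) = V x * (deriv \<alpha> x + k * \<alpha> x)" for x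
      by (simp add: exp_minus)
    ultimately show ?thesis by (simp only: cbox_interval)
  qed
  have zeroth: "integral {A..B} (\<lambda>x. V x * \<alpha> x) = 0"
    if cd: "A \<le> c" "c \<le> d" "d + 2 * T \<le> B" and \<alpha>: "test_on c d \<alpha>" for c d \<alpha>
  proof -
    note \<alpha>' = test_on_deriv[OF \<alpha>]
    have "integral (cbox A B) (\<lambda>x. V x * exp (- k * x) * (exp (k * x) * \<alpha> x)) = 0"
    proof (rule transport_integral_zero[where v = 1 and T = T])
      show "((\<lambda>x. exp (k * x) * \<alpha> x) has_derivative
        (\<lambda>h. exp (k * x) * (deriv \<alpha> x + k * \<alpha> x) * h)) (at x)" for x
      proof -
        have "((\<lambda>x. exp (k * x) * \<alpha> x) has_real_derivative exp (k * x) * (deriv \<alpha> x + k * \<alpha> x)) (at x)"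
          by (auto intro!: derivative_eq_intros test_on_DERIV[OF \<alpha>] simp: algebra_simps)
        then show ?thesis by (simp add: has_field_derivative_def)
      qed
      fix \<sigma> :: real assume \<sigma>: "0 \<le> \<sigma>" "\<sigma> \<le> T"
      have "integral {A..B} (\<lambda>x. V x * (deriv (\<lambda>x. \<alpha> (x - \<sigma>)) x + k * \<alpha> (x - \<sigma>))) = 0"
        by (rule first[OF _ _ _ test_on_shift(1)[OF \<alpha>]]) (use cd \<sigma> in auto)
      then have "exp (- k * \<sigma>) * integral {A..B} (\<lambda>x. V x * (deriv \<alpha> (x - \<sigma>) + k * \<alpha> (x - \<sigma>))) = 0"
        by (simp add: test_on_shift(2)[OF \<alpha>])
      also have "exp (- k * \<sigma>) * integral {A..B} (\<lambda>x. V x * (deriv \<alpha> (x - \<sigma>) + k * \<alpha> (x - \<sigma>)))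
        = integral {A..B} (\<lambda>x. exp (- k * \<sigma>) * (V x * (deriv \<alpha> (x - \<sigma>) + k * \<alpha> (x - \<sigma>))))"
        by (rule integral_mult_right[symmetric])
      also have "\<dots> = integral (cbox A B) (\<lambda>x. V x * exp (- k * x) * (exp (k * (x - \<sigma> *\<^sub>R 1)) *
          (deriv \<alpha> (x - \<sigma> *\<^sub>R 1) + k * \<alpha> (x - \<sigma> *\<^sub>R 1))))"
      proof (unfold cbox_interval, rule integral_cong)
        fix x
        have "exp (- k * \<sigma>) = exp (- k * x) * exp (k * (x - \<sigma>))"
          by (simp add: algebra_simps flip: exp_add)
        then show "exp (- k * \<sigma>) * (V x * (deriv \<alpha> (x - \<sigma>) + k * \<alpha> (x - \<sigma>))) =
          V x * exp (- k * x) * (exp (k * (x - \<sigma> *\<^sub>R 1)) * (deriv \<alpha> (x - \<sigma> *\<^sub>R 1) + k * \<alpha> (x - \<sigma> *\<^sub>R 1)))"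
          by (simp only: real_scaleR_def mult_1_left mult_1_right mult_ac)
      qed
      finally show "integral (cbox A B) (\<lambda>x. V x * exp (- k * x) * (exp (k * (x - \<sigma> *\<^sub>R 1)) *
          (deriv \<alpha> (x - \<sigma> *\<^sub>R 1) + k * \<alpha> (x - \<sigma> *\<^sub>R 1)))) = 0" .
    next
      have "V x * exp (- k * x) * (exp (k * (x - T *\<^sub>R 1)) * \<alpha> (x - T *\<^sub>R 1)) = 0" for x
        using support[OF \<alpha>, of x] cd A by auto
      then show "integral (cbox A B) (\<lambda>x. V x * exp (- k * x) * (exp (k * (x - T *\<^sub>R 1)) * \<alpha> (x - T *\<^sub>R 1))) = 0"
        by (simp only: integral_0)
    qed (use T VB in \<open>auto intro!: continuous_intros test_on_continuous[OF \<alpha>] test_on_continuous[OF \<alpha>']\<close>)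
    moreover have "V x * exp (- k * x) * (exp (k * x) * \<alpha> x) = V x * \<alpha> x" for x
      by (simp add: exp_minus)
    ultimately show ?thesis by (simp only: cbox_interval)
  qed
  have "V x0 = 0"
  proof (rule zero_if_bump_integrals_zero[where A = A and B = B and D = V and ?p0.0 = x0])
    show "continuous_on (cbox A B) V" using VB by simp
    fix \<epsilon> :: real assume "0 < \<epsilon>"
    define e where "e = min \<epsilon> (min (x0 - A) 1)"
    have e: "0 < e" "e \<le> \<epsilon>" "e \<le> x0 - A" "e \<le> 1"
      using \<open>0 < \<epsilon>\<close> A unfolding e_def min_le_iff_disj by auto
    obtain \<alpha> where \<alpha>: "test_on (x0 - e) (x0 + e) \<alpha>" "\<And>x. 0 \<le> \<alpha> x" "0 < \<alpha> x0" "\<And>x. e \<le> dist x x0 \<Longrightarrow> \<alpha> x = 0"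
      using test_bump[OF e(1)] by blast
    have "integral {A..B} (\<lambda>x. V x * \<alpha> x) = 0"
      by (rule zeroth[OF _ _ _ \<alpha>(1)]) (use e B in auto)
    then show "\<exists>\<zeta>. continuous_on (cbox A B) \<zeta> \<and> (\<forall>p. 0 \<le> \<zeta> p) \<and> 0 < \<zeta> x0 \<and>
          (\<forall>p. \<epsilon> \<le> dist p x0 \<longrightarrow> \<zeta> p = 0) \<and> integral (cbox A B) (\<lambda>p. V p * \<zeta> p) = 0"
      using \<alpha> e(2) test_on_continuous[OF \<alpha>(1)] by (intro exI[of _ \<alpha>]) auto
  qed (use A B T in auto)
  then show ?thesis by (simp add: V_def)
qed

section \<open>The operator equation\<close>

definition triangle :: "(real \<times> real) set" where
  "triangle = {(x, s). 0 \<le> s \<and> s \<le> x \<and> x \<le> M}"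

text \<open>The kernel of \<open>W - I\<close>.\<close>

definition K :: "real \<times> real \<Rightarrow> real" where
  "K p = indicator triangle p * w (fst p, - snd p)"

definition K_bound :: real where
  "K_bound = (SOME c. \<forall>p\<in>triangle. \<bar>w (fst p, - snd p)\<bar> \<le> c)"

lemma K_bounded_kernel: "bounded_kernel K M K_bound"
proof
  have "closed triangle"
    unfolding triangle_def case_prod_unfold
    by (intro closed_Collect_conj closed_Collect_le continuous_intros)
  moreover have "triangle \<subseteq> cbox (0, 0) (M, M)"
    by (auto simp: triangle_def)
  ultimately have T: "compact triangle"
    using bounded_subset[OF bounded_cbox] compact_eq_bounded_closed by blast
  have wc: "continuous_on triangle (\<lambda>p. w (fst p, - snd p))"
    by (intro continuous_intros) (auto simp: triangle_def)
  have ex: "\<exists>c. \<forall>p\<in>triangle. \<bar>w (fst p, - snd p)\<bar> \<le> c"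
    using compact_imp_bounded[OF compact_continuous_image[OF wc T]] by (auto simp: bounded_real)
  have c: "\<bar>w (fst p, - snd p)\<bar> \<le> K_bound" if "p \<in> triangle" for p
    using someI_ex[OF ex] that unfolding K_bound_def by blast
  show "K \<in> borel_measurable borel"
    using borel_measurable_continuous_on_indicator[OF borel_compact[OF T] wc] by (simp add: K_def[abs_def])
  have "(0, 0) \<in> triangle" using M_pos by (simp add: triangle_def)
  from c[OF this] have "0 \<le> K_bound" by simp
  then show "\<bar>K (x, s)\<bar> \<le> K_bound * (indicator {0..M} x * indicator {0..M} s)" for x s
    using c[of "(x, s)"] by (cases "(x, s) \<in> triangle") (auto simp: K_def triangle_def)
qed

sublocale V: bounded_kernel K M K_bound
  by (rule K_bounded_kernel)

lemma K_eq: "0 \<le> s \<Longrightarrow> s \<le> x \<Longrightarrow> K (x, s) = w (x, - s)"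
  using w_far[of x s] by (auto simp: K_def triangle_def indicator_def)

lemma K_zero: "x < s \<Longrightarrow> K (x, s) = 0" "s < 0 \<Longrightarrow> K (x, s) = 0" "x < 0 \<Longrightarrow> K (x, s) = 0" "M < x \<Longrightarrow> K (x, s) = 0"
  by (auto simp: K_def triangle_def)

lemma control_operator_eq:
  assumes \<phi>: "half_line_version \<phi> \<phi>0" and x: "0 \<le> x"
  shows "control_operator w \<phi> x = \<phi> x + V.operator \<phi>0 x"
proof -
  have m: "\<phi> \<in> borel_measurable half_line" "\<phi>0 \<in> borel_measurable borel" "AE s in half_line. \<phi> s = \<phi>0 s"
    using \<phi> by (auto simp: half_line_version_def square_integrable_def)
  have wm: "(\<lambda>s. w (x, - s)) \<in> borel_measurable (lebesgue_on {0..x})"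
    by (intro continuous_imp_measurable_on_sets_lebesgue continuous_intros) auto
  have "(LINT s|lebesgue_on {0..x}. w (x, - s) * \<phi> s) = (LINT s|lebesgue_on {0..x}. w (x, - s) * \<phi>0 s)"
  proof (rule integral_cong_AE)
    have "\<phi> \<in> borel_measurable (lebesgue_on {0..x})"
      using measurable_restrict_mono[OF m(1), of "{0..x}"] by auto
    then show "(\<lambda>s. w (x, - s) * \<phi> s) \<in> borel_measurable (lebesgue_on {0..x})"
      using wm by (intro borel_measurable_times)
    show "(\<lambda>s. w (x, - s) * \<phi>0 s) \<in> borel_measurable (lebesgue_on {0..x})"
      using m(2) by (intro borel_measurable_times wm measurable_restrict_space1 measurable_completion) simp
    have "AE s in lebesgue_on {0..x}. \<phi> s = \<phi>0 s"
      using m(3) unfolding AE_half_line by (simp add: AE_restrict_space_iff AE_completion_iff) (elim eventually_mono, simp)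
    then show "AE s in lebesgue_on {0..x}. w (x, - s) * \<phi> s = w (x, - s) * \<phi>0 s"
      by eventually_elim simp
  qed
  also have "\<dots> = (LINT s|lebesgue. indicator {0..x} s *\<^sub>R (w (x, - s) * \<phi>0 s))"
    by (rule integral_restrict_space) simp
  also have "\<dots> = (LINT s|lebesgue. K (x, s) * \<phi>0 s)"
  proof (rule Bochner_Integration.integral_cong[OF refl])
    fix s
    show "indicator {0..x} s *\<^sub>R (w (x, - s) * \<phi>0 s) = K (x, s) * \<phi>0 s"
      using K_eq[of s x] K_zero(1)[of x s] K_zero(2)[of s x] by (cases "s \<in> {0..x}") (auto simp: not_le)
  qed
  also have "\<dots> = V.operator \<phi>0 x"
    unfolding V.operator_def
    using borel_measurable_integrable[OF square_integrable_product[OF V.section_square_integrable(1)]] \<phi>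
    by (intro integral_completion) (auto simp: half_line_version_def)
  finally show ?thesis
    using x by (simp add: control_operator_def wave_def)
qed

lemma control_operator_version:
  assumes \<phi>: "half_line_version \<phi> \<phi>0"
  shows "half_line_version (control_operator w \<phi>) (\<lambda>x. \<phi>0 x + V.operator \<phi>0 x)"
proof -
  have s: "square_integrable \<phi>0" and m: "\<phi> \<in> borel_measurable half_line" "AE s in half_line. \<phi> s = \<phi>0 s"
    and z: "\<And>x. x < 0 \<Longrightarrow> \<phi>0 x = 0"
    using \<phi> by (auto simp: half_line_version_def)
  have "V.operator \<phi>0 \<in> borel_measurable half_line"
    using V.operator_square_integrable[OF s]
    by (intro measurable_restrict_space1 measurable_completion) (simp add: square_integrable_def)
  then have "(\<lambda>x. \<phi> x + V.operator \<phi>0 x) \<in> borel_measurable half_line"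
    using m(1) by (intro borel_measurable_add)
  then have "control_operator w \<phi> \<in> borel_measurable half_line"
    by (subst measurable_cong[where g = "\<lambda>x. \<phi> x + V.operator \<phi>0 x"]) (simp_all add: control_operator_eq[OF \<phi>])
  moreover have "AE x in half_line. control_operator w \<phi> x = \<phi>0 x + V.operator \<phi>0 x"
    using m(2) unfolding AE_half_line by eventually_elim (simp add: control_operator_eq[OF \<phi>])
  moreover have "V.operator \<phi>0 x = 0" if "x < 0" for x
    using K_zero(3)[OF that] by (simp add: V.operator_def)
  ultimately show ?thesis
    using square_integrable_add[OF s V.operator_square_integrable[OF s]] z by (simp add: half_line_version_def)
qed

lemma transposed_eq_wave_adjoint:
  assumes y: "continuous_on {0<..} y" and y0: "AE x in half_line. y x = y0 x"
    and m: "y0 \<in> borel_measurable borel" and \<tau>: "0 < \<tau>"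
  shows "wave_adjoint y \<tau> = y \<tau> + V.transposed y0 \<tau>"
proof -
  have c: "continuous_on {\<tau>..M} (\<lambda>x. w (x, - \<tau>) * y x)"
    using \<tau> by (intro continuous_intros continuous_on_subset[OF y]) auto
  have "integral {\<tau>..M} (\<lambda>x. w (x, - \<tau>) * y x) = (LINT x|lborel. indicator {\<tau>..M} x * (w (x, - \<tau>) * y x))"
    by (rule lborel_integral_indicator_Icc[OF c, symmetric])
  also have "\<dots> = V.transposed y0 \<tau>"
    unfolding V.transposed_def
  proof (rule integral_cong_AE)
    show "(\<lambda>x. indicator {\<tau>..M} x * (w (x, - \<tau>) * y x)) \<in> borel_measurable lborel"
      using borel_measurable_continuous_on_indicator[OF _ c] by simp
    show "(\<lambda>x. K (x, \<tau>) * y0 x) \<in> borel_measurable lborel"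
      using V.section_square_integrable(2) m by (simp add: square_integrable_def)
    show "AE x in lborel. indicator {\<tau>..M} x * (w (x, - \<tau>) * y x) = K (x, \<tau>) * y0 x"
      using y0 unfolding AE_half_line
    proof eventually_elim
      case (elim x)
      then show ?case
        using \<tau> K_eq[of \<tau> x] K_zero(1)[of x \<tau>] K_zero(4)[of x \<tau>]
        by (cases "x \<in> {\<tau>..M}") (auto simp: not_le)
    qed
  qed
  finally show ?thesis by (simp add: wave_adjoint_def)
qed

text \<open>Beyond \<open>M\<close> both sides vanish; otherwise the left-hand side is \<open>\<Gamma> (s, \<tau>)\<close>.\<close>

lemma K_convolution:
  assumes "0 \<le> s" "s < \<tau>"
  shows "K (\<tau>, s) + (LINT x|lborel. K (x, s) * K (x, \<tau>)) = r (s + \<tau>)"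
proof (cases "\<tau> \<le> M")
  case True
  have c: "continuous_on {\<tau>..M} (\<lambda>x. w (x, - \<tau>) * w (x, - s))"
    using assms by (intro continuous_intros) auto
  have "(LINT x|lborel. K (x, s) * K (x, \<tau>)) = (LINT x|lborel. indicator {\<tau>..M} x * (w (x, - \<tau>) * w (x, - s)))"
  proof (rule Bochner_Integration.integral_cong[OF refl])
    fix x
    show "K (x, s) * K (x, \<tau>) = indicator {\<tau>..M} x * (w (x, - \<tau>) * w (x, - s))"
      using assms K_eq[of \<tau> x] K_eq[of s x] K_zero(1)[of x \<tau>] K_zero(4)[of x \<tau>]
      by (cases "x \<in> {\<tau>..M}") (auto simp: not_le)
  qed
  also have "\<dots> = integral {\<tau>..M} (\<lambda>x. w (x, - \<tau>) * w (x, - s))"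
    by (rule lborel_integral_indicator_Icc[OF c])
  finally have "K (\<tau>, s) + (LINT x|lborel. K (x, s) * K (x, \<tau>)) = gram_kernel (s, \<tau>)"
    using assms K_eq[of s \<tau>] by (simp add: gram_kernel_def wave_adjoint_def)
  also have "\<dots> = r (s + \<tau>)"
    by (rule gram_kernel_eq_response) (use assms in auto)
  finally show ?thesis .
next
  case False
  have zero: "K (x, s) * K (x, \<tau>) = 0" for x
    using K_zero(1)[of x \<tau>] K_zero(4)[of x \<tau>] False by (cases "x < \<tau>") auto
  have "(LINT x|lborel. K (x, s) * K (x, \<tau>)) = 0"
    unfolding zero by simp
  then show ?thesis
    using False assms M_gt K_zero(4)[of \<tau> s] by (simp add: r_zero)
qed

text \<open>The identity \<open>W\<^sup>* W - I = R\<close>, for a Borel function supported on the half-line. After Fubini the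
left-hand side has the kernel \<open>K (\<tau>, s) + K (s, \<tau>) + \<integral> K (x, s) K (x, \<tau>) dx\<close>, one of whose first two terms is
zero off the diagonal.\<close>

theorem control_gram:
  assumes g: "square_integrable g" and z: "\<And>s. s < 0 \<Longrightarrow> g s = 0" and \<tau>: "0 \<le> \<tau>"
  shows "V.operator g \<tau> + V.transposed (\<lambda>x. g x + V.operator g x) \<tau> = (LINT s|lborel. indicator {0..} s * (r (\<tau> + s) * g s))"
proof -
  note Kg = square_integrable_product[OF V.section_square_integrable(1) g]
  note Kg' = square_integrable_product[OF V.section_square_integrable(2) g]
  have kk: "V.transposed (V.operator g) \<tau> = (LINT s|lborel. g s * (LINT x|lborel. K (x, s) * K (x, \<tau>)))"
    using V.duality[OF g V.section_square_integrable(2)[of \<tau>]]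
    by (simp add: V.transposed_def mult.commute)
  have "square_integrable (\<lambda>s. LINT x|lborel. K (x, s) * K (x, \<tau>))"
    using V.transposed_square_integrable[OF V.section_square_integrable(2)[of \<tau>]]
    by (simp add: V.transposed_def[abs_def])
  then have Kkg: "integrable lborel (\<lambda>s. g s * (LINT x|lborel. K (x, s) * K (x, \<tau>)))"
    by (rule square_integrable_product[OF g])
  have "V.operator g \<tau> + V.transposed (\<lambda>x. g x + V.operator g x) \<tau>
     = (LINT s|lborel. K (\<tau>, s) * g s) + ((LINT s|lborel. K (s, \<tau>) * g s) + (LINT s|lborel. g s * (LINT x|lborel. K (x, s) * K (x, \<tau>))))"
    unfolding V.transposed_add[OF g V.operator_square_integrable[OF g]] kk by (simp add: V.operator_def V.transposed_def)
  also have "\<dots> = (LINT s|lborel. K (\<tau>, s) * g s + (K (s, \<tau>) * g s + g s * (LINT x|lborel. K (x, s) * K (x, \<tau>))))"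
    using Kg Kg' Kkg by simp
  also have "\<dots> = (LINT s|lborel. indicator {0..} s * (r (\<tau> + s) * g s))"
  proof (rule integral_cong_AE)
    show "AE s in lborel. K (\<tau>, s) * g s + (K (s, \<tau>) * g s + g s * (LINT x|lborel. K (x, s) * K (x, \<tau>)))
        = indicator {0..} s * (r (\<tau> + s) * g s)"
      using AE_lborel_singleton[of \<tau>]
    proof eventually_elim
      case (elim s)
      consider "s < 0" | "0 \<le> s" "s < \<tau>" | "\<tau> < s" using elim by linarith
      then show ?case
      proof cases
        case 1
        then show ?thesis by (simp add: z)
      next
        case 2
        then show ?thesis
          using K_convolution[of s \<tau>] K_zero(1)[of s \<tau>]
          by (simp add: add.commute[of \<tau>] flip: distrib_right K_convolution) (simp add: algebra_simps)
      next
        case 3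
        then show ?thesis
          using K_convolution[of \<tau> s] K_zero(1)[of \<tau> s] \<tau>
          by (simp flip: K_convolution) (simp add: algebra_simps)
      qed
    qed
    show "(\<lambda>s. K (\<tau>, s) * g s + (K (s, \<tau>) * g s + g s * (LINT x|lborel. K (x, s) * K (x, \<tau>)))) \<in> borel_measurable lborel"
      by (intro borel_measurable_integrable Bochner_Integration.integrable_add Kg Kg' Kkg)
    have "continuous_on {0..} (\<lambda>s. r (\<tau> + s))"
      using \<tau> by (intro continuous_on_compose2[OF continuous_on_smooth[OF r_smooth]] continuous_intros) auto
    from borel_measurable_continuous_on_indicator[OF _ this]
    have "(\<lambda>s. (indicator {0..} s * r (\<tau> + s)) * g s) \<in> borel_measurable lborel"
      using square_integrable_measurable[OF g] by simp
    then show "(\<lambda>s. indicator {0..} s * (r (\<tau> + s) * g s)) \<in> borel_measurable lborel"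
      by (simp add: mult.assoc)
  qed
  finally show ?thesis .
qed

theorem inverse_image_of_decaying_solution:
  assumes k: "0 < k" and y: "decaying_solution q a k y"
    and f: "f \<in> L2" and Wf: "AE x in half_line. control_operator w f x = y x"
  shows "connecting_maps w f (\<lambda>\<tau>. exp (- k * \<tau>))"
    and "\<forall>g\<in>L2. connecting_maps w g (\<lambda>\<tau>. exp (- k * \<tau>)) \<longrightarrow> (AE \<tau> in half_line. g \<tau> = f \<tau>)"
    and "AE \<tau> in half_line. f \<tau> + (LINT s|half_line. r (\<tau> + s) * f s) = exp (- k * \<tau>)"
proof -
  obtain f0 where f0: "half_line_version f f0" using L2_version[OF f] by blast
  have f0': "square_integrable f0" "\<And>s. s < 0 \<Longrightarrow> f0 s = 0" "AE s in half_line. f s = f0 s" 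
    using f0 by (auto simp: half_line_version_def)
  define y0 where "y0 x = f0 x + V.operator f0 x" for x
  have y0: "half_line_version (control_operator w f) y0"
    using control_operator_version[OF f0] by (simp add: y0_def[abs_def])
  then have y0': "square_integrable y0" "AE x in half_line. control_operator w f x = y0 x"
    by (auto simp: half_line_version_def)
  have yy0: "AE x in half_line. y x = y0 x"
    using Wf y0'(2) by eventually_elim simp
  have yc: "continuous_on {0<..} y"
    by (rule continuous_on_smooth[OF decaying_solution_smooth(1)[OF y]])
  have adjoint: "AE \<tau> in lborel. 0 \<le> \<tau> \<longrightarrow> y0 \<tau> + V.transposed y0 \<tau> = exp (- k * \<tau>)"
    using yy0[unfolded AE_half_line] AE_lborel_singleton[of 0]
  proof eventually_elim
    case (elim \<tau>)
    show ?case
    proof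
      assume "0 \<le> \<tau>"
      then have "0 < \<tau>" using elim by simp
      then show "y0 \<tau> + V.transposed y0 \<tau> = exp (- k * \<tau>)"
        using transposed_eq_wave_adjoint[OF yc yy0 square_integrable_measurable[OF y0'(1)]]
          wave_adjoint_decaying_solution[OF k y] elim by simp
    qed
  qed
  let ?e = "\<lambda>\<tau>. exp (- k * \<tau>)"
  let ?cut_exp = "\<lambda>\<tau>. indicator {0..} \<tau> * exp (- k * \<tau>)"
  have e: "half_line_version ?e ?cut_exp"
  proof -
    have "(\<lambda>x. exp (- (2 * k) * x)) absolutely_integrable_on {0..}"
      using k by (intro nonnegative_absolutely_integrable_1 integrable_on_exp_minus_to_infinity) auto
    then have "integrable lebesgue (\<lambda>x. indicator {0..} x * exp (- (2 * k) * x))"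
      by (simp add: set_integrable_def)
    then have "integrable lborel (\<lambda>x. indicator {0..} x * exp (- (2 * k) * x))"
      by (subst (asm) integrable_completion) auto
    moreover have "(?cut_exp x)\<^sup>2 = indicator {0..} x * exp (- (2 * k) * x)" for x
      by (simp add: power2_eq_square indicator_def flip: exp_add)
    ultimately have "square_integrable ?cut_exp"
      unfolding square_integrable_def by simp
    moreover have "?e \<in> borel_measurable half_line"
      by (intro measurable_restrict_space1 measurable_completion) simp
    ultimately show ?thesis
      by (auto simp: half_line_version_def AE_half_line)
  qed
  have gram: "L2_inner (control_operator w \<phi>) (control_operator w f) = L2_inner \<phi> ?e" if "\<phi> \<in> L2" for \<phi>
  proof -
    obtain \<phi>0 where \<phi>0: "half_line_version \<phi> \<phi>0" using L2_version[OF \<open>\<phi> \<in> L2\<close>] by blast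
    then have \<phi>0': "square_integrable \<phi>0" "\<And>s. s < 0 \<Longrightarrow> \<phi>0 s = 0"
      by (auto simp: half_line_version_def)
    have i1: "integrable lborel (\<lambda>x. \<phi>0 x * y0 x)"
      by (rule square_integrable_product[OF \<phi>0'(1) y0'(1)])
    have i2: "integrable lborel (\<lambda>x. V.operator \<phi>0 x * y0 x)"
      by (rule square_integrable_product[OF V.operator_square_integrable[OF \<phi>0'(1)] y0'(1)])
    have tr: "square_integrable (V.transposed y0)"
      by (rule V.transposed_square_integrable[OF y0'(1)])
    have "L2_inner (control_operator w \<phi>) (control_operator w f) = (LINT x|lborel. (\<phi>0 x + V.operator \<phi>0 x) * y0 x)"
      by (rule L2_inner_version[OF control_operator_version[OF \<phi>0] y0])
    also have "\<dots> = (LINT x|lborel. \<phi>0 x * y0 x) + (LINT x|lborel. V.operator \<phi>0 x * y0 x)"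
      using i1 i2 by (simp add: distrib_right)
    also have "(LINT x|lborel. V.operator \<phi>0 x * y0 x) = (LINT x|lborel. \<phi>0 x * V.transposed y0 x)"
      by (rule V.duality[OF \<phi>0'(1) y0'(1)])
    also have "(LINT x|lborel. \<phi>0 x * y0 x) + \<dots> = (LINT x|lborel. \<phi>0 x * (y0 x + V.transposed y0 x))"
      using i1 square_integrable_product[OF \<phi>0'(1) tr] by (simp add: distrib_left)
    also have "\<dots> = (LINT x|lborel. \<phi>0 x * ?cut_exp x)"
    proof (rule integral_cong_AE)
      show "AE x in lborel. \<phi>0 x * (y0 x + V.transposed y0 x) = \<phi>0 x * ?cut_exp x"
        using adjoint by eventually_elim (auto simp: \<phi>0'(2) not_le indicator_def)
      show "(\<lambda>x. \<phi>0 x * (y0 x + V.transposed y0 x)) \<in> borel_measurable lborel"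
        using \<phi>0'(1) y0'(1) tr
        by (intro borel_measurable_times borel_measurable_add) (simp_all add: square_integrable_def)
      show "(\<lambda>x. \<phi>0 x * ?cut_exp x) \<in> borel_measurable lborel"
        using square_integrable_measurable[OF \<phi>0'(1)] by simp
    qed
    also have "\<dots> = L2_inner \<phi> ?e"
      by (rule L2_inner_version[OF \<phi>0 e, symmetric])
    finally show ?thesis .
  qed
  then show "connecting_maps w f ?e"
    using half_line_version_L2[OF e] by (simp add: connecting_maps_def adjoint_maps_def)
  show "\<forall>g\<in>L2. connecting_maps w g ?e \<longrightarrow> (AE \<tau> in half_line. g \<tau> = f \<tau>)"
  proof (intro ballI impI)
    fix g assume g: "g \<in> L2" "connecting_maps w g ?e"
    obtain g0 where g0: "half_line_version g g0" using L2_version[OF g(1)] by blast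
    then have g0': "square_integrable g0" "\<And>s. s < 0 \<Longrightarrow> g0 s = 0" "AE s in half_line. g s = g0 s"
      by (auto simp: half_line_version_def)
    \<comment> \<open>Both candidates give the same inner product with \<open>W h\<close>, so \<open>W h\<close> is orthogonal to itself.\<close>
    define h where "h s = g0 s + - f0 s" for s
    have h: "square_integrable h"
      unfolding h_def[abs_def] by (intro square_integrable_add square_integrable_minus g0' f0')
    have hv: "half_line_version h h"
    proof -
      have "h \<in> borel_measurable half_line"
        using square_integrable_measurable[OF h] by (intro measurable_restrict_space1 measurable_completion) simp
      moreover have "h s = 0" if "s < 0" for s
        using that g0'(2) f0'(2) by (simp add: h_def)
      ultimately show ?thesis using h by (simp add: half_line_version_def)
    qed
    define z where "z x = h x + V.operator h x" for x
    have z: "square_integrable z"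
      unfolding z_def[abs_def] by (intro square_integrable_add h V.operator_square_integrable)
    define z0 where "z0 x = g0 x + V.operator g0 x" for x
    have z0: "square_integrable z0"
      unfolding z0_def[abs_def] by (intro square_integrable_add g0' V.operator_square_integrable)
    have zz: "z x = z0 x + - y0 x" for x
    proof -
      have "V.operator g0 x = V.operator (\<lambda>s. h s + f0 s) x" by (simp add: h_def)
      also have "\<dots> = V.operator h x + V.operator f0 x" by (rule V.operator_add[OF h f0'(1)])
      finally show ?thesis by (simp add: z_def z0_def y0_def h_def)
    qed
    have "L2_inner (control_operator w h) (control_operator w g) = L2_inner (control_operator w h) (control_operator w f)"
      using g(2) gram[OF half_line_version_L2[OF hv]] half_line_version_L2[OF hv]
      by (simp add: connecting_maps_def adjoint_maps_def)
    then have "(LINT x|lborel. z x * z0 x) = (LINT x|lborel. z x * y0 x)"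
      using L2_inner_version[OF control_operator_version[OF hv] control_operator_version[OF g0]]
        L2_inner_version[OF control_operator_version[OF hv] y0]
      by (simp add: z_def z0_def)
    moreover have "(z x)\<^sup>2 = z x * z0 x - z x * y0 x" for x
    proof -
      have "(z x)\<^sup>2 = z x * (z0 x + - y0 x)"
        unfolding power2_eq_square by (rule arg_cong[OF zz])
      then show ?thesis by (simp add: algebra_simps)
    qed
    ultimately have "(LINT x|lborel. (z x)\<^sup>2) = 0"
      using square_integrable_product[OF z z0] square_integrable_product[OF z y0'(1)] by simp
    then have "AE x in lborel. z x = 0"
      using z by (subst (asm) integral_nonneg_eq_0_iff_AE) (simp_all add: square_integrable_def)
    then have "AE x in lborel. h x = 0"
      using Volterra_injective[OF K_bounded_kernel K_zero(1) h] by (simp add: z_def)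
    then show "AE \<tau> in half_line. g \<tau> = f \<tau>"
      using g0'(3) f0'(3) unfolding AE_half_line by eventually_elim (simp add: h_def)
  qed
  have R: "(LINT s|half_line. r (\<tau> + s) * f s) = (LINT s|lborel. indicator {0..} s * (r (\<tau> + s) * f0 s))"
    if \<tau>: "0 \<le> \<tau>" for \<tau>
  proof -
    have rc: "continuous_on {0..} (\<lambda>s. r (\<tau> + s))"
      using \<tau> by (intro continuous_on_compose2[OF continuous_on_smooth[OF r_smooth]] continuous_intros) auto
    have rm: "(\<lambda>s. r (\<tau> + s)) \<in> borel_measurable half_line"
      by (rule continuous_imp_measurable_on_sets_lebesgue[OF rc]) simp
    have "(LINT s|half_line. r (\<tau> + s) * f s) = (LINT s|half_line. r (\<tau> + s) * f0 s)"
    proof (rule integral_cong_AE)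
      show "AE s in half_line. r (\<tau> + s) * f s = r (\<tau> + s) * f0 s"
        using f0'(3) by eventually_elim simp
      show "(\<lambda>s. r (\<tau> + s) * f s) \<in> borel_measurable half_line"
        using f0 by (intro borel_measurable_times rm) (simp add: half_line_version_def)
      show "(\<lambda>s. r (\<tau> + s) * f0 s) \<in> borel_measurable half_line"
        using square_integrable_measurable[OF f0'(1)]
        by (intro borel_measurable_times rm measurable_restrict_space1 measurable_completion) simp
    qed
    also have "\<dots> = (LINT s|lebesgue. indicator {0..} s *\<^sub>R (r (\<tau> + s) * f0 s))"
      by (rule integral_restrict_space) simp
    also have "\<dots> = (LINT s|lborel. indicator {0..} s *\<^sub>R (r (\<tau> + s) * f0 s))"
    proof (rule integral_completion)
      have "(\<lambda>s. (indicator {0..} s *\<^sub>R r (\<tau> + s)) * f0 s) \<in> borel_measurable lborel"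
        using borel_measurable_continuous_on_indicator[OF _ rc] square_integrable_measurable[OF f0'(1)] by simp
      then show "(\<lambda>s. indicator {0..} s *\<^sub>R (r (\<tau> + s) * f0 s)) \<in> borel_measurable lborel"
        by (simp add: mult.assoc)
    qed
    finally show ?thesis by simp
  qed
  show "AE \<tau> in half_line. f \<tau> + (LINT s|half_line. r (\<tau> + s) * f s) = ?e \<tau>"
    unfolding AE_half_line using adjoint f0'(3)[unfolded AE_half_line]
  proof eventually_elim
    case (elim \<tau>)
    show ?case
    proof
      assume \<tau>: "0 \<le> \<tau>"
      have "f \<tau> + (LINT s|half_line. r (\<tau> + s) * f s) = f0 \<tau> + (V.operator f0 \<tau> + V.transposed y0 \<tau>)"
        using elim \<tau> control_gram[OF f0'(1,2) \<tau>] R[OF \<tau>] by (simp add: y0_def[abs_def])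
      also have "\<dots> = ?e \<tau>"
        using elim \<tau> by (simp add: y0_def[of \<tau>])
      finally show "f \<tau> + (LINT s|half_line. r (\<tau> + s) * f s) = ?e \<tau>" .
    qed
  qed
qed

end

theorem theorem8:
  fixes q r y f :: "real \<Rightarrow> real" and w :: "real \<times> real \<Rightarrow> real" and a k :: real
  assumes "0 \<le> a"
    and "smooth_on {0..} q"
    and "closure {x. 0 \<le> x \<and> q x \<noteq> 0} \<subseteq> {0..a}"
    and "fundamental_solution q w"
    and "response_function a w r"
    and "0 < k"
    and "decaying_solution q a k y"
    and "f \<in> L2"
    and "AE x in half_line. control_operator w f x = y x"
  shows "connecting_maps w f (\<lambda>\<tau>. exp (- k * \<tau>)) \<and>
    (\<forall>g\<in>L2. connecting_maps w g (\<lambda>\<tau>. exp (- k * \<tau>)) \<longrightarrow> (AE \<tau> in half_line. g \<tau> = f \<tau>)) \<and>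
    (AE \<tau> in half_line. f \<tau> + (LINT s|half_line. r (\<tau> + s) * f s) = exp (- k * \<tau>))"
proof -
  interpret scattering q r w a
    by unfold_locales (use assms in auto)
  show ?thesis
    using inverse_image_of_decaying_solution[OF assms(6-9)] by blast
qed

end
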